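(* Let $G$ be a discrete group such that every finitely generated subgroup $H \leq G$ is residually finite and has a subnormal series $\{1\} = H_0 \triangleleft H_1 \triangleleft \cdots \triangleleft H_n = H$ in which each quotient $H_{i+1}/H_i$ is locally virtually abelian. Let $(G, X, 0)$ be an expansive $0$-gluing pointed dynamical system with dense homoclinic points. Then every asymptotically nilpotent endomorphism $f : X \to X$ is nilpotent.
   Context: A group is locally $\mathcal{P}$ if all its finitely generated subgroups have $\mathcal{P}$, and virtually $\mathcal{P}$ if it has a finite-index subgroup with $\mathcal{P}$. A pointed dynamical system $(G,X,0)$ consists of a discrete group $G$, a compact metric space $(X,d_X)$, a continuous left action of $G$ on $X$, and a point $0 \in X$ with $g\cdot 0 = 0$ for all $g \in G$. It is expansive if there is $0<\Delta\le 1$ such that $d_X(g\cdot x, g\cdot y)\le \Delta$ for all $g\in G$ implies $x=y$. A point $x \in X$ is homoclinic if for every $\epsilon>0$ there is a finite $E\subseteq G$ with $d_X(g\cdot x,0)<\epsilon$ for all $g\in G\setminus E$. The system has dense homoclinic points if the homoclinic points are dense in $X$. For $A,E\subseteq G$ let $\partial_E A=\{g\in A : Eg\not\subseteq A\}$. A designation is a family $(A_i,x_i)_{i\in I}$ with $x_i\in X$ and $(A_i)_{i\in I}$ a partition of $G$. It is a $(\delta,E)$-designation if $d_X(g\cdot x_i,0)<\delta$ for all $i\in I$ and $g\in\partial_E A_i$. An $\epsilon$-realization of it is a point $y\in X$ with $d_X(g\cdot y,g\cdot x_i)<\epsilon$ whenever $i \in I$ and $g\in A_i$. The system is $0$-gluing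 if for all $\epsilon>0$ there exist $\delta>0$ and a finite $E\subseteq G$ such that every $(\delta,E)$-designation has an $\epsilon$-realization. An endomorphism is a continuous map $f:X\to X$ with $f(0)=0$ and $f(g\cdot x)=g\cdot f(x)$ for all $g\in G$, $x\in X$. It is asymptotically nilpotent if $\lim_{n\to\infty}f^n(x)=0$ for all $x\in X$, and nilpotent if $f^n(X)=\{0\}$ for some $n\in\mathbb{N}$. *)

theory Defs
  imports
    "HOL-Analysis.Analysis"
    "HOL-Algebra.Generated_Groups"
    "HOL-Algebra.Group_Action"
begin

section \<open>Group theory\<close>

definition finitely_generated :: "('g, 'b) monoid_scheme \<Rightarrow> bool" where
  "finitely_generated G \<longleftrightarrow>
     (\<exists>S. finite S \<and> S \<subseteq> carrier G \<and> carrier G = generate G S)"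

text \<open>The name \<open>locally\<close> is taken by the topological notion of HOL-Analysis.\<close>

definition group_locally ::
    "(('g, 'b) monoid_scheme \<Rightarrow> bool) \<Rightarrow> ('g, 'b) monoid_scheme \<Rightarrow> bool" where
  "group_locally P G \<longleftrightarrow>
     (\<forall>H. subgroup H G \<longrightarrow> finitely_generated (G\<lparr>carrier := H\<rparr>) \<longrightarrow> P (G\<lparr>carrier := H\<rparr>))"

definition group_virtually ::
    "(('g, 'b) monoid_scheme \<Rightarrow> bool) \<Rightarrow> ('g, 'b) monoid_scheme \<Rightarrow> bool" where
  "group_virtually P G \<longleftrightarrow>
     (\<exists>H. subgroup H G \<and> finite (rcosets\<^bsub>G\<^esub> H) \<and> P (G\<lparr>carrier := H\<rparr>))"

definition residually_finite :: "('g, 'b) monoid_scheme \<Rightarrow> bool" where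
  "residually_finite G \<longleftrightarrow>
     (\<forall>g\<in>carrier G. g \<noteq> \<one>\<^bsub>G\<^esub> \<longrightarrow> (\<exists>N. N \<lhd> G \<and> finite (rcosets\<^bsub>G\<^esub> N) \<and> g \<notin> N))"

definition has_subnormal_series ::
    "('g set monoid \<Rightarrow> bool) \<Rightarrow> ('g, 'b) monoid_scheme \<Rightarrow> bool" where
  "has_subnormal_series P G \<longleftrightarrow>
     (\<exists>(n::nat) H. H 0 = {\<one>\<^bsub>G\<^esub>} \<and> H n = carrier G \<and>
        (\<forall>i\<le>n. subgroup (H i) G) \<and>
        (\<forall>i<n. H i \<lhd> (G\<lparr>carrier := H (Suc i)\<rparr>) \<and>
               P ((G\<lparr>carrier := H (Suc i)\<rparr>) Mod H i)))"


section \<open>Pointed dynamical systems\<close>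

text \<open>
  Since the group is discrete, continuity of the action means that every group element
  acts continuously. The library locale \<open>group_action\<close> requires each \<open>\<phi> g\<close> to be a bijection
  of \<open>X\<close> that is \<open>undefined\<close> outside \<open>X\<close>. The distinguished point, written $0$ in the
  mathematics, is \<open>z\<close>.
\<close>

locale pointed_dynamical_system = group_action G X \<phi>
  for G :: "('g, 'b) monoid_scheme" (structure)
    and X :: "'x::metric_space set"
    and \<phi> :: "'g \<Rightarrow> 'x \<Rightarrow> 'x" +
  fixes z :: 'x
  assumes compact_space: "compact X"
    and continuous_action: "g \<in> carrier G \<Longrightarrow> continuous_on X (\<phi> g)"
    and point_in_space: "z \<in> X"
    and point_fixed: "g \<in> carrier G \<Longrightarrow> \<phi> g z = z"

definition expansive ::
    "('g, 'b) monoid_scheme \<Rightarrow> 'x::metric_space set \<Rightarrow> ('g \<Rightarrow> 'x \<Rightarrow> 'x) \<Rightarrow> bool" where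
  "expansive G X \<phi> \<longleftrightarrow>
     (\<exists>\<Delta>::real. 0 < \<Delta> \<and> \<Delta> \<le> 1 \<and>
        (\<forall>x\<in>X. \<forall>y\<in>X. (\<forall>g\<in>carrier G. dist (\<phi> g x) (\<phi> g y) \<le> \<Delta>) \<longrightarrow> x = y))"

definition homoclinic ::
    "('g, 'b) monoid_scheme \<Rightarrow> ('g \<Rightarrow> 'x::metric_space \<Rightarrow> 'x) \<Rightarrow> 'x \<Rightarrow> 'x \<Rightarrow> bool" where
  "homoclinic G \<phi> z x \<longleftrightarrow>
     (\<forall>\<epsilon>>0. \<exists>E. finite E \<and> E \<subseteq> carrier G \<and> (\<forall>g\<in>carrier G - E. dist (\<phi> g x) z < \<epsilon>))"

definition dense_homoclinic_points ::
    "('g, 'b) monoid_scheme \<Rightarrow> 'x::metric_space set \<Rightarrow> ('g \<Rightarrow> 'x \<Rightarrow> 'x) \<Rightarrow> 'x \<Rightarrow> bool" where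
  "dense_homoclinic_points G X \<phi> z \<longleftrightarrow> X \<subseteq> closure {x \<in> X. homoclinic G \<phi> z x}"


section \<open>Gluing\<close>

definition boundary :: "('g, 'b) monoid_scheme \<Rightarrow> 'g set \<Rightarrow> 'g set \<Rightarrow> 'g set" where
  "boundary G E A = {g \<in> A. \<not> E #>\<^bsub>G\<^esub> g \<subseteq> A}"

text \<open>Empty parts are allowed; they impose no condition below.\<close>

definition designation ::
    "('g, 'b) monoid_scheme \<Rightarrow> 'x set \<Rightarrow> 'i set \<Rightarrow> ('i \<Rightarrow> 'g set) \<Rightarrow> ('i \<Rightarrow> 'x) \<Rightarrow> bool" where
  "designation G X I A x \<longleftrightarrow>
     disjoint_family_on A I \<and> (\<Union>i\<in>I. A i) = carrier G \<and> (\<forall>i\<in>I. x i \<in> X)"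

definition de_designation ::
    "('g, 'b) monoid_scheme \<Rightarrow> 'x::metric_space set \<Rightarrow> ('g \<Rightarrow> 'x \<Rightarrow> 'x) \<Rightarrow> 'x \<Rightarrow>
     real \<Rightarrow> 'g set \<Rightarrow> 'i set \<Rightarrow> ('i \<Rightarrow> 'g set) \<Rightarrow> ('i \<Rightarrow> 'x) \<Rightarrow> bool" where
  "de_designation G X \<phi> z \<delta> E I A x \<longleftrightarrow>
     designation G X I A x \<and> (\<forall>i\<in>I. \<forall>g\<in>boundary G E (A i). dist (\<phi> g (x i)) z < \<delta>)"

definition realization ::
    "'x::metric_space set \<Rightarrow> ('g \<Rightarrow> 'x \<Rightarrow> 'x) \<Rightarrow> real \<Rightarrow>
     'i set \<Rightarrow> ('i \<Rightarrow> 'g set) \<Rightarrow> ('i \<Rightarrow> 'x) \<Rightarrow> 'x \<Rightarrow> bool" where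
  "realization X \<phi> \<epsilon> I A x y \<longleftrightarrow>
     y \<in> X \<and> (\<forall>i\<in>I. \<forall>g\<in>A i. dist (\<phi> g y) (\<phi> g (x i)) < \<epsilon>)"

text \<open>
  A definition cannot quantify over index types, so the index sets are subsets of the type
  of group elements. This covers index sets in every type: drop the empty parts and index
  each remaining part by one of its elements. See the lemma after the definition.
\<close>

definition zero_gluing ::
    "('g, 'b) monoid_scheme \<Rightarrow> 'x::metric_space set \<Rightarrow> ('g \<Rightarrow> 'x \<Rightarrow> 'x) \<Rightarrow> 'x \<Rightarrow> bool" where
  "zero_gluing G X \<phi> z \<longleftrightarrow>
     (\<forall>\<epsilon>>0. \<exists>\<delta>>0. \<exists>E. finite E \<and> E \<subseteq> carrier G \<and>
        (\<forall>(I :: 'g set) A x. de_designation G X \<phi> z \<delta> E I A x \<longrightarrow>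
           (\<exists>y. realization X \<phi> \<epsilon> I A x y)))"

lemma zero_gluing_any_index_type:
  fixes G :: "('g, 'b) monoid_scheme" and X :: "'x::metric_space set"
  assumes "zero_gluing G X \<phi> z" and "\<epsilon> > 0"
  shows "\<exists>\<delta>>0. \<exists>E. finite E \<and> E \<subseteq> carrier G \<and>
           (\<forall>(I :: 'i set) A x. de_designation G X \<phi> z \<delta> E I A x \<longrightarrow>
              (\<exists>y. realization X \<phi> \<epsilon> I A x y))"
proof -
  from assms obtain \<delta> where "\<delta> > 0"
    and "\<exists>E. finite E \<and> E \<subseteq> carrier G \<and>
           (\<forall>(I :: 'g set) A x. de_designation G X \<phi> z \<delta> E I A x \<longrightarrow>
              (\<exists>y. realization X \<phi> \<epsilon> I A x y))"
    unfolding zero_gluing_def by meson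
  then obtain E where E: "finite E" "E \<subseteq> carrier G"
    and real: "\<forall>(I :: 'g set) A x. de_designation G X \<phi> z \<delta> E I A x \<longrightarrow>
                 (\<exists>y. realization X \<phi> \<epsilon> I A x y)"
    by (elim exE conjE)
  have "\<exists>y. realization X \<phi> \<epsilon> I A x y"
    if des: "de_designation G X \<phi> z \<delta> E I A x"
    for I :: "'i set" and A :: "'i \<Rightarrow> 'g set" and x :: "'i \<Rightarrow> 'x"
  proof -
    define J where "J = {i \<in> I. A i \<noteq> {}}"
    define c where "c i = (SOME g. g \<in> A i)" for i
    define d where "d = the_inv_into J c"
    have c: "c i \<in> A i" if "i \<in> J" for i
      using that unfolding J_def c_def by (simp add: some_in_eq)
    have disj: "disjoint_family_on A I" and un: "(\<Union>i\<in>I. A i) = carrier G"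
      using des unfolding de_designation_def designation_def by blast+
    have inj: "inj_on c J"
    proof (rule inj_onI, rule ccontr)
      fix i j assume ij: "i \<in> J" "j \<in> J" "c i = c j" "i \<noteq> j"
      then have "A i \<inter> A j = {}"
        using disj unfolding disjoint_family_on_def J_def by blast
      moreover have "c i \<in> A i" "c i \<in> A j"
        using c[OF ij(1)] c[OF ij(2)] ij(3) by simp_all
      ultimately show False by blast
    qed
    have d: "d (c i) = i" if "i \<in> J" for i
      using the_inv_into_f_f[OF inj that] by (simp add: d_def)
    have JI: "i \<in> I" if "i \<in> J" for i
      using that by (simp add: J_def)
    have "de_designation G X \<phi> z \<delta> E (c ` J) (A \<circ> d) (x \<circ> d)"
      unfolding de_designation_def designation_def
    proof (intro conjI)
      show "disjoint_family_on (A \<circ> d) (c ` J)"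
        unfolding disjoint_family_on_def
      proof (intro ballI impI)
        fix m n assume mn: "m \<in> c ` J" "n \<in> c ` J" "m \<noteq> n"
        then obtain i j where ij: "i \<in> J" "j \<in> J" "m = c i" "n = c j"
          by blast
        with mn(3) have "i \<noteq> j" by blast
        then have "A i \<inter> A j = {}"
          using disj JI ij(1,2) unfolding disjoint_family_on_def by blast
        then show "(A \<circ> d) m \<inter> (A \<circ> d) n = {}"
          by (simp add: ij d)
      qed
      have "(\<Union>i\<in>c ` J. (A \<circ> d) i) = (\<Union>i\<in>J. A i)"
        by (simp add: d)
      also have "\<dots> = (\<Union>i\<in>I. A i)"
        unfolding J_def by blast
      finally show "(\<Union>i\<in>c ` J. (A \<circ> d) i) = carrier G"
        using un by simp
      show "\<forall>i\<in>c ` J. (x \<circ> d) i \<in> X"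
        using des JI by (simp add: d de_designation_def designation_def)
      show "\<forall>i\<in>c ` J. \<forall>g\<in>boundary G E ((A \<circ> d) i). dist (\<phi> g ((x \<circ> d) i)) z < \<delta>"
        using des JI by (simp add: d de_designation_def)
    qed
    from real[rule_format, OF this]
    obtain y where "realization X \<phi> \<epsilon> (c ` J) (A \<circ> d) (x \<circ> d) y" ..
    then have y: "y \<in> X" and yJ: "\<forall>i\<in>J. \<forall>g\<in>A i. dist (\<phi> g y) (\<phi> g (x i)) < \<epsilon>"
      by (simp_all add: realization_def d)
    then have "realization X \<phi> \<epsilon> I A x y"
      unfolding realization_def J_def by blast
    then show ?thesis by (rule exI)
  qed
  with \<open>\<delta> > 0\<close> E show ?thesis
    by (intro exI[of _ \<delta>] exI[of _ E] conjI allI impI)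
qed


section \<open>Endomorphisms\<close>

definition system_endomorphism ::
    "('g, 'b) monoid_scheme \<Rightarrow> 'x::metric_space set \<Rightarrow> ('g \<Rightarrow> 'x \<Rightarrow> 'x) \<Rightarrow> 'x \<Rightarrow> ('x \<Rightarrow> 'x) \<Rightarrow> bool" where
  "system_endomorphism G X \<phi> z f \<longleftrightarrow>
     f \<in> X \<rightarrow> X \<and> continuous_on X f \<and> f z = z \<and>
     (\<forall>g\<in>carrier G. \<forall>x\<in>X. f (\<phi> g x) = \<phi> g (f x))"

definition asymptotically_nilpotent ::
    "'x::metric_space set \<Rightarrow> 'x \<Rightarrow> ('x \<Rightarrow> 'x) \<Rightarrow> bool" where
  "asymptotically_nilpotent X z f \<longleftrightarrow> (\<forall>x\<in>X. (\<lambda>n. (f ^^ n) x) \<longlonglongrightarrow> z)"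

definition nilpotent_map :: "'x set \<Rightarrow> 'x \<Rightarrow> ('x \<Rightarrow> 'x) \<Rightarrow> bool" where
  "nilpotent_map X z f \<longleftrightarrow> (\<exists>n::nat. (f ^^ n) ` X = {z})"

end

theory Submission
  imports Defs
begin

text \<open>
  An expansive system with the gluing property behaves like a full shift over the group, and an
  endomorphism like a cellular automaton: the support of a point \<open>x\<close> consists of the \<open>g\<close> for which
  \<open>\<phi> g x\<close> is not very close to \<open>z\<close>, points are determined by what they look like on all windows,
  \<open>f\<close> is given by a local rule with a finite window \<open>E\<close>, and points can be merged along borders at
  which they are invisible. Call a point dying if some iterate of \<open>f\<close> maps it to \<open>z\<close>. An orbit visits
  \<open>g\<close> at time \<open>n\<close> if \<open>g\<close> is in the support of its \<open>n\<close>-th point; by asymptotic nilpotency a finite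
  set is visited up to some time only.

  The source of uniformity is a Baire category argument (\<open>finally_quiet\<close>): every nonempty class of points
  has a member \<open>x\<close> such that all members near \<open>x\<close> stop visiting a given finite set at a common time.
  For dying points it has a strong consequence (\<open>dying_spread_bounded\<close>). A dying point can be merged with
  any other one that is far away, because it is gone before they interact. So a dying homoclinic point
  whose support avoids a certain finite set never visits \<open>\<one>\<close>; the same holds with finitely many left
  cosets of a subgroup in place of finite sets. Consequently the orbit of a dying point visits, in a uniform
  sense, only what is close to its support, and if all homoclinic points are dying, then \<open>f\<close> is nilpotent
  (\<open>nilpotent_if_homoclinic_dying\<close>).

  It remains to show that each homoclinic point \<open>x0\<close> is dying. Consider superpositions of translates of
  \<open>x0\<close>. A subgroup \<open>B\<close> is confined if the superpositions with positions in \<open>B\<close> visit only finitely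
  many left cosets of \<open>B\<close>. The whole group is confined, and \<open>x0\<close> is dying if the trivial group is
  confined. Confinement passes to subgroups of finite index and to suitable finitely generated subgroups. By
  means of these, a subnormal series with locally virtually abelian quotients reduces everything to one
  step: \<open>B\<close> is confined and \<open>N\<close> is a normal subgroup of \<open>B\<close> with infinite cyclic quotient, and \<open>N\<close> is
  to be shown to be confined (\<open>confined_N\<close>).

  By residual finiteness, \<open>N\<close> contains arbitrarily sparse subgroups \<open>L\<close> of finite index that are normalized
  by \<open>B\<close>. Modulo \<open>L\<close>, the group \<open>B\<close> looks like the group of integers. Repeat a finite pattern of positions
  in \<open>N\<close> along \<open>L\<close> and along finitely many cosets of \<open>N\<close> in \<open>B\<close>. The Baire argument yields such a
  configuration that becomes a wall: the two sides of it do not interact any more, whatever is placed far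
  away (\<open>quiet_walls\<close>). Now put two copies of the wall at a large distance. What happens between them
  takes place in finitely many cosets of \<open>L\<close>, so it dies; and then it remains close to the walls, at a
  distance that does not depend on the distance of the walls (\<open>trapped_between_walls\<close>). Letting the latter
  tend to infinity, one concludes that a single wall visits finitely many cosets of \<open>L\<close> only, and it is
  dying as well (\<open>dying_row\<close>). Thus superpositions with positions in \<open>N\<close> are approximated by dying ones,
  and the bound on the spread of dying points, for left cosets of \<open>N\<close>, gives the confinement of \<open>N\<close>.
\<close>

section \<open>Local rules and merging\<close>

context group
begin

lemma mem_set_mult: "g \<in> A <#> B \<longleftrightarrow> (\<exists>a\<in>A. \<exists>b\<in>B. g = a \<otimes> b)"
  by (auto simp: set_mult_def)

lemma set_multI: "a \<in> A \<Longrightarrow> b \<in> B \<Longrightarrow> a \<otimes> b \<in> A <#> B"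
  by (auto simp: set_mult_def)

lemma set_multE:
  assumes "g \<in> A <#> B"
  obtains a b where "a \<in> A" "b \<in> B" "g = a \<otimes> b"
  using assms by (auto simp: mem_set_mult)

lemma finite_set_mult: "finite A \<Longrightarrow> finite B \<Longrightarrow> finite (A <#> B)"
  by (simp add: set_mult_def)

end

text \<open>
  The constants under which \<open>f\<close> behaves like a cellular automaton with window \<open>E\<close>. The number
  \<open>4 * \<eta>\<close> is an expansivity constant, which leaves room for adding a few errors of size \<open>\<eta>\<close>.
  Closeness up to \<open>4 * \<eta>\<close> on \<open>E\<close> implies the much better closeness up to \<open>\<delta>\<close> for the points
  and for their images, and this gain is what keeps errors from accumulating under iteration.
\<close>

locale windowed_endomorphism = pointed_dynamical_system G X \<phi> z
  for G :: "('g, 'b) monoid_scheme" (structure)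
    and X :: "'x::metric_space set" and \<phi> and z +
  fixes f :: "'x \<Rightarrow> 'x" and \<eta> \<delta> :: real and E :: "'g set"
  assumes endo: "system_endomorphism G X \<phi> z f"
    and asym: "asymptotically_nilpotent X z f"
    and threshold: "0 < \<delta>" "\<delta> \<le> \<eta>"
    and window: "finite E" "E \<subseteq> carrier G" "\<one> \<in> E" "\<And>h. h \<in> E \<Longrightarrow> inv h \<in> E"
    and window_determines: "\<And>\<epsilon>. 0 < \<epsilon> \<Longrightarrow> \<exists>K. finite K \<and> K \<subseteq> carrier G \<and>
          (\<forall>x\<in>X. \<forall>y\<in>X. (\<forall>g\<in>K. dist (\<phi> g x) (\<phi> g y) \<le> 4 * \<eta>) \<longrightarrow> dist x y < \<epsilon>)"
    and local_rule: "\<And>x y. x \<in> X \<Longrightarrow> y \<in> X \<Longrightarrow> (\<And>h. h \<in> E \<Longrightarrow> dist (\<phi> h x) (\<phi> h y) \<le> 4 * \<eta>) \<Longrightarrow>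
          dist x y < \<delta> \<and> dist (f x) (f y) < \<delta>"
    and glue: "\<And>v. v \<in> carrier G \<rightarrow> X \<Longrightarrow>
          (\<And>g h. g \<in> carrier G \<Longrightarrow> h \<in> E \<Longrightarrow> v (h \<otimes> g) \<noteq> v g \<Longrightarrow> dist (\<phi> g (v g)) z < \<delta>) \<Longrightarrow>
          \<exists>y\<in>X. \<forall>g\<in>carrier G. dist (\<phi> g y) (\<phi> g (v g)) < \<eta>"

sublocale pointed_dynamical_system \<subseteq> group G
  using group_hom group_hom.axioms(1) by blast

context windowed_endomorphism
begin

lemma E_carrier [simp]: "h \<in> E \<Longrightarrow> h \<in> carrier G"
  using window(2) by auto

lemma E_closed: "A \<subseteq> carrier G \<Longrightarrow> E <#> A \<subseteq> carrier G"
  by (rule set_mult_closed[OF window(2)])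

lemma E_finite: "finite A \<Longrightarrow> finite (E <#> A)"
  by (rule finite_set_mult[OF window(1)])

lemma act_closed [simp]: "g \<in> carrier G \<Longrightarrow> x \<in> X \<Longrightarrow> \<phi> g x \<in> X"
  using element_image by blast

lemma act_mult [simp]:
  "g \<in> carrier G \<Longrightarrow> h \<in> carrier G \<Longrightarrow> x \<in> X \<Longrightarrow> \<phi> (g \<otimes> h) x = \<phi> g (\<phi> h x)"
  using composition_rule by blast

lemma act_one [simp]: "x \<in> X \<Longrightarrow> \<phi> \<one> x = x"
  using id_eq_one by (metis restrict_apply')

lemma act_inv [simp]: "g \<in> carrier G \<Longrightarrow> x \<in> X \<Longrightarrow> \<phi> (inv g) (\<phi> g x) = x"
  using orbit_sym_aux by blast

lemma act_inv' [simp]: "g \<in> carrier G \<Longrightarrow> x \<in> X \<Longrightarrow> \<phi> g (\<phi> (inv g) x) = x"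
  by (metis act_mult act_one inv_closed r_inv)

lemma z_in [simp]: "z \<in> X" and act_z [simp]: "g \<in> carrier G \<Longrightarrow> \<phi> g z = z"
  using point_in_space point_fixed by auto

lemma f_in [simp]: "x \<in> X \<Longrightarrow> f x \<in> X" and f_z [simp]: "f z = z"
  and f_cont: "continuous_on X f"
  and f_act: "g \<in> carrier G \<Longrightarrow> x \<in> X \<Longrightarrow> f (\<phi> g x) = \<phi> g (f x)"
  using endo by (auto simp: system_endomorphism_def)

lemma fn_in [simp]: "x \<in> X \<Longrightarrow> (f ^^ n) x \<in> X"
  by (induction n) auto

lemma fn_z [simp]: "(f ^^ n) z = z"
  by (induction n) auto

lemma fn_act: "g \<in> carrier G \<Longrightarrow> x \<in> X \<Longrightarrow> (f ^^ n) (\<phi> g x) = \<phi> g ((f ^^ n) x)"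
  by (induction n) (auto simp: f_act)

lemma fn_cont: "continuous_on X (f ^^ n)"
proof (induction n)
  case 0
  then show ?case by (simp add: id_def[symmetric])
next
  case (Suc n)
  have "continuous_on X (f \<circ> (f ^^ n))"
    by (rule continuous_on_compose[OF Suc]) (rule continuous_on_subset[OF f_cont], auto)
  then show ?case by simp
qed

text \<open>
  The analogue of the support of a configuration. Neighbours of \<open>g\<close> are the elements of \<open>E <#> {g}\<close>,
  on the left; the action moves supports by multiplication on the right.
\<close>

definition supp :: "'x \<Rightarrow> 'g set" where
  "supp x = {g \<in> carrier G. \<delta> \<le> dist (\<phi> g x) z}"

lemma visit_cont:
  assumes "g \<in> carrier G"
  shows "continuous_on X (\<lambda>x. dist (\<phi> g ((f ^^ n) x)) z)"
proof -
  have "continuous_on X (\<lambda>x. \<phi> g ((f ^^ n) x))"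
    by (rule continuous_on_compose2[OF continuous_action[OF assms] fn_cont]) auto
  then show ?thesis by (intro continuous_intros)
qed

text \<open>
  This plays the role of agreement on \<open>A\<close>. It is not transitive, but points that are near on the
  whole group are equal.
\<close>

definition near :: "'g set \<Rightarrow> 'x \<Rightarrow> 'x \<Rightarrow> bool" where
  "near A x y \<longleftrightarrow> (\<forall>g\<in>A. dist (\<phi> g x) (\<phi> g y) \<le> 4 * \<eta>)"

text \<open>
  The iterate \<open>f ^^ n\<close> on \<open>A\<close> depends on what happens on \<open>halo n A\<close> only.
\<close>

definition halo :: "nat \<Rightarrow> 'g set \<Rightarrow> 'g set" where
  "halo n A = ((\<lambda>B. E <#> B) ^^ n) A"

lemma halo_0 [simp]: "halo 0 A = A" and halo_Suc: "halo (Suc n) A = E <#> halo n A"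
  by (auto simp: halo_def)

lemma halo_Suc': "halo (Suc n) A = halo n (E <#> A)"
  by (simp add: halo_def funpow_swap1)

lemma halo_carrier: "A \<subseteq> carrier G \<Longrightarrow> halo n A \<subseteq> carrier G"
  by (induction n) (use set_mult_closed window(2) in \<open>auto simp: halo_Suc\<close>)

lemma halo_finite: "finite A \<Longrightarrow> finite (halo n A)"
  by (induction n) (auto simp: halo_Suc intro: finite_set_mult window)

lemma subset_E_mult: "A \<subseteq> carrier G \<Longrightarrow> A \<subseteq> E <#> A"
  using set_multI[OF window(3)] by force

lemma halo_increasing: "A \<subseteq> carrier G \<Longrightarrow> halo n A \<subseteq> halo (Suc n) A"
  unfolding halo_Suc by (rule subset_E_mult) (rule halo_carrier)

lemma halo_mono_index: "A \<subseteq> carrier G \<Longrightarrow> m \<le> n \<Longrightarrow> halo m A \<subseteq> halo n A"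
  using lift_Suc_mono_le[of "\<lambda>n. halo n A" m n] halo_increasing[of A] by simp

lemma halo_mono: "A \<subseteq> B \<Longrightarrow> halo n A \<subseteq> halo n B"
  by (induction n) (simp_all add: halo_Suc mono_set_mult)

lemma supp_carrier: "supp x \<subseteq> carrier G"
  by (auto simp: supp_def)

lemma supp_z [simp]: "supp z = {}"
  using threshold by (auto simp: supp_def)

lemma not_supp: "g \<in> carrier G \<Longrightarrow> g \<notin> supp x \<Longrightarrow> dist (\<phi> g x) z < \<delta>"
  by (auto simp: supp_def)

lemma supp_act:
  assumes "b \<in> carrier G" "x \<in> X" "g \<in> carrier G"
  shows "g \<in> supp (\<phi> b x) \<longleftrightarrow> g \<otimes> b \<in> supp x"
  using assms by (auto simp: supp_def)

lemma near_all_eq: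
  assumes "x \<in> X" "y \<in> X" "near (carrier G) x y"
  shows "x = y"
proof (rule ccontr)
  assume "x \<noteq> y"
  then obtain K where "K \<subseteq> carrier G"
    "\<forall>x'\<in>X. \<forall>y'\<in>X. (\<forall>g\<in>K. dist (\<phi> g x') (\<phi> g y') \<le> 4 * \<eta>) \<longrightarrow> dist x' y' < dist x y"
    using window_determines[of "dist x y"] by auto
  then show False using assms by (force simp: near_def)
qed

lemma near_step:
  assumes "x \<in> X" "y \<in> X" "A \<subseteq> carrier G" "near (E <#> A) x y" "g \<in> A"
  shows "dist (\<phi> g x) (\<phi> g y) < \<delta>" "dist (\<phi> g (f x)) (\<phi> g (f y)) < \<delta>"
proof -
  have g: "g \<in> carrier G" using assms by auto
  have "dist (\<phi> h (\<phi> g x)) (\<phi> h (\<phi> g y)) \<le> 4 * \<eta>" if "h \<in> E" for h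
  proof -
    have "h \<otimes> g \<in> E <#> A" using that assms by (auto intro: set_multI)
    then have "dist (\<phi> (h \<otimes> g) x) (\<phi> (h \<otimes> g) y) \<le> 4 * \<eta>"
      using assms(4) by (auto simp: near_def)
    then show ?thesis using that g assms by simp
  qed
  from local_rule[OF _ _ this]
  show "dist (\<phi> g x) (\<phi> g y) < \<delta>" "dist (\<phi> g (f x)) (\<phi> g (f y)) < \<delta>"
    using g assms by (auto simp: f_act)
qed

lemma near_iter:
  assumes "x \<in> X" "y \<in> X" "A \<subseteq> carrier G" "near (halo n A) x y"
  shows "near A ((f ^^ n) x) ((f ^^ n) y)"
  using assms
proof (induction n arbitrary: x y)
  case 0
  then show ?case by simp
next
  case (Suc n)
  have "dist (\<phi> g (f x)) (\<phi> g (f y)) < \<delta>" if "g \<in> halo n A" for g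
    using near_step(2)[of x y "halo n A" g] Suc that by (auto simp: halo_Suc halo_carrier)
  then have "near (halo n A) (f x) (f y)"
    using threshold unfolding near_def by fastforce
  from Suc.IH[OF _ _ _ this] Suc show ?case by (simp add: funpow_swap1)
qed

lemma near_iter_strict:
  assumes "x \<in> X" "y \<in> X" "A \<subseteq> carrier G" "near (halo (Suc n) A) x y" "g \<in> A"
  shows "dist (\<phi> g ((f ^^ n) x)) (\<phi> g ((f ^^ n) y)) < \<delta>"
proof -
  have "near (E <#> A) ((f ^^ n) x) ((f ^^ n) y)"
    using assms window(2) by (intro near_iter) (auto simp: halo_Suc' intro: set_mult_closed[THEN subsetD])
  from near_step(1)[OF _ _ assms(3) this assms(5)] assms show ?thesis by simp
qed

lemma near_z:
  assumes "supp x \<inter> A = {}" "A \<subseteq> carrier G"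
  shows "near A x z"
proof -
  have "dist (\<phi> g x) z \<le> 4 * \<eta>" if "g \<in> A" for g
    using not_supp[of g x] that assms threshold by fastforce
  then show ?thesis using assms(2) by (auto simp: near_def)
qed

lemma supp_iter_avoid:
  assumes "x \<in> X" "A \<subseteq> carrier G" "supp x \<inter> halo (Suc n) A = {}"
  shows "supp ((f ^^ n) x) \<inter> A = {}"
proof -
  have "near (halo (Suc n) A) x z"
    using assms halo_carrier by (intro near_z) auto
  from near_iter_strict[OF _ _ assms(2) this] show ?thesis
    using assms by (fastforce simp: supp_def)
qed

lemma near_small_supp:
  assumes "x \<in> X" "A \<subseteq> carrier G" "\<And>g. g \<in> E <#> A \<Longrightarrow> dist (\<phi> g x) z \<le> 4 * \<eta>"
  shows "supp x \<inter> A = {}"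
proof -
  have "near (E <#> A) x z"
    using assms E_closed[OF assms(2)] by (auto simp: near_def subset_iff)
  from near_step(1)[OF _ _ assms(2) this] show ?thesis
    using assms by (fastforce simp: supp_def)
qed

lemma E_sym: "g \<in> carrier G \<Longrightarrow> k \<in> carrier G \<Longrightarrow> h \<in> E \<Longrightarrow> k = h \<otimes> g \<Longrightarrow> g = inv h \<otimes> k"
  by (simp add: inv_solve_left)

lemma E_disjoint_swap:
  assumes "A \<subseteq> carrier G" "B \<subseteq> carrier G"
  shows "(E <#> A) \<inter> B = {} \<longleftrightarrow> A \<inter> (E <#> B) = {}"
proof -
  have *: "A \<inter> (E <#> B) = {}" if "(E <#> A) \<inter> B = {}" "A \<subseteq> carrier G" "B \<subseteq> carrier G" for A B
  proof (rule ccontr)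
    assume "A \<inter> (E <#> B) \<noteq> {}"
    then obtain h b where "h \<in> E" "b \<in> B" "h \<otimes> b \<in> A" by (auto simp: mem_set_mult)
    then have "inv h \<otimes> (h \<otimes> b) \<in> E <#> A" using window by (auto intro: set_multI)
    moreover have "inv h \<otimes> (h \<otimes> b) = b" using \<open>h \<in> E\<close> \<open>b \<in> B\<close> that E_sym[of b _ h] by fastforce
    ultimately show False using that \<open>b \<in> B\<close> by auto
  qed
  show ?thesis using *[of A B] *[of B A] assms by blast
qed

lemma supp_f: "x \<in> X \<Longrightarrow> supp (f x) \<subseteq> E <#> supp x"
proof
  fix g assume x: "x \<in> X" and g: "g \<in> supp (f x)"
  then have gc: "g \<in> carrier G" using supp_carrier by auto
  show "g \<in> E <#> supp x"
  proof (rule ccontr)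
    assume "g \<notin> E <#> supp x"
    then have "supp x \<inter> (E <#> {g}) = {}"
      using E_disjoint_swap[of "supp x" "{g}"] gc supp_carrier by auto
    then have "near (E <#> {g}) x z"
      using gc by (intro near_z set_mult_closed window) auto
    from near_step(2)[OF x _ _ this, of g] gc g show False by (auto simp: supp_def)
  qed
qed

lemma supp_fn: "x \<in> X \<Longrightarrow> supp ((f ^^ n) x) \<subseteq> halo n (supp x)"
proof (induction n)
  case 0
  then show ?case by simp
next
  case (Suc n)
  have "supp (f ((f ^^ n) x)) \<subseteq> E <#> supp ((f ^^ n) x)" using Suc.prems by (intro supp_f) simp
  also have "\<dots> \<subseteq> halo (Suc n) (supp x)"
    using Suc unfolding halo_Suc by (intro mono_set_mult) auto
  finally show ?case by simp
qed

text \<open>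
  The threshold in \<open>supp\<close> is sharp, so that a small error can make an element of the support
  disappear. It cannot make a whole window disappear, because a point that is within \<open>4 * \<eta>\<close> of
  \<open>z\<close> on a window is invisible in its middle.
\<close>

lemma supp_transfer:
  assumes "x \<in> X" "y \<in> X" "A \<subseteq> carrier G" "near (halo (Suc n) (E <#> A)) x y"
    "supp ((f ^^ n) y) \<inter> (E <#> A) = {}"
  shows "supp ((f ^^ n) x) \<inter> A = {}"
proof (rule near_small_supp)
  fix g assume g: "g \<in> E <#> A"
  have EA: "E <#> A \<subseteq> carrier G" by (intro set_mult_closed window assms)
  have "dist (\<phi> g ((f ^^ n) x)) (\<phi> g ((f ^^ n) y)) < \<delta>"
    using assms EA g by (intro near_iter_strict) auto
  moreover have "dist (\<phi> g ((f ^^ n) y)) z < \<delta>"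
    using g EA assms(5) by (intro not_supp) auto
  ultimately show "dist (\<phi> g ((f ^^ n) x)) z \<le> 4 * \<eta>"
    using dist_triangle[of "\<phi> g ((f ^^ n) x)" z "\<phi> g ((f ^^ n) y)"] threshold by linarith
qed (use assms in auto)

lemma supp_empty: "x \<in> X \<Longrightarrow> supp x = {} \<Longrightarrow> x = z"
  using near_z[of x "carrier G"] by (intro near_all_eq) auto

lemma eventually_off:
  assumes "x \<in> X" "finite W" "W \<subseteq> carrier G" "0 < \<epsilon>"
  shows "\<exists>N. \<forall>n\<ge>N. \<forall>g\<in>W. dist (\<phi> g ((f ^^ n) x)) z < \<epsilon>"
  using assms(2,3)
proof (induction W)
  case empty
  then show ?case by simp
next
  case (insert g W)
  then obtain N where N: "\<forall>n\<ge>N. \<forall>g\<in>W. dist (\<phi> g ((f ^^ n) x)) z < \<epsilon>" by auto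
  have "(\<lambda>n. (f ^^ n) (\<phi> g x)) \<longlonglongrightarrow> z"
    using asym insert assms by (auto simp: asymptotically_nilpotent_def)
  then obtain M where "\<forall>n\<ge>M. dist ((f ^^ n) (\<phi> g x)) z < \<epsilon>"
    using assms(4) unfolding lim_sequentially by blast
  then have "\<forall>n\<ge>max M N. \<forall>h\<in>insert g W. dist (\<phi> h ((f ^^ n) x)) z < \<epsilon>"
    using N insert assms by (auto simp: fn_act)
  then show ?case by blast
qed

lemma eventually_supp_off:
  assumes "x \<in> X" "finite W" "W \<subseteq> carrier G"
  shows "\<exists>N. \<forall>n\<ge>N. supp ((f ^^ n) x) \<inter> W = {}"
  using eventually_off[OF assms threshold(1)] by (fastforce simp: supp_def)

text \<open>
  A function \<open>v\<close> prescribes for every \<open>g\<close> the point \<open>v g\<close> to be imitated at \<open>g\<close>. Where \<open>v\<close> changes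
  within a window, both points concerned have to be invisible. The points themselves serve as indices
  of the parts that are glued.
\<close>

definition separated :: "('g \<Rightarrow> 'x) \<Rightarrow> bool" where
  "separated v \<longleftrightarrow> (\<forall>g\<in>carrier G. \<forall>h\<in>E. v (h \<otimes> g) \<noteq> v g \<longrightarrow> g \<notin> supp (v g) \<and> g \<notin> supp (v (h \<otimes> g)))"

definition realizes :: "'x \<Rightarrow> ('g \<Rightarrow> 'x) \<Rightarrow> bool" where
  "realizes y v \<longleftrightarrow> (\<forall>g\<in>carrier G. dist (\<phi> g y) (\<phi> g (v g)) < \<eta>)"

lemma realization_exists:
  assumes "v \<in> carrier G \<rightarrow> X" "separated v"
  shows "\<exists>y\<in>X. realizes y v"
  unfolding realizes_def
  by (rule glue[OF assms(1)]) (use assms(2) not_supp in \<open>auto simp: separated_def\<close>)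

lemma realizes_unique:
  assumes "x \<in> X" "y \<in> X" "realizes x v" "realizes y v"
  shows "x = y"
proof (rule near_all_eq[OF assms(1,2)])
  show "near (carrier G) x y"
    unfolding near_def
  proof
    fix g assume "g \<in> carrier G"
    then have "dist (\<phi> g x) (\<phi> g (v g)) < \<eta>" "dist (\<phi> g y) (\<phi> g (v g)) < \<eta>"
      using assms(3,4) by (auto simp: realizes_def)
    then show "dist (\<phi> g x) (\<phi> g y) \<le> 4 * \<eta>"
      using dist_triangle2[of "\<phi> g x" "\<phi> g y" "\<phi> g (v g)"] threshold by linarith
  qed
qed

text \<open>
  Where \<open>v\<close> changes inside a window, both values are within \<open>\<delta>\<close> of \<open>z\<close>, so \<open>y\<close> is near the single
  point \<open>v g\<close> on the whole window around \<open>g\<close>, and the local rule applies. It returns the error \<open>\<delta>\<close>,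
  which is at most the error \<open>\<eta>\<close> one started with.
\<close>

lemma realizes_f:
  assumes y: "y \<in> X" and v: "v \<in> carrier G \<rightarrow> X" "separated v" "realizes y v"
  shows "realizes (f y) (f \<circ> v)"
  unfolding realizes_def
proof
  fix g assume g: "g \<in> carrier G"
  have "dist (\<phi> h (\<phi> g y)) (\<phi> h (\<phi> g (v g))) \<le> 4 * \<eta>" if h: "h \<in> E" for h
  proof -
    let ?k = "h \<otimes> g"
    have k: "?k \<in> carrier G" using g h by simp
    have d1: "dist (\<phi> ?k y) (\<phi> ?k (v ?k)) < \<eta>" using v(3) k by (auto simp: realizes_def)
    have d2: "dist (\<phi> ?k (v ?k)) (\<phi> ?k (v g)) \<le> 2 * \<delta>"
    proof (cases "v ?k = v g")
      case False
      have e: "inv h \<otimes> ?k = g" using g h E_sym[of g ?k h] k by simp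
      have "?k \<notin> supp (v ?k) \<and> ?k \<notin> supp (v g)"
        using v(2) window(4)[OF h] k False e unfolding separated_def by metis
      then show ?thesis
        using not_supp[OF k, of "v ?k"] not_supp[OF k, of "v g"]
          dist_triangle2[of "\<phi> ?k (v ?k)" "\<phi> ?k (v g)" z] by linarith
    qed (use threshold in simp)
    have "v g \<in> X" using v(1) g by auto
    then show ?thesis
      using d1 d2 dist_triangle[of "\<phi> ?k y" "\<phi> ?k (v g)" "\<phi> ?k (v ?k)"] g h y threshold by simp
  qed
  moreover have "v g \<in> X" using v(1) g by auto
  ultimately have "dist (f (\<phi> g y)) (f (\<phi> g (v g))) < \<delta>"
    using local_rule[of "\<phi> g y" "\<phi> g (v g)"] g y by auto
  then show "dist (\<phi> g (f y)) (\<phi> g ((f \<circ> v) g)) < \<eta>"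
    using threshold g y \<open>v g \<in> X\<close> by (simp add: f_act)
qed

lemma realizes_fn:
  assumes "y \<in> X" "v \<in> carrier G \<rightarrow> X" "\<And>m. m < n \<Longrightarrow> separated ((f ^^ m) \<circ> v)" "realizes y v"
  shows "realizes ((f ^^ n) y) ((f ^^ n) \<circ> v)"
  using assms(3)
proof (induction n)
  case 0
  then show ?case using assms by (simp add: comp_def)
next
  case (Suc n)
  have "realizes (f ((f ^^ n) y)) (f \<circ> ((f ^^ n) \<circ> v))"
  proof (rule realizes_f)
    show "(f ^^ n) \<circ> v \<in> carrier G \<rightarrow> X" using assms(2) by (auto simp: Pi_iff)
    show "separated ((f ^^ n) \<circ> v)" by (rule Suc.prems) simp
    show "realizes ((f ^^ n) y) ((f ^^ n) \<circ> v)" by (rule Suc.IH) (rule Suc.prems, simp)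
  qed (simp add: assms(1))
  then show ?case by (simp add: comp_def)
qed

lemma realizes_supp:
  assumes "y \<in> X" "realizes y v" "A \<subseteq> carrier G" "\<And>g. g \<in> E <#> A \<Longrightarrow> g \<notin> supp (v g)"
  shows "supp y \<inter> A = {}"
proof (rule near_small_supp[OF assms(1,3)])
  fix g assume g: "g \<in> E <#> A"
  then have gc: "g \<in> carrier G" using E_closed[OF assms(3)] by auto
  have "dist (\<phi> g y) (\<phi> g (v g)) < \<eta>" using assms(2) gc by (auto simp: realizes_def)
  moreover have "dist (\<phi> g (v g)) z < \<delta>" using not_supp[OF gc] assms(4)[OF g] by auto
  ultimately show "dist (\<phi> g y) z \<le> 4 * \<eta>"
    using dist_triangle[of "\<phi> g y" z "\<phi> g (v g)"] threshold by linarith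
qed

section \<open>Baire category\<close>

text \<open>
  If this failed, then every point of \<open>C\<close> could be approximated by points of \<open>C\<close> that visit \<open>W\<close> at
  arbitrarily late times. A nested sequence of balls would give a limit that visits \<open>W\<close> infinitely
  often, against asymptotic nilpotency.
\<close>

lemma finally_quiet:
  assumes C: "C \<subseteq> X" "C \<noteq> {}" and W: "finite W" "W \<subseteq> carrier G"
  shows "\<exists>x\<in>C. \<exists>K N. finite K \<and> K \<subseteq> carrier G \<and>
           (\<forall>y\<in>C. near K x y \<longrightarrow> (\<forall>n\<ge>N. supp ((f ^^ n) y) \<inter> W = {}))"
proof (rule ccontr)
  assume neg: "\<not> ?thesis"
  have hit: "\<exists>y\<in>C. dist x y < r \<and> (\<exists>n\<ge>N. \<exists>g\<in>W. \<delta> \<le> dist (\<phi> g ((f ^^ n) y)) z)"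
    if x: "x \<in> C" and r: "r > 0" for x r N
  proof -
    obtain K where K: "finite K" "K \<subseteq> carrier G"
      "\<forall>x\<in>X. \<forall>y\<in>X. (\<forall>g\<in>K. dist (\<phi> g x) (\<phi> g y) \<le> 4 * \<eta>) \<longrightarrow> dist x y < r"
      using window_determines[OF r] by blast
    obtain y where "y \<in> C" "near K x y" "\<exists>n\<ge>N. supp ((f ^^ n) y) \<inter> W \<noteq> {}"
      using neg x K(1,2) by blast
    then show ?thesis using K(3) x C(1) by (auto simp: near_def supp_def) blast
  qed
  \<comment> \<open>Half the threshold turns a visit into an open condition, which a whole ball satisfies.\<close>
  define good where "good p k \<longleftrightarrow> fst p \<in> C \<and> snd p > 0 \<and>
     (\<exists>n\<ge>k. \<exists>g\<in>W. \<forall>x\<in>X. dist (fst p) x \<le> snd p \<longrightarrow> \<delta> / 2 < dist (\<phi> g ((f ^^ n) x)) z)"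
    for p :: "'x \<times> real" and k :: nat
  have step: "\<exists>q. good q k \<and> cball (fst q) (snd q) \<subseteq> cball (fst p) (snd p)"
    if p: "fst p \<in> C" "snd p > 0" for p and k :: nat
  proof -
    obtain y n g where y: "y \<in> C" "dist (fst p) y < snd p" and n: "n \<ge> k" and g: "g \<in> W"
      and big: "\<delta> \<le> dist (\<phi> g ((f ^^ n) y)) z"
      using hit[OF p, of k] by blast
    have gc: "g \<in> carrier G" using g W by auto
    have "continuous_on X (\<lambda>x. dist (\<phi> g ((f ^^ n) x)) z)" by (rule visit_cont[OF gc])
    moreover have "y \<in> X" using y C by auto
    ultimately obtain s where s: "s > 0"
      "\<And>x. x \<in> X \<Longrightarrow> dist x y < s \<Longrightarrow>
         dist (dist (\<phi> g ((f ^^ n) x)) z) (dist (\<phi> g ((f ^^ n) y)) z) < \<delta> / 2"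
      using threshold(1) unfolding continuous_on_iff by (meson half_gt_zero)
    define r where "r = min (s / 2) (snd p - dist (fst p) y)"
    have r: "r > 0" "r < s" using s y unfolding r_def by auto
    have "good (y, r) k"
      unfolding good_def
    proof (intro conjI exI[of _ n] bexI[of _ g] ballI impI)
      fix x assume x: "x \<in> X" "dist (fst (y, r)) x \<le> snd (y, r)"
      then have "dist x y < s" using r by (simp add: dist_commute)
      from s(2)[OF x(1) this] big show "\<delta> / 2 < dist (\<phi> g ((f ^^ n) x)) z"
        unfolding dist_real_def by arith
    qed (use y r n g in auto)
    moreover have "cball y r \<subseteq> cball (fst p) (snd p)"
    proof
      fix x assume "x \<in> cball y r"
      then show "x \<in> cball (fst p) (snd p)"
        using dist_triangle[of "fst p" x y] unfolding r_def by auto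
    qed
    ultimately show ?thesis by force
  qed
  obtain x0 where x0: "x0 \<in> C" using C by auto
  have "\<exists>p. (\<forall>k. good (p k) k) \<and> (\<forall>k. cball (fst (p (Suc k))) (snd (p (Suc k))) \<subseteq> cball (fst (p k)) (snd (p k)))"
  proof (rule dependent_nat_choice[where P = "\<lambda>k p. good p k" and
        Q = "\<lambda>k p q. cball (fst q) (snd q) \<subseteq> cball (fst p) (snd p)", simplified all_conj_distrib])
    show "\<exists>p. good p 0" using step[of "(x0, 1)" 0] x0 by auto
    show "\<exists>q. good q (Suc k) \<and> cball (fst q) (snd q) \<subseteq> cball (fst p) (snd p)" if "good p k" for p k
      using step[of p "Suc k"] that unfolding good_def by blast
  qed
  then obtain p where p: "\<And>k. good (p k) k"
    and nest: "\<And>k. cball (fst (p (Suc k))) (snd (p (Suc k))) \<subseteq> cball (fst (p k)) (snd (p k))"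
    by blast
  have nest': "cball (fst (p j)) (snd (p j)) \<subseteq> cball (fst (p k)) (snd (p k))" if "k \<le> j" for k j
    using lift_Suc_antimono_le[of "\<lambda>k. cball (fst (p k)) (snd (p k))", OF nest that] by simp
  have inX: "\<forall>k. fst (p k) \<in> X" using p C unfolding good_def by auto
  have "seq_compact X" using compact_space compact_eq_seq_compact_metric by blast
  then obtain l r where l: "l \<in> X" "strict_mono r" "((\<lambda>k. fst (p k)) \<circ> r) \<longlonglongrightarrow> l"
    using inX by (metis seq_compactE)
  have l_in: "l \<in> cball (fst (p k)) (snd (p k))" for k
  proof (rule Lim_in_closed_set[OF closed_cball _ _ l(3)])
    show "\<forall>\<^sub>F j in sequentially. ((\<lambda>k. fst (p k)) \<circ> r) j \<in> cball (fst (p k)) (snd (p k))"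
    proof (rule eventually_sequentiallyI[of k])
      fix j assume "k \<le> j"
      then have "k \<le> r j" using seq_suble[OF l(2), of j] by linarith
      moreover have "fst (p (r j)) \<in> cball (fst (p (r j))) (snd (p (r j)))"
        using p[of "r j"] by (simp add: good_def)
      ultimately show "((\<lambda>k. fst (p k)) \<circ> r) j \<in> cball (fst (p k)) (snd (p k))"
        using subsetD[OF nest'[OF \<open>k \<le> r j\<close>]] by simp
    qed
  qed simp
  obtain N where N: "\<forall>n\<ge>N. \<forall>g\<in>W. dist (\<phi> g ((f ^^ n) l)) z < \<delta> / 2"
    using eventually_off[OF l(1) W, of "\<delta> / 2"] threshold by auto
  obtain n g where "n \<ge> N" "g \<in> W" "\<delta> / 2 < dist (\<phi> g ((f ^^ n) l)) z"
    using p[of N] l_in[of N] l(1) unfolding good_def by auto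
  then show False using N by fastforce
qed

lemma halo_mult: "A \<subseteq> carrier G \<Longrightarrow> B \<subseteq> carrier G \<Longrightarrow> halo n (A <#> B) = halo n A <#> B"
  by (induction n) (simp_all add: halo_Suc set_mult_assoc window halo_carrier)

lemma halo_halo: "halo m (halo n A) = halo (m + n) A"
  by (simp add: halo_def funpow_add)

lemma one_mult_subset: "\<one> \<in> Z \<Longrightarrow> A \<subseteq> carrier G \<Longrightarrow> A \<subseteq> A <#> Z"
  by (force simp: mem_set_mult)

lemma realizes_supp_subset:
  assumes "y \<in> X" "realizes y v"
  shows "supp y \<subseteq> E <#> {g \<in> carrier G. g \<in> supp (v g)}"
proof
  fix g assume g: "g \<in> supp y"
  then have gc: "g \<in> carrier G" using supp_carrier by auto
  let ?S = "{g \<in> carrier G. g \<in> supp (v g)}"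
  show "g \<in> E <#> ?S"
  proof (rule ccontr)
    assume "g \<notin> E <#> ?S"
    then have "?S \<inter> (E <#> {g}) = {}"
      using E_disjoint_swap[of ?S "{g}"] gc by auto
    moreover have "E <#> {g} \<subseteq> carrier G" using gc by (intro set_mult_closed window) auto
    ultimately have "supp y \<inter> {g} = {}"
      using gc by (intro realizes_supp[OF assms]) auto
    then show False using g by auto
  qed
qed

definition dying :: "'x \<Rightarrow> bool" where
  "dying x \<longleftrightarrow> x \<in> X \<and> (\<exists>n. (f ^^ n) x = z)"

definition thin :: "'g set \<Rightarrow> 'x \<Rightarrow> bool" where
  "thin Z x \<longleftrightarrow> (\<exists>F. finite F \<and> F \<subseteq> carrier G \<and> supp x \<subseteq> F <#> Z)"

lemma dying_fn: "dying x \<Longrightarrow> dying ((f ^^ n) x)"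
  unfolding dying_def by (metis add.commute fn_in fn_z funpow_add o_apply)

lemma dying_act:
  assumes "dying y" "b \<in> carrier G"
  shows "dying (\<phi> b y)"
proof -
  obtain n where "y \<in> X" "(f ^^ n) y = z" using assms(1) by (auto simp: dying_def)
  then have "(f ^^ n) (\<phi> b y) = z" "\<phi> b y \<in> X" using assms(2) by (simp_all add: fn_act)
  then show ?thesis by (auto simp: dying_def)
qed

text \<open>
  The lemma \<open>finally_quiet\<close> provides a dying thin point \<open>x\<close> such that all dying thin points near \<open>x\<close>
  are quiet on \<open>W\<close> from some time on. If the support of a dying thin point \<open>y\<close> is far away from that
  of \<open>x\<close>, then \<open>x\<close> and \<open>y\<close> can be merged, and they do not interact before \<open>x\<close> has died. The merged
  point is near \<open>x\<close>, it is dying and thin, and after the death of \<open>x\<close> its orbit is that of \<open>y\<close>. So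
  \<open>y\<close> is quiet on \<open>W\<close> from a time on that does not depend on \<open>y\<close>. Before this time \<open>y\<close> cannot have
  reached \<open>W\<close> if its support is far away from \<open>W\<close>.
\<close>

lemma dying_spread_bounded:
  assumes Z: "Z \<subseteq> carrier G" "\<one> \<in> Z" and W: "finite W" "W \<subseteq> carrier G"
  shows "\<exists>F. finite F \<and> F \<subseteq> carrier G \<and>
    (\<forall>y. dying y \<longrightarrow> thin Z y \<longrightarrow> supp y \<inter> (F <#> Z) = {} \<longrightarrow> (\<forall>n. supp ((f ^^ n) y) \<inter> W = {}))"
proof -
  have z: "dying z" "thin Z z" by (auto simp: dying_def thin_def)
  have "\<exists>x\<in>{x. dying x \<and> thin Z x}. \<exists>K N. finite K \<and> K \<subseteq> carrier G \<and>
      (\<forall>y\<in>{x. dying x \<and> thin Z x}. near K x y \<longrightarrow> (\<forall>n\<ge>N. supp ((f ^^ n) y) \<inter> W = {}))"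
  proof (rule finally_quiet[OF _ _ W])
    show "{x. dying x \<and> thin Z x} \<subseteq> X" by (auto simp: dying_def)
    show "{x. dying x \<and> thin Z x} \<noteq> {}" using z by blast
  qed
  then obtain x K N where x: "dying x" "thin Z x" and K: "finite K" "K \<subseteq> carrier G"
    and quiet: "\<And>y n. dying y \<Longrightarrow> thin Z y \<Longrightarrow> near K x y \<Longrightarrow> N \<le> n \<Longrightarrow> supp ((f ^^ n) y) \<inter> W = {}"
    by blast
  obtain n0 where n0: "(f ^^ n0) x = z" and xX: "x \<in> X" using x by (auto simp: dying_def)
  obtain F where F: "finite F" "F \<subseteq> carrier G" "supp x \<subseteq> F <#> Z"
    using x by (auto simp: thin_def)
  define S where "S k = halo k (F <#> Z)" for k
  have FZ: "F <#> Z \<subseteq> carrier G" by (intro set_mult_closed F Z)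
  have Sc: "S k \<subseteq> carrier G" for k unfolding S_def by (rule halo_carrier[OF FZ])
  have Smono: "S k \<subseteq> S l" if "k \<le> l" for k l unfolding S_def by (rule halo_mono_index[OF FZ that])
  have ES: "h \<otimes> g \<in> S (Suc k)" if "h \<in> E" "g \<in> S k" for h g k
    using that unfolding S_def halo_Suc by (rule set_multI)
  define N' where "N' = max N n0"
  define F' where "F' = K \<union> halo (2 * n0 + 5) F \<union> halo (Suc N') W"
  have F'c: "finite F'" "F' \<subseteq> carrier G"
    unfolding F'_def using K F W halo_finite halo_carrier by auto
  have "supp ((f ^^ n) y) \<inter> W = {}"
    if y: "dying y" "thin Z y" and off: "supp y \<inter> (F' <#> Z) = {}" for y n
  proof -
    have yX: "y \<in> X" using y by (simp add: dying_def)
    have F'Z: "F' \<subseteq> F' <#> Z" by (rule one_mult_subset[OF Z(2) F'c(2)])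
    have offS: "supp y \<inter> S k = {}" if "k \<le> 2 * n0 + 5" for k
    proof -
      have "S (2 * n0 + 5) = halo (2 * n0 + 5) F <#> Z"
        unfolding S_def by (rule halo_mult[OF F(2) Z(1)])
      also have "\<dots> \<subseteq> F' <#> Z" unfolding F'_def by (intro mono_set_mult) auto
      finally show ?thesis using off Smono[OF that] by blast
    qed
    have offS': "supp ((f ^^ m) y) \<inter> S k = {}" if "Suc m + k \<le> 2 * n0 + 5" for m k
    proof (rule supp_iter_avoid[OF yX Sc])
      show "supp y \<inter> halo (Suc m) (S k) = {}"
        unfolding S_def halo_halo using offS[of "Suc m + k"] that by (simp add: S_def)
    qed
    \<comment> \<open>Up to time \<open>n0\<close> the orbit of \<open>x\<close> stays inside \<open>A\<close> and the orbit of \<open>y\<close> stays outside, with a window to spare.\<close>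
    define A where "A = S (n0 + 2)"
    define v where "v g = (if g \<in> A then x else y)" for g
    have v: "v \<in> carrier G \<rightarrow> X" using xX yX by (auto simp: v_def)
    have sep: "separated ((f ^^ m) \<circ> v)" if m: "m \<le> n0" for m
      unfolding separated_def
    proof (intro ballI impI)
      fix g h assume g: "g \<in> carrier G" and h: "h \<in> E"
        and ne: "((f ^^ m) \<circ> v) (h \<otimes> g) \<noteq> ((f ^^ m) \<circ> v) g"
      then have iff: "h \<otimes> g \<in> A \<longleftrightarrow> g \<notin> A" by (auto simp: v_def split: if_splits)
      have "g \<notin> supp ((f ^^ m) x)"
      proof
        assume "g \<in> supp ((f ^^ m) x)"
        then have "g \<in> S m"
          using supp_fn[OF xX, of m] halo_mono[OF F(3), of m] by (auto simp: S_def)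
        then have "g \<in> A" "h \<otimes> g \<in> A"
          using ES[OF h, of g m] Smono[of m "n0 + 2"] Smono[of "Suc m" "n0 + 2"] m by (auto simp: A_def)
        then show False using iff by simp
      qed
      moreover have "g \<notin> supp ((f ^^ m) y)"
      proof -
        have "g \<in> S (n0 + 3)"
        proof (cases "g \<in> A")
          case True
          then show ?thesis using Smono[of "n0 + 2" "n0 + 3"] by (auto simp: A_def)
        next
          case False
          then have hg: "h \<otimes> g \<in> A" using iff by simp
          have "inv h \<otimes> (h \<otimes> g) \<in> S (Suc (n0 + 2))"
            using ES[OF window(4)[OF h], of "h \<otimes> g" "n0 + 2"] hg by (simp add: A_def)
          moreover have "inv h \<otimes> (h \<otimes> g) = g"
            using g h by (metis E_carrier inv_solve_left m_closed)
          ultimately show ?thesis by (simp add: numeral_3_eq_3)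
        qed
        then show ?thesis using offS'[of m "n0 + 3"] m by auto
      qed
      ultimately show "g \<notin> supp (((f ^^ m) \<circ> v) g) \<and> g \<notin> supp (((f ^^ m) \<circ> v) (h \<otimes> g))"
        by (auto simp: v_def)
    qed
    have "separated v" using sep[of 0] by (simp add: comp_def)
    from realization_exists[OF v this] obtain w where w: "w \<in> X" "realizes w v" by blast
    have real: "realizes ((f ^^ n0) w) ((f ^^ n0) \<circ> v)"
      using sep by (intro realizes_fn w v) auto
    have eq0: "(f ^^ n0) w = (f ^^ n0) y"
    proof (rule near_all_eq)
      show "near (carrier G) ((f ^^ n0) w) ((f ^^ n0) y)"
        unfolding near_def
      proof
        fix g assume g: "g \<in> carrier G"
        have d: "dist (\<phi> g ((f ^^ n0) w)) (\<phi> g ((f ^^ n0) (v g))) < \<eta>"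
          using real g by (auto simp: realizes_def)
        show "dist (\<phi> g ((f ^^ n0) w)) (\<phi> g ((f ^^ n0) y)) \<le> 4 * \<eta>"
        proof (cases "g \<in> A")
          case True
          then have "g \<notin> supp ((f ^^ n0) y)" using offS'[of n0 "n0 + 2"] by (auto simp: A_def)
          then have "dist (\<phi> g ((f ^^ n0) y)) z < \<delta>" using not_supp g by auto
          moreover have "dist (\<phi> g ((f ^^ n0) w)) z < \<eta>" using d True g n0 by (simp add: v_def)
          ultimately show ?thesis
            using dist_triangle2[of "\<phi> g ((f ^^ n0) w)" "\<phi> g ((f ^^ n0) y)" z] threshold by linarith
        next
          case False
          then show ?thesis using d threshold by (simp add: v_def)
        qed
      qed
    qed (use w yX in auto)
    have eq: "(f ^^ k) w = (f ^^ k) y" if "n0 \<le> k" for k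
    proof -
      have "(f ^^ k) u = (f ^^ (k - n0)) ((f ^^ n0) u)" for u
        using that by (metis comp_apply funpow_add le_add_diff_inverse2)
      then show ?thesis using eq0 by simp
    qed
    have "dying w"
    proof -
      obtain k where "(f ^^ k) y = z" using y by (auto simp: dying_def)
      then have "(f ^^ (n0 + k)) w = z"
        using eq[of "n0 + k"] by (simp add: funpow_add)
      then show ?thesis using w by (auto simp: dying_def)
    qed
    moreover have "thin Z w"
    proof -
      obtain F1 where F1: "finite F1" "F1 \<subseteq> carrier G" "supp y \<subseteq> F1 <#> Z"
        using y by (auto simp: thin_def)
      have "supp w \<subseteq> E <#> {g \<in> carrier G. g \<in> supp (v g)}" by (rule realizes_supp_subset[OF w])
      also have "\<dots> \<subseteq> E <#> ((F \<union> F1) <#> Z)"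
      proof (rule mono_set_mult[OF order_refl])
        show "{g \<in> carrier G. g \<in> supp (v g)} \<subseteq> (F \<union> F1) <#> Z"
          using F(3) F1(3) mono_set_mult[of F "F \<union> F1" Z Z G] mono_set_mult[of F1 "F \<union> F1" Z Z G]
          by (auto simp: v_def split: if_splits)
      qed
      also have "\<dots> = (E <#> (F \<union> F1)) <#> Z"
        using F F1 Z window by (simp add: set_mult_assoc)
      finally show ?thesis
        unfolding thin_def
        using E_finite[of "F \<union> F1"] E_closed[of "F \<union> F1"] F F1
        by (intro exI[of _ "E <#> (F \<union> F1)"]) simp
    qed
    moreover have "near K x w"
      unfolding near_def
    proof
      fix g assume gK: "g \<in> K"
      then have g: "g \<in> carrier G" using K by auto
      have d: "dist (\<phi> g w) (\<phi> g (v g)) < \<eta>" using w g by (auto simp: realizes_def)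
      show "dist (\<phi> g x) (\<phi> g w) \<le> 4 * \<eta>"
      proof (cases "g \<in> A")
        case True
        then show ?thesis using d threshold by (simp add: v_def dist_commute)
      next
        case False
        have "g \<notin> supp y" using off F'Z gK by (auto simp: F'_def)
        moreover have "g \<notin> supp x"
          using False F(3) Smono[of 0 "n0 + 2"] by (auto simp: A_def S_def)
        ultimately show ?thesis
          using not_supp[OF g, of x] not_supp[OF g, of y] d False threshold
            dist_triangle2[of "\<phi> g x" "\<phi> g w" z] dist_triangle[of "\<phi> g w" z "\<phi> g y"]
          by (simp add: v_def)
      qed
    qed
    ultimately have q: "supp ((f ^^ k) w) \<inter> W = {}" if "k \<ge> N" for k using quiet that by blast
    show ?thesis
    proof (cases "n \<ge> N'")
      case True
      then show ?thesis using q[of n] eq[of n] by (simp add: N'_def)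
    next
      case False
      show ?thesis
      proof (rule supp_iter_avoid[OF yX W(2)])
        have "halo (Suc n) W \<subseteq> halo (Suc N') W" using False W by (intro halo_mono_index) auto
        then show "supp y \<inter> halo (Suc n) W = {}" using off F'Z by (auto simp: F'_def)
      qed
    qed
  qed
  then show ?thesis using F'c by blast
qed

text \<open>
  By compactness: a limit of points that visit \<open>W\<close> for longer and longer initial periods would visit
  \<open>W\<close> at all times.
\<close>

lemma uniform_rest:
  assumes W: "finite W" "W \<subseteq> carrier G"
  shows "\<exists>L. \<forall>y\<in>X. \<exists>i\<le>L. supp ((f ^^ i) y) \<inter> W = {}"
proof (rule ccontr)
  assume "\<not> ?thesis"
  then have "\<forall>L. \<exists>y\<in>X. \<forall>i\<le>L. supp ((f ^^ i) y) \<inter> W \<noteq> {}" by blast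
  then obtain y where y: "\<And>L. y L \<in> X" "\<And>L i. i \<le> L \<Longrightarrow> supp ((f ^^ i) (y L)) \<inter> W \<noteq> {}" by metis
  have "seq_compact X" using compact_space compact_eq_seq_compact_metric by blast
  then obtain l r where l: "l \<in> X" "strict_mono r" "(y \<circ> r) \<longlonglongrightarrow> l"
    using y(1) by (metis seq_compactE)
  obtain i where i: "\<forall>g\<in>W. dist (\<phi> g ((f ^^ i) l)) z < \<delta>"
    using eventually_off[OF l(1) W threshold(1)] by blast
  have "\<forall>\<^sub>F k in sequentially. dist (\<phi> g ((f ^^ i) (y (r k)))) z < \<delta>" if g: "g \<in> W" for g
  proof -
    have gc: "g \<in> carrier G" using g W by auto
    have "continuous_on X (\<lambda>x. dist (\<phi> g ((f ^^ i) x)) z)" by (rule visit_cont[OF gc])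
    then have "((\<lambda>k. dist (\<phi> g ((f ^^ i) ((y \<circ> r) k))) z) \<longlongrightarrow> dist (\<phi> g ((f ^^ i) l)) z) sequentially"
      by (rule continuous_on_tendsto_compose[OF _ l(3) l(1)]) (use y in auto)
    then show ?thesis using i g order_tendstoD(2) by fastforce
  qed
  then have "\<forall>\<^sub>F k in sequentially. \<forall>g\<in>W. dist (\<phi> g ((f ^^ i) (y (r k)))) z < \<delta>"
    using W(1) by (simp add: eventually_ball_finite)
  then have "\<forall>\<^sub>F k in sequentially. i \<le> k \<and> (\<forall>g\<in>W. dist (\<phi> g ((f ^^ i) (y (r k)))) z < \<delta>)"
    by (intro eventually_conj eventually_ge_at_top)
  then obtain k where k: "i \<le> k" "\<forall>g\<in>W. dist (\<phi> g ((f ^^ i) (y (r k)))) z < \<delta>"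
    using eventually_happens by (metis (mono_tags, lifting) trivial_limit_sequentially)
  have "i \<le> r k" using k(1) seq_suble[OF l(2), of k] by linarith
  then show False using y(2)[of i "r k"] k(2) by (fastforce simp: supp_def)
qed

text \<open>
  By \<open>dying_spread_bounded\<close> for the trivial subgroup, a dying homoclinic point whose support avoids a
  certain finite set never visits \<open>\<one>\<close>. By \<open>uniform_rest\<close> every orbit avoids this set at some time up
  to \<open>L\<close>. So \<open>\<one>\<close> is not visited after time \<open>L\<close>, and by translation nothing is visited.
\<close>

lemma nilpotent_if_homoclinic_dying:
  assumes dense: "X \<subseteq> closure {x \<in> X. finite (supp x)}"
    and die: "\<And>x. x \<in> X \<Longrightarrow> finite (supp x) \<Longrightarrow> dying x"
  shows "\<exists>n. \<forall>x\<in>X. (f ^^ n) x = z"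
proof -
  obtain F where F: "finite F" "F \<subseteq> carrier G"
    and spread: "\<And>y n. dying y \<Longrightarrow> thin {\<one>} y \<Longrightarrow> supp y \<inter> (F <#> {\<one>}) = {} \<Longrightarrow> \<one> \<notin> supp ((f ^^ n) y)"
    using dying_spread_bounded[of "{\<one>}" "{\<one>}"] by auto
  obtain L where L: "\<And>y. y \<in> X \<Longrightarrow> \<exists>i\<le>L. supp ((f ^^ i) y) \<inter> F = {}"
    using uniform_rest[OF F] by blast
  have F1: "A <#> {\<one>} = A" if "A \<subseteq> carrier G" for A
    using that by (force simp: mem_set_mult)
  have fin: "finite (supp (\<phi> g y))" if "y \<in> X" "finite (supp y)" "g \<in> carrier G" for y g
  proof -
    have "supp (\<phi> g y) \<subseteq> (\<lambda>k. k \<otimes> inv g) ` supp y"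
    proof
      fix k assume k: "k \<in> supp (\<phi> g y)"
      then have kc: "k \<in> carrier G" using supp_carrier by auto
      then have "k \<otimes> g \<in> supp y" using supp_act that k by blast
      moreover have "k = k \<otimes> g \<otimes> inv g" using kc that by (simp add: m_assoc)
      ultimately show "k \<in> (\<lambda>k. k \<otimes> inv g) ` supp y" by blast
    qed
    then show ?thesis using that finite_surj by blast
  qed
  have one: "\<one> \<notin> supp ((f ^^ L) y)" if y: "y \<in> X" "finite (supp y)" for y
  proof -
    obtain i where i: "i \<le> L" "supp ((f ^^ i) y) \<inter> F = {}" using L y by blast
    have fs: "finite (supp ((f ^^ i) y))"
      using supp_fn[OF y(1), of i] halo_finite[OF y(2), of i] finite_subset by blast
    have "\<one> \<notin> supp ((f ^^ (L - i)) ((f ^^ i) y))"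
    proof (rule spread)
      show "dying ((f ^^ i) y)" using die y dying_fn by blast
      show "thin {\<one>} ((f ^^ i) y)" unfolding thin_def
        using fs supp_carrier F1 by (intro exI[of _ "supp ((f ^^ i) y)"]) auto
      show "supp ((f ^^ i) y) \<inter> (F <#> {\<one>}) = {}" using i F1[OF F(2)] by simp
    qed
    moreover have "(f ^^ (L - i)) ((f ^^ i) y) = (f ^^ L) y"
      using i(1) by (metis comp_apply funpow_add le_add_diff_inverse2)
    ultimately show ?thesis by simp
  qed
  have zero: "(f ^^ L) y = z" if y: "y \<in> X" "finite (supp y)" for y
  proof (rule supp_empty)
    show "supp ((f ^^ L) y) = {}"
    proof (rule ccontr)
      assume "supp ((f ^^ L) y) \<noteq> {}"
      then obtain g where g: "g \<in> supp ((f ^^ L) y)" by blast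
      then have gc: "g \<in> carrier G" using supp_carrier by auto
      have "\<one> \<in> supp (\<phi> g ((f ^^ L) y))"
        using g gc y supp_act[OF gc, of "(f ^^ L) y" \<one>] by simp
      then have "\<one> \<in> supp ((f ^^ L) (\<phi> g y))" using y gc by (simp add: fn_act)
      then show False using one[of "\<phi> g y"] fin y gc by auto
    qed
  qed (use y in simp)
  have "(f ^^ L) x = z" if x: "x \<in> X" for x
  proof -
    obtain u where u: "\<And>n. u n \<in> {x \<in> X. finite (supp x)}" "u \<longlonglongrightarrow> x"
      using x dense closure_sequential[of x "{x \<in> X. finite (supp x)}"] by blast
    have "(\<lambda>n. (f ^^ L) (u n)) \<longlonglongrightarrow> (f ^^ L) x"
      by (rule continuous_on_tendsto_compose[OF fn_cont u(2) x]) (use u in auto)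
    moreover have "(\<lambda>n. (f ^^ L) (u n)) = (\<lambda>n. z)" using u(1) zero by auto
    ultimately show ?thesis using LIMSEQ_unique[of "\<lambda>n. z"] by simp
  qed
  then show ?thesis by blast
qed

end

section \<open>Superpositions of translates\<close>

locale seeded_endomorphism = windowed_endomorphism G X \<phi> z f \<eta> \<delta> E
  for G :: "('g, 'b) monoid_scheme" (structure)
    and X :: "'x::metric_space set" and \<phi> and z and f and \<eta> \<delta> and E +
  fixes x0 :: 'x
  assumes x0_in [simp]: "x0 \<in> X" and x0_finite: "finite (supp x0)"
begin

definition D :: "'g set" where "D = E <#> supp x0"

lemma D_finite: "finite D" and D_carrier: "D \<subseteq> carrier G" and supp_D: "supp x0 \<subseteq> D"
  unfolding D_def using E_finite[OF x0_finite] E_closed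
    subset_E_mult supp_carrier by auto

lemma D_in [simp]: "d \<in> D \<Longrightarrow> d \<in> carrier G"
  using D_carrier by blast

text \<open>
  The translate of \<open>x0\<close> by \<open>inv p\<close> has its support inside \<open>{d \<otimes> p |d. d \<in> D}\<close>. These sets have to
  be disjoint for a superposition of the translates.
\<close>

definition sparse :: "'g set \<Rightarrow> bool" where
  "sparse P \<longleftrightarrow> P \<subseteq> carrier G \<and> (\<forall>p\<in>P. \<forall>q\<in>P. \<forall>c\<in>D. \<forall>d\<in>D. c \<otimes> p = d \<otimes> q \<longrightarrow> p = q)"

definition is_overlay :: "'g set \<Rightarrow> 'x \<Rightarrow> bool" where
  "is_overlay P y \<longleftrightarrow> y \<in> X \<and> (\<forall>p\<in>P. \<forall>d\<in>D. dist (\<phi> (d \<otimes> p) y) (\<phi> d x0) < \<eta>) \<and>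
     (\<forall>g\<in>carrier G. g \<notin> D <#> P \<longrightarrow> dist (\<phi> g y) z < \<eta>)"

definition overlay :: "'g set \<Rightarrow> 'x" where
  "overlay P = (SOME y. is_overlay P y)"

lemma sparse_subset: "sparse P \<Longrightarrow> Q \<subseteq> P \<Longrightarrow> sparse Q"
  unfolding sparse_def by (meson subset_iff)

lemma overlay_exists:
  assumes P: "sparse P"
  shows "\<exists>y. is_overlay P y"
proof -
  have Pc: "P \<subseteq> carrier G" using P by (simp add: sparse_def)
  define v where "v g = (if g \<in> D <#> P then \<phi> (inv (SOME p. p \<in> P \<and> (\<exists>d\<in>D. g = d \<otimes> p))) x0 else z)" for g
  have v1: "v (d \<otimes> p) = \<phi> (inv p) x0" if "p \<in> P" "d \<in> D" for d p
  proof -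
    have "(SOME q. q \<in> P \<and> (\<exists>c\<in>D. d \<otimes> p = c \<otimes> q)) = p"
    proof (rule some_equality)
      show "p \<in> P \<and> (\<exists>c\<in>D. d \<otimes> p = c \<otimes> p)" using that by blast
      show "q = p" if "q \<in> P \<and> (\<exists>c\<in>D. d \<otimes> p = c \<otimes> q)" for q
        using that P \<open>p \<in> P\<close> \<open>d \<in> D\<close> unfolding sparse_def by metis
    qed
    then show ?thesis using that by (auto simp: v_def intro: set_multI)
  qed
  have v2: "v g = z" if "g \<notin> D <#> P" for g using that by (simp add: v_def)
  have v3: "\<exists>p d. p \<in> P \<and> d \<in> D \<and> g = d \<otimes> p \<and> v g = \<phi> (inv p) x0" if "g \<in> D <#> P" for g
    using that v1 by (auto simp: mem_set_mult)
  have vX: "v \<in> carrier G \<rightarrow> X"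
  proof
    fix g assume "g \<in> carrier G"
    show "v g \<in> X"
      using v3[of g] v2[of g] Pc by (cases "g \<in> D <#> P") auto
  qed
  have key: "v k = \<phi> (inv p) x0 \<and> v (h \<otimes> k) = \<phi> (inv p) x0"
    if "k \<in> carrier G" "h \<in> E" "p \<in> P" "k \<in> supp (\<phi> (inv p) x0)" for k h p
  proof -
    have pc: "p \<in> carrier G" using that Pc by auto
    have s: "k \<otimes> inv p \<in> supp x0"
      using that supp_act[of "inv p" x0 k] pc by auto
    have "k = (k \<otimes> inv p) \<otimes> p" "h \<otimes> k = (h \<otimes> (k \<otimes> inv p)) \<otimes> p"
      using that pc by (simp_all add: m_assoc)
    moreover have "k \<otimes> inv p \<in> D" using s supp_D by auto
    moreover have "h \<otimes> (k \<otimes> inv p) \<in> D" unfolding D_def using s that by (auto intro: set_multI)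
    ultimately show ?thesis using v1 that by metis
  qed
  have "separated v"
    unfolding separated_def
  proof (intro ballI impI conjI)
    fix g h assume g: "g \<in> carrier G" and h: "h \<in> E" and ne: "v (h \<otimes> g) \<noteq> v g"
    show "g \<notin> supp (v g)"
    proof
      assume s: "g \<in> supp (v g)"
      then have "g \<in> D <#> P" using v2[of g] supp_z by (metis empty_iff)
      then obtain p where "p \<in> P" "v g = \<phi> (inv p) x0" using v3 by blast
      then show False using key[OF g h, of p] s ne by simp
    qed
    show "g \<notin> supp (v (h \<otimes> g))"
    proof
      assume s: "g \<in> supp (v (h \<otimes> g))"
      then have "h \<otimes> g \<in> D <#> P" using v2[of "h \<otimes> g"] supp_z by (metis empty_iff)
      then obtain p where "p \<in> P" "v (h \<otimes> g) = \<phi> (inv p) x0" using v3 by blast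
      then show False using key[OF g h, of p] s ne by simp
    qed
  qed
  from realization_exists[OF vX this] obtain y where y: "y \<in> X" "realizes y v" by blast
  have "is_overlay P y"
    unfolding is_overlay_def
  proof (intro conjI ballI impI)
    fix p d assume pd: "p \<in> P" "d \<in> D"
    then have c: "p \<in> carrier G" "d \<in> carrier G" using Pc by auto
    then have "dist (\<phi> (d \<otimes> p) y) (\<phi> (d \<otimes> p) (v (d \<otimes> p))) < \<eta>"
      using y(2) unfolding realizes_def by blast
    then show "dist (\<phi> (d \<otimes> p) y) (\<phi> d x0) < \<eta>"
      using pd c y(1) by (simp add: v1)
  next
    fix g assume g: "g \<in> carrier G" "g \<notin> D <#> P"
    then have "dist (\<phi> g y) (\<phi> g (v g)) < \<eta>"
      using y(2) unfolding realizes_def by blast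
    then show "dist (\<phi> g y) z < \<eta>" using g by (simp add: v2)
  qed (rule y(1))
  then show ?thesis by blast
qed

lemma overlay: "sparse P \<Longrightarrow> is_overlay P (overlay P)"
  unfolding overlay_def using overlay_exists someI_ex by metis

lemma overlay_in [simp]: "sparse P \<Longrightarrow> overlay P \<in> X"
  using overlay by (auto simp: is_overlay_def)

lemma overlays_near:
  assumes "is_overlay P y" "is_overlay Q y'" "A \<subseteq> carrier G"
    and diff: "\<And>p d. p \<in> P - Q \<or> p \<in> Q - P \<Longrightarrow> d \<in> D \<Longrightarrow> d \<otimes> p \<notin> A"
  shows "near A y y'"
  unfolding near_def
proof
  fix g assume gA: "g \<in> A"
  then have g: "g \<in> carrier G" using assms by auto
  show "dist (\<phi> g y) (\<phi> g y') \<le> 4 * \<eta>"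
  proof (cases "\<exists>p\<in>P \<union> Q. \<exists>d\<in>D. g = d \<otimes> p")
    case True
    then obtain p d where pd: "p \<in> P \<union> Q" "d \<in> D" "g = d \<otimes> p" by blast
    then have "p \<in> P" "p \<in> Q" using diff[of p d] gA by auto
    then have "dist (\<phi> g y) (\<phi> d x0) < \<eta>" "dist (\<phi> g y') (\<phi> d x0) < \<eta>"
      using assms(1,2) pd unfolding is_overlay_def by blast+
    then show ?thesis using dist_triangle2[of "\<phi> g y" "\<phi> g y'" "\<phi> d x0"] threshold by linarith
  next
    case False
    then have "g \<notin> D <#> P" "g \<notin> D <#> Q" by (auto simp: mem_set_mult)
    then have "dist (\<phi> g y) z < \<eta>" "dist (\<phi> g y') z < \<eta>"
      using assms(1,2) g unfolding is_overlay_def by blast+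
    then show ?thesis using dist_triangle2[of "\<phi> g y" "\<phi> g y'" z] threshold by linarith
  qed
qed

lemma overlay_unique: "is_overlay P y \<Longrightarrow> is_overlay P y' \<Longrightarrow> y = y'"
  by (rule near_all_eq) (auto intro: overlays_near simp: is_overlay_def)

lemma overlay_near:
  assumes "sparse P" "sparse Q" "A \<subseteq> carrier G"
    and "\<And>p d. p \<in> P - Q \<or> p \<in> Q - P \<Longrightarrow> d \<in> D \<Longrightarrow> d \<otimes> p \<notin> A"
  shows "near A (overlay P) (overlay Q)"
  by (rule overlays_near[OF overlay[OF assms(1)] overlay[OF assms(2)] assms(3,4)])

lemma sparse_translate:
  assumes P: "sparse P" and b: "b \<in> carrier G"
  shows "sparse (P #> b)" "\<phi> (inv b) (overlay P) = overlay (P #> b)"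
proof -
  have Pc: "P \<subseteq> carrier G" using P by (simp add: sparse_def)
  have mem: "k \<in> P #> b \<longleftrightarrow> (\<exists>p\<in>P. k = p \<otimes> b)" for k by (auto simp: r_coset_def)
  show sp: "sparse (P #> b)"
    unfolding sparse_def
  proof (intro conjI ballI impI)
    show "P #> b \<subseteq> carrier G" using Pc b by (rule r_coset_subset_G)
    fix p' q' c d assume a: "p' \<in> P #> b" "q' \<in> P #> b" "c \<in> D" "d \<in> D" "c \<otimes> p' = d \<otimes> q'"
    then obtain p q where pq: "p \<in> P" "q \<in> P" "p' = p \<otimes> b" "q' = q \<otimes> b" by (auto simp: mem)
    then have c: "p \<in> carrier G" "q \<in> carrier G" using Pc by auto
    have "(c \<otimes> p) \<otimes> b = (d \<otimes> q) \<otimes> b" using a pq c b by (simp add: m_assoc)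
    then have "c \<otimes> p = d \<otimes> q" using a c b by simp
    then have "p = q" using P pq a unfolding sparse_def by blast
    then show "p' = q'" using pq by simp
  qed
  have "is_overlay (P #> b) (\<phi> (inv b) (overlay P))"
    unfolding is_overlay_def
  proof (intro conjI ballI impI)
    show "\<phi> (inv b) (overlay P) \<in> X" using P b by simp
    fix p' d assume a: "p' \<in> P #> b" "d \<in> D"
    then obtain p where p: "p \<in> P" "p' = p \<otimes> b" by (auto simp: mem)
    then have pc: "p \<in> carrier G" using Pc by auto
    have "\<phi> (d \<otimes> p') (\<phi> (inv b) (overlay P)) = \<phi> (d \<otimes> p) (overlay P)"
      using p pc a b P by simp
    then show "dist (\<phi> (d \<otimes> p') (\<phi> (inv b) (overlay P))) (\<phi> d x0) < \<eta>"
      using overlay[OF P] p a unfolding is_overlay_def by simp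
  next
    fix g assume g: "g \<in> carrier G" "g \<notin> D <#> (P #> b)"
    have "g \<otimes> inv b \<notin> D <#> P"
    proof
      assume "g \<otimes> inv b \<in> D <#> P"
      then obtain d p where dp: "d \<in> D" "p \<in> P" "g \<otimes> inv b = d \<otimes> p" by (auto simp: mem_set_mult)
      then have "g = d \<otimes> p \<otimes> b" using g b Pc by (metis D_in inv_solve_right inv_inv inv_closed m_closed subsetD)
      also have "\<dots> = d \<otimes> (p \<otimes> b)" using dp b Pc by (auto intro: m_assoc)
      finally show False using g dp mem by (auto intro: set_multI)
    qed
    then have "dist (\<phi> (g \<otimes> inv b) (overlay P)) z < \<eta>"
      using overlay[OF P] g b unfolding is_overlay_def by blast
    then show "dist (\<phi> g (\<phi> (inv b) (overlay P))) z < \<eta>" using g b P by simp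
  qed
  then show "\<phi> (inv b) (overlay P) = overlay (P #> b)" using overlay_unique overlay[OF sp] by blast
qed

lemma overlay_supp:
  assumes P: "sparse P"
  shows "supp (overlay P) \<subseteq> (E <#> D) <#> P"
proof
  fix g assume g: "g \<in> supp (overlay P)"
  then have gc: "g \<in> carrier G" using supp_carrier by auto
  have Pc: "P \<subseteq> carrier G" using P by (simp add: sparse_def)
  have DP: "D <#> P \<subseteq> carrier G" using D_carrier Pc by (rule set_mult_closed)
  have "g \<in> E <#> (D <#> P)"
  proof (rule ccontr)
    assume "g \<notin> E <#> (D <#> P)"
    then have e: "(D <#> P) \<inter> (E <#> {g}) = {}"
      using E_disjoint_swap[of "D <#> P" "{g}"] gc DP by auto
    have "supp (overlay P) \<inter> {g} = {}"
    proof (rule near_small_supp)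
      fix k assume k: "k \<in> E <#> {g}"
      then have "k \<in> carrier G" using gc E_closed[of "{g}"] by auto
      then have "dist (\<phi> k (overlay P)) z < \<eta>" using overlay[OF P] k e unfolding is_overlay_def by blast
      then show "dist (\<phi> k (overlay P)) z \<le> 4 * \<eta>" using threshold by linarith
    qed (use P gc in auto)
    then show False using g by auto
  qed
  then show "g \<in> (E <#> D) <#> P" using window D_carrier Pc by (simp add: set_mult_assoc)
qed

section \<open>Confinement\<close>

text \<open>
  The definition is uniform in time and in the positions, and it speaks of superpositions of one point \<open>x0\<close>.
  The descent from a group to smaller and smaller subgroups cuts evolved superpositions into pieces, but
  it controls the pieces through the superpositions they are cut from and never through a confinement
  property of their own. So the number of descents is not limited.
\<close>

definition confined :: "'g set \<Rightarrow> bool" where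
  "confined B \<longleftrightarrow> (\<exists>F. finite F \<and> F \<subseteq> carrier G \<and>
     (\<forall>P n. P \<subseteq> B \<longrightarrow> sparse P \<longrightarrow> supp ((f ^^ n) (overlay P)) \<subseteq> F <#> B))"

lemma confined_carrier: "confined (carrier G)"
  unfolding confined_def
proof (intro exI[of _ "{\<one>}"] conjI allI impI)
  fix P n
  show "supp ((f ^^ n) (overlay P)) \<subseteq> {\<one>} <#> carrier G"
    using supp_carrier[of "(f ^^ n) (overlay P)"] by (force simp: mem_set_mult)
qed auto

lemma confined_finite_index:
  assumes "confined B" "B' \<subseteq> B" "B \<subseteq> C <#> B'" "finite C" "C \<subseteq> carrier G" "B \<subseteq> carrier G"
  shows "confined B'"
proof -
  obtain F where F: "finite F" "F \<subseteq> carrier G"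
    "\<And>P n. P \<subseteq> B \<Longrightarrow> sparse P \<Longrightarrow> supp ((f ^^ n) (overlay P)) \<subseteq> F <#> B"
    using assms(1) unfolding confined_def by blast
  have "F <#> B \<subseteq> F <#> (C <#> B')" using assms by (intro mono_set_mult) auto
  also have "\<dots> = (F <#> C) <#> B'" using F assms by (simp add: set_mult_assoc subset_trans)
  finally have "F <#> B \<subseteq> (F <#> C) <#> B'" .
  then show ?thesis
    unfolding confined_def using F assms
    by (intro exI[of _ "F <#> C"] conjI allI impI finite_set_mult set_mult_closed) blast+
qed

text \<open>
  Representatives \<open>a\<close> and \<open>a'\<close> of cosets of \<open>N\<close>, and one application of \<open>f\<close>, change the component in
  \<open>N\<close> by a factor \<open>inv a' \<otimes> (h \<otimes> a)\<close> with \<open>h \<in> E\<close>. There are finitely many such factors, and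
  \<open>N'\<close> only has to contain them.
\<close>

lemma confined_finitely_generated:
  assumes N: "confined N" "subgroup N G"
  shows "\<exists>C. finite C \<and> C \<subseteq> N \<and> (\<forall>N'. subgroup N' G \<longrightarrow> N' \<subseteq> N \<longrightarrow> C \<subseteq> N' \<longrightarrow> confined N')"
proof -
  obtain F0 where F0: "finite F0" "F0 \<subseteq> carrier G"
    "\<And>P n. P \<subseteq> N \<Longrightarrow> sparse P \<Longrightarrow> supp ((f ^^ n) (overlay P)) \<subseteq> F0 <#> N"
    using N(1) unfolding confined_def by blast
  define F where "F = F0 \<union> (E <#> D)"
  have F: "finite F" "F \<subseteq> carrier G"
    unfolding F_def using F0 E_finite[OF D_finite] E_closed[OF D_carrier] by auto
  define C where "C = {c \<in> N. \<exists>a\<in>F. \<exists>h\<in>E. \<exists>a'\<in>F. c = inv a' \<otimes> (h \<otimes> a)}"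
  have "C \<subseteq> (\<lambda>(a, h, a'). inv a' \<otimes> (h \<otimes> a)) ` (F \<times> E \<times> F)" unfolding C_def by force
  then have finC: "finite C" using F window finite_subset by blast
  have "confined N'" if N': "subgroup N' G" "N' \<subseteq> N" "C \<subseteq> N'" for N'
    unfolding confined_def
  proof (intro exI[of _ F] conjI allI impI F)
    fix P n assume P: "P \<subseteq> N'" "sparse P"
    have N'c: "N' \<subseteq> carrier G" using N' subgroup.subset by blast
    show "supp ((f ^^ n) (overlay P)) \<subseteq> F <#> N'"
    proof (induction n)
      case 0
      have "supp (overlay P) \<subseteq> (E <#> D) <#> P" by (rule overlay_supp[OF P(2)])
      also have "\<dots> \<subseteq> F <#> N'" unfolding F_def using P by (intro mono_set_mult) auto
      finally show ?case by simp
    next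
      case (Suc n)
      show ?case
      proof
        fix k assume k: "k \<in> supp ((f ^^ Suc n) (overlay P))"
        have "supp ((f ^^ Suc n) (overlay P)) \<subseteq> E <#> supp ((f ^^ n) (overlay P))"
          using supp_f[of "(f ^^ n) (overlay P)"] P by simp
        then obtain h a m where h: "h \<in> E" and a: "a \<in> F" and m: "m \<in> N'" and k1: "k = h \<otimes> (a \<otimes> m)"
          using k Suc by (force simp: mem_set_mult)
        have "k \<in> F0 <#> N" using F0(3)[of P "Suc n"] P N' k by blast
        then obtain a' m' where a': "a' \<in> F" and m': "m' \<in> N" and k2: "k = a' \<otimes> m'"
          by (auto simp: mem_set_mult F_def)
        have c: "h \<in> carrier G" "a \<in> carrier G" "a' \<in> carrier G" "m \<in> carrier G" "m' \<in> carrier G"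
          using h a a' m m' F N'c subgroup.subset[OF N(2)] by auto
        have eq: "(inv a' \<otimes> (h \<otimes> a)) \<otimes> m = m'"
        proof -
          have "(inv a' \<otimes> (h \<otimes> a)) \<otimes> m = inv a' \<otimes> k" using c k1 by (simp add: m_assoc)
          also have "\<dots> = m'" using c k2 by (simp add: m_assoc[symmetric])
          finally show ?thesis .
        qed
        have "inv a' \<otimes> (h \<otimes> a) = m' \<otimes> inv m" using eq c by (metis inv_closed inv_solve_right m_closed)
        then have "inv a' \<otimes> (h \<otimes> a) \<in> N"
          using N(2) m m' N' by (auto intro: subgroup.m_closed subgroup.m_inv_closed)
        then have "inv a' \<otimes> (h \<otimes> a) \<in> C" unfolding C_def using h a a' by blast
        then have "m' \<in> N'" using eq m N' by (metis subgroup.m_closed subsetD)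
        then show "k \<in> F <#> N'" using a' k2 by (auto intro: set_multI)
      qed
    qed
  qed
  then show ?thesis using finC by (intro exI[of _ C]) (auto simp: C_def)
qed

lemma confined_one_dying:
  assumes "confined {\<one>}"
  shows "dying x0"
proof -
  obtain F where F: "finite F" "F \<subseteq> carrier G"
    "\<And>P n. P \<subseteq> {\<one>} \<Longrightarrow> sparse P \<Longrightarrow> supp ((f ^^ n) (overlay P)) \<subseteq> F <#> {\<one>}"
    using assms unfolding confined_def by blast
  have sp: "sparse {\<one>}" by (auto simp: sparse_def)
  have "is_overlay {\<one>} x0"
    unfolding is_overlay_def
  proof (intro conjI ballI impI)
    fix g assume g: "g \<in> carrier G" "g \<notin> D <#> {\<one>}"
    then have "g \<notin> supp x0" using supp_D by (force simp: mem_set_mult)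
    then show "dist (\<phi> g x0) z < \<eta>" using not_supp g threshold by fastforce
  qed (use threshold in auto)
  then have eq: "overlay {\<one>} = x0" using overlay_unique overlay[OF sp] by blast
  have F1: "F <#> {\<one>} = F" using F by (force simp: mem_set_mult)
  obtain n where "supp ((f ^^ n) x0) \<inter> F = {}"
    using eventually_supp_off[OF x0_in F(1,2)] by blast
  moreover have "supp ((f ^^ n) x0) \<subseteq> F" using F(3)[of "{\<one>}" n] sp eq F1 by simp
  ultimately have "(f ^^ n) x0 = z" by (intro supp_empty) auto
  then show ?thesis by (auto simp: dying_def)
qed

end

section \<open>Infinite cyclic extensions\<close>

text \<open>
  The map \<open>deg\<close> is the quotient map from \<open>B\<close> to the infinite cyclic group \<open>B / N\<close>, which is generated by
  the image of \<open>t\<close>. The subgroups \<open>L\<close> come from residual finiteness: they have finite index in \<open>N\<close>,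
  so that modulo \<open>L\<close> a bounded set of degrees is finite, and they are arbitrarily sparse.
\<close>

locale cyclic_extension = seeded_endomorphism G X \<phi> z f \<eta> \<delta> E x0
  for G :: "('g, 'b) monoid_scheme" (structure)
    and X :: "'x::metric_space set" and \<phi> and z and f and \<eta> \<delta> and E and x0 +
  fixes N B and t and deg :: "'g \<Rightarrow> int"
  assumes N_sub: "subgroup N G" and B_sub: "subgroup B G" and N_B: "N \<subseteq> B"
    and t_B: "t \<in> B" and deg_t: "deg t = 1"
    and deg_mult: "\<And>a b. a \<in> B \<Longrightarrow> b \<in> B \<Longrightarrow> deg (a \<otimes> b) = deg a + deg b"
    and deg_0: "\<And>a. a \<in> B \<Longrightarrow> deg a = 0 \<longleftrightarrow> a \<in> N"
    and confined_B: "confined B"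
    and small_subgroups: "\<And>T. finite T \<Longrightarrow> \<one> \<notin> T \<Longrightarrow>
       \<exists>L C. subgroup L G \<and> L \<subseteq> N \<and> L \<inter> T = {} \<and> (\<forall>b\<in>B. \<forall>l\<in>L. b \<otimes> l \<otimes> inv b \<in> L) \<and>
             finite C \<and> C \<subseteq> N \<and> N \<subseteq> C <#> L"
begin

lemma B_in [simp]: "b \<in> B \<Longrightarrow> b \<in> carrier G" and B_closed [simp]: "a \<in> B \<Longrightarrow> b \<in> B \<Longrightarrow> a \<otimes> b \<in> B"
  and B_inv [simp]: "a \<in> B \<Longrightarrow> inv a \<in> B" and B_one [simp]: "\<one> \<in> B"
  using B_sub by (auto intro: subgroup.mem_carrier subgroup.m_closed subgroup.m_inv_closed subgroup.one_closed)

lemma N_in_B [simp]: "a \<in> N \<Longrightarrow> a \<in> B" using N_B by auto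

lemma deg_one [simp]: "deg \<one> = 0"
  using deg_0[of \<one>] N_sub subgroup.one_closed by auto

lemma deg_inv: "b \<in> B \<Longrightarrow> deg (inv b) = - deg b"
  using deg_mult[of b "inv b"] by simp

definition tpow :: "int \<Rightarrow> 'g" where "tpow q = t [^] q"

lemma tpow_B [simp]: "tpow q \<in> B"
  unfolding tpow_def using B_sub t_B by (rule subgroup_int_pow_closed)

lemma tpow_carrier [simp]: "tpow q \<in> carrier G" by simp

lemma tpow_0 [simp]: "tpow 0 = \<one>" by (simp add: tpow_def)

lemma tpow_add: "tpow (i + j) = tpow i \<otimes> tpow j"
  using t_B by (simp add: tpow_def int_pow_mult)

lemma tpow_neg: "inv (tpow q) = tpow (- q)"
  using t_B by (simp add: tpow_def int_pow_neg)

lemma deg_tpow [simp]: "deg (tpow q) = q"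
proof -
  have nat: "deg (tpow (int n)) = int n" for n
  proof (induction n)
    case (Suc n)
    have "tpow (int (Suc n)) = tpow (int n) \<otimes> tpow 1" using tpow_add[of "int n" 1] by (simp add: add.commute)
    moreover have "tpow 1 = t" using t_B by (simp add: tpow_def)
    ultimately show ?case using Suc t_B by (simp add: deg_mult deg_t)
  qed simp
  show ?thesis
  proof (cases "q \<ge> 0")
    case True
    then show ?thesis using nat[of "nat q"] by simp
  next
    case False
    then show ?thesis using nat[of "nat (- q)"] deg_inv[of "tpow (- q)"] by (simp add: tpow_neg)
  qed
qed

lemma degree_shift:
  assumes "a \<in> carrier G" "c \<in> carrier G" "b \<in> B" "b' \<in> B" "a \<otimes> b = c \<otimes> b'"
  shows "inv c \<otimes> a \<in> B" "deg (inv c \<otimes> a) = deg b' - deg b"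
proof -
  have "inv c \<otimes> a \<otimes> b = b'" using assms by (simp add: m_assoc inv_solve_left')
  then have e: "inv c \<otimes> a = b' \<otimes> inv b" using assms by (metis B_in inv_closed inv_solve_right m_closed)
  show "inv c \<otimes> a \<in> B" "deg (inv c \<otimes> a) = deg b' - deg b"
    unfolding e using assms by (simp_all add: deg_mult deg_inv)
qed

text \<open>
  Elements of \<open>F <#> B\<close> with \<open>F\<close> finite are written as \<open>a \<otimes> b\<close>. Neither the factors nor the degree of
  \<open>b\<close> are determined by the product, but two such degrees differ by a bounded amount.
\<close>

lemma degree_bound:
  assumes "finite A" "finite C" "A \<subseteq> carrier G" "C \<subseteq> carrier G"
  shows "\<exists>r\<ge>0. \<forall>a\<in>A. \<forall>c\<in>C. \<forall>b\<in>B. \<forall>b'\<in>B. a \<otimes> b = c \<otimes> b' \<longrightarrow> \<bar>deg b - deg b'\<bar> \<le> r"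
proof -
  define S where "S = (\<lambda>(a, c). \<bar>deg (inv c \<otimes> a)\<bar>) ` (A \<times> C)"
  have fin: "finite S" unfolding S_def using assms by simp
  define r where "r = Max (insert 0 S)"
  have "\<bar>deg b - deg b'\<bar> \<le> r" if "a \<in> A" "c \<in> C" "b \<in> B" "b' \<in> B" "a \<otimes> b = c \<otimes> b'" for a c b b'
  proof -
    have "\<bar>deg (inv c \<otimes> a)\<bar> \<in> S" unfolding S_def using that by force
    then have "\<bar>deg (inv c \<otimes> a)\<bar> \<le> r" unfolding r_def using fin by simp
    then show ?thesis using degree_shift(2)[of a c b b'] that assms by (auto simp: abs_minus_commute subset_iff)
  qed
  moreover have "0 \<le> r" unfolding r_def using fin by simp
  ultimately show ?thesis by blast
qed

definition layer :: "'g set \<Rightarrow> int set \<Rightarrow> 'g set" where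
  "layer F J = F <#> {b \<in> B. deg b \<in> J}"

lemma layer_mem: "g \<in> layer F J \<longleftrightarrow> (\<exists>a\<in>F. \<exists>b\<in>B. deg b \<in> J \<and> g = a \<otimes> b)"
  by (auto simp: layer_def mem_set_mult)

lemma layerI: "a \<in> F \<Longrightarrow> b \<in> B \<Longrightarrow> deg b \<in> J \<Longrightarrow> a \<otimes> b \<in> layer F J"
  by (auto simp: layer_mem)

lemma layer_carrier: "F \<subseteq> carrier G \<Longrightarrow> layer F J \<subseteq> carrier G"
  unfolding layer_def by (intro set_mult_closed) auto

definition periodic :: "'g set \<Rightarrow> 'x \<Rightarrow> bool" where
  "periodic L x \<longleftrightarrow> (\<forall>l\<in>L. \<phi> l x = x)"

lemma periodic_fn:
  assumes "periodic L x" "L \<subseteq> carrier G" "x \<in> X"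
  shows "periodic L ((f ^^ n) x)"
  using assms unfolding periodic_def by (metis fn_act subsetD)

lemma periodic_supp:
  assumes "periodic L x" "subgroup L G" "x \<in> X" "g \<in> carrier G" "l \<in> L"
  shows "g \<otimes> l \<in> supp x \<longleftrightarrow> g \<in> supp x"
  using assms supp_act[of l x g] subgroup.mem_carrier[of L G l] unfolding periodic_def by auto

text \<open>
  Modulo \<open>L\<close> there are finitely many elements to visit, and by asymptotic nilpotency they all fall
  silent together.
\<close>

lemma periodic_dying:
  assumes x: "x \<in> X" "periodic L x" and L: "subgroup L G"
    and Y: "finite Y" "Y \<subseteq> carrier G" "\<And>n. n \<ge> n0 \<Longrightarrow> supp ((f ^^ n) x) \<subseteq> Y <#> L"
  shows "dying x"
proof -
  obtain M where M: "\<And>n. n \<ge> M \<Longrightarrow> supp ((f ^^ n) x) \<inter> Y = {}"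
    using eventually_supp_off[OF x(1) Y(1,2)] by blast
  let ?n = "max M n0"
  have Lc: "L \<subseteq> carrier G" using L by (rule subgroup.subset)
  have "supp ((f ^^ ?n) x) = {}"
  proof (rule ccontr)
    assume "supp ((f ^^ ?n) x) \<noteq> {}"
    then obtain g where g: "g \<in> supp ((f ^^ ?n) x)" by blast
    then obtain y l where yl: "y \<in> Y" "l \<in> L" "g = y \<otimes> l"
      using subsetD[OF Y(3)[of ?n] g] by (auto elim!: set_multE)
    have "y \<in> supp ((f ^^ ?n) x)"
      using periodic_supp[OF periodic_fn[OF x(2) Lc x(1)] L, of ?n y l] g yl Y x by auto
    then show False using M[of ?n] yl by auto
  qed
  then show ?thesis using x supp_empty[of "(f ^^ ?n) x"] by (auto simp: dying_def)
qed

end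

section \<open>Walls\<close>

text \<open>
  A finite pattern \<open>P0\<close> of positions in \<open>N\<close> is repeated along \<open>L\<close>, and copies of the resulting
  \<open>L\<close>-periodic pattern are put into layers of different degrees. The constant \<open>gap\<close> is a distance
  of degrees beyond which the copies do not interfere.
\<close>

locale wall_setting = cyclic_extension G X \<phi> z f \<eta> \<delta> E x0 N B t deg
  for G :: "('g, 'b) monoid_scheme" (structure)
    and X :: "'x::metric_space set" and \<phi> and z and f and \<eta> \<delta> and E and x0 and N B and t and deg +
  fixes P0 L C and gap :: int
  assumes P0: "P0 \<subseteq> N" "finite P0"
    and L: "subgroup L G" "L \<subseteq> N" "\<And>b l. b \<in> B \<Longrightarrow> l \<in> L \<Longrightarrow> b \<otimes> l \<otimes> inv b \<in> L"
    and C: "finite C" "C \<subseteq> N" "N \<subseteq> C <#> L"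
    and gap: "gap \<ge> 0"
    and sparse_P0L: "sparse (P0 <#> L)"
    and gap_D: "\<And>c d b b'. c \<in> D \<Longrightarrow> d \<in> D \<Longrightarrow> b \<in> B \<Longrightarrow> b' \<in> B \<Longrightarrow> c \<otimes> b = d \<otimes> b' \<Longrightarrow> \<bar>deg b - deg b'\<bar> \<le> gap"
begin

lemma L_in [simp]: "l \<in> L \<Longrightarrow> l \<in> N" and L_in_B [simp]: "l \<in> L \<Longrightarrow> l \<in> B"
  and L_mult [simp]: "l \<in> L \<Longrightarrow> l' \<in> L \<Longrightarrow> l \<otimes> l' \<in> L"
  and L_inv [simp]: "l \<in> L \<Longrightarrow> inv l \<in> L" and L_one [simp]: "\<one> \<in> L"
  using L(1,2) by (auto intro: subgroup.m_closed subgroup.m_inv_closed subgroup.one_closed)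

lemma L_carrier: "L \<subseteq> carrier G" using L(1) by (rule subgroup.subset)

lemma L_in_carrier [simp]: "l \<in> L \<Longrightarrow> l \<in> carrier G" by simp

lemma P0_in [simp]: "p \<in> P0 \<Longrightarrow> p \<in> N" using P0 by auto

lemma deg_N [simp]: "a \<in> N \<Longrightarrow> deg a = 0" using deg_0 by simp

definition pos :: "int set \<Rightarrow> 'g set" where
  "pos Q = (\<Union>q\<in>Q. (P0 <#> L) #> tpow q)"

lemma pos_mem: "b \<in> pos Q \<longleftrightarrow> (\<exists>p\<in>P0. \<exists>l\<in>L. \<exists>q\<in>Q. b = p \<otimes> l \<otimes> tpow q)"
  unfolding pos_def r_coset_def set_mult_def by blast

lemma pos_B: "pos Q \<subseteq> B" by (auto simp: pos_mem)

lemma pos_deg: "b \<in> pos Q \<Longrightarrow> deg b \<in> Q" by (auto simp: pos_mem deg_mult)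

lemma pos_subset_deg: "b \<in> pos Q \<Longrightarrow> deg b \<in> Q' \<Longrightarrow> b \<in> pos Q'"
  by (fastforce simp: pos_mem deg_mult)

definition gapped :: "int set \<Rightarrow> bool" where
  "gapped Q \<longleftrightarrow> finite Q \<and> (\<forall>i\<in>Q. \<forall>j\<in>Q. i \<noteq> j \<longrightarrow> gap < \<bar>i - j\<bar>)"

lemma sparse_pos:
  assumes Q: "gapped Q"
  shows "sparse (pos Q)"
  unfolding sparse_def
proof (intro conjI ballI impI)
  show "pos Q \<subseteq> carrier G" using pos_B[of Q] by (auto dest!: subsetD)
  fix b b' c d assume a: "b \<in> pos Q" "b' \<in> pos Q" "c \<in> D" "d \<in> D" "c \<otimes> b = d \<otimes> b'"
  then have BB: "b \<in> B" "b' \<in> B" using pos_B by auto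
  obtain p l q where b: "p \<in> P0" "l \<in> L" "q \<in> Q" "b = p \<otimes> l \<otimes> tpow q" using a by (auto simp: pos_mem)
  obtain p' l' q' where b': "p' \<in> P0" "l' \<in> L" "q' \<in> Q" "b' = p' \<otimes> l' \<otimes> tpow q'" using a by (auto simp: pos_mem)
  have "\<bar>deg b - deg b'\<bar> \<le> gap" using gap_D a BB by blast
  moreover have "deg b = q" "deg b' = q'" using b b' by (auto simp: deg_mult)
  ultimately have q: "q = q'" using Q b b' unfolding gapped_def by fastforce
  have "(c \<otimes> (p \<otimes> l)) \<otimes> tpow q = (d \<otimes> (p' \<otimes> l')) \<otimes> tpow q"
    using a(3-5) b b' q by (simp add: m_assoc)
  then have "c \<otimes> (p \<otimes> l) = d \<otimes> (p' \<otimes> l')" using a(3,4) b b' by simp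
  moreover have "p \<otimes> l \<in> P0 <#> L" "p' \<otimes> l' \<in> P0 <#> L" using b b' by (auto intro: set_multI)
  ultimately have "p \<otimes> l = p' \<otimes> l'" using sparse_P0L a(3,4) unfolding sparse_def by blast
  then show "b = b'" using b b' q by simp
qed

definition row :: "int set \<Rightarrow> 'x" where "row Q = overlay (pos Q)"

lemma row_in [simp]: "gapped Q \<Longrightarrow> row Q \<in> X"
  unfolding row_def using sparse_pos by simp

lemma pos_L: "l \<in> L \<Longrightarrow> pos Q #> l = pos Q"
proof -
  have sub: "pos Q #> l \<subseteq> pos Q" if l: "l \<in> L" for l
  proof
    fix k assume "k \<in> pos Q #> l"
    then obtain p l1 q where k: "p \<in> P0" "l1 \<in> L" "q \<in> Q" "k = (p \<otimes> l1 \<otimes> tpow q) \<otimes> l"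
      by (auto simp: r_coset_def pos_mem)
    have "k = p \<otimes> (l1 \<otimes> (tpow q \<otimes> l \<otimes> inv (tpow q))) \<otimes> tpow q"
      using k l by (simp add: m_assoc)
    moreover have "l1 \<otimes> (tpow q \<otimes> l \<otimes> inv (tpow q)) \<in> L" using k l L(3) by simp
    ultimately show "k \<in> pos Q" using k by (auto simp: pos_mem)
  qed
  assume l: "l \<in> L"
  have "pos Q = (pos Q #> inv l) #> l"
    using l pos_B by (simp add: coset_mult_assoc subset_iff coset_mult_one)
  also have "\<dots> \<subseteq> pos Q #> l" using sub[of "inv l"] l by (auto simp: r_coset_def)
  finally show ?thesis using sub[OF l] by blast
qed

lemma row_periodic: "gapped Q \<Longrightarrow> periodic L (row Q)"
  unfolding periodic_def
proof
  fix l assume Q: "gapped Q" and l: "l \<in> L"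
  then have "\<phi> (inv (inv l)) (overlay (pos Q)) = overlay (pos Q #> inv l)"
    by (intro sparse_translate sparse_pos) auto
  then show "\<phi> l (row Q) = row Q" using l by (simp add: row_def pos_L)
qed

lemma pos_shift: "pos Q #> tpow j = pos ((+) j ` Q)"
proof -
  have e: "p \<otimes> l \<otimes> tpow q \<otimes> tpow j = p \<otimes> l \<otimes> tpow (j + q)" if "p \<in> P0" "l \<in> L" for p l q
    using that by (subst add.commute) (simp add: m_assoc tpow_add)
  show ?thesis
  proof (intro equalityI subsetI)
    fix k assume "k \<in> pos Q #> tpow j"
    then obtain p l q where k: "p \<in> P0" "l \<in> L" "q \<in> Q" "k = p \<otimes> l \<otimes> tpow q \<otimes> tpow j"
      by (auto simp: r_coset_def pos_mem)
    then have "k = p \<otimes> l \<otimes> tpow (j + q)" "j + q \<in> (+) j ` Q" using e by auto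
    then show "k \<in> pos ((+) j ` Q)" unfolding pos_mem using k(1,2) by fast
  next
    fix k assume "k \<in> pos ((+) j ` Q)"
    then obtain p l q where k: "p \<in> P0" "l \<in> L" "q \<in> Q" "k = p \<otimes> l \<otimes> tpow (j + q)"
      by (auto simp: pos_mem)
    then have "k = (p \<otimes> l \<otimes> tpow q) \<otimes> tpow j" using e by simp
    moreover have "p \<otimes> l \<otimes> tpow q \<in> pos Q" unfolding pos_mem using k(1-3) by fast
    ultimately show "k \<in> pos Q #> tpow j" by (auto simp: r_coset_def)
  qed
qed

lemma row_shift: "gapped Q \<Longrightarrow> \<phi> (tpow j) (row Q) = row ((\<lambda>q. q - j) ` Q)"
proof -
  assume Q: "gapped Q"
  have "\<phi> (inv (tpow (- j))) (overlay (pos Q)) = overlay (pos Q #> tpow (- j))"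
    using Q by (intro sparse_translate sparse_pos) auto
  then show ?thesis by (simp add: row_def pos_shift tpow_neg)
qed

lemma row_near:
  assumes "gapped Q" "gapped Q'" "A \<subseteq> carrier G"
    and r: "\<And>d b g. d \<in> D \<Longrightarrow> b \<in> B \<Longrightarrow> d \<otimes> b \<in> A \<Longrightarrow> \<bar>deg b\<bar> \<le> r"
    and "Q \<inter> {-r..r} = Q' \<inter> {-r..r}"
  shows "near A (row Q) (row Q')"
  unfolding row_def
proof (rule overlay_near)
  fix p d assume p: "p \<in> pos Q - pos Q' \<or> p \<in> pos Q' - pos Q" and d: "d \<in> D"
  show "d \<otimes> p \<notin> A"
  proof
    assume "d \<otimes> p \<in> A"
    moreover have "p \<in> B" using p pos_B by auto
    ultimately have "deg p \<in> {-r..r}" using r d by fastforce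
    then show False
      using p pos_deg pos_subset_deg assms(5) by blast
  qed
qed (use assms sparse_pos in auto)

lemma layer_L:
  assumes "g \<in> layer F J" "l \<in> L" "F \<subseteq> carrier G"
  shows "g \<otimes> l \<in> layer F J"
proof -
  obtain a b where ab: "a \<in> F" "b \<in> B" "deg b \<in> J" "g = a \<otimes> b" using assms by (auto simp: layer_mem)
  then have "g \<otimes> l = a \<otimes> (b \<otimes> l)" using assms by (auto intro!: m_assoc)
  then show ?thesis using layerI[of a F "b \<otimes> l" J] ab assms by (simp add: deg_mult)
qed

lemma layer_finite:
  assumes F: "finite F" "F \<subseteq> carrier G" and J: "finite J"
  shows "\<exists>Y. finite Y \<and> Y \<subseteq> carrier G \<and> layer F J \<subseteq> Y <#> L"
proof (intro exI conjI)
  let ?Y = "F <#> ((\<lambda>(j, c). tpow j \<otimes> c) ` (J \<times> C))"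
  have Cc: "C \<subseteq> carrier G" using C by auto
  then show "?Y \<subseteq> carrier G" using F by (intro set_mult_closed) auto
  show "finite ?Y" using F J C by (intro finite_set_mult) auto
  show "layer F J \<subseteq> ?Y <#> L"
  proof
    fix g assume "g \<in> layer F J"
    then obtain a b where ab: "a \<in> F" "b \<in> B" "deg b \<in> J" "g = a \<otimes> b" by (auto simp: layer_mem)
    define j where "j = deg b"
    have "deg (inv (tpow j) \<otimes> b) = 0" using ab by (simp add: deg_mult deg_inv j_def)
    then have "inv (tpow j) \<otimes> b \<in> N" using deg_0 ab by simp
    then obtain c l where cl: "c \<in> C" "l \<in> L" "inv (tpow j) \<otimes> b = c \<otimes> l"
      using C(3) by (meson set_multE subsetD)
    have cc: "c \<in> carrier G" "a \<in> carrier G" using cl Cc ab F by auto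
    have "b = tpow j \<otimes> (c \<otimes> l)" using cl(2,3) cc ab by (simp add: inv_solve_left')
    then have "g = (a \<otimes> (tpow j \<otimes> c)) \<otimes> l" using ab cc cl by (simp add: m_assoc)
    moreover have "a \<otimes> (tpow j \<otimes> c) \<in> ?Y" using ab cl by (intro set_multI) (auto simp: j_def)
    ultimately show "g \<in> ?Y <#> L" using cl by (auto intro: set_multI)
  qed
qed

lemma finite_window:
  assumes A: "finite A" "A \<subseteq> carrier G"
  shows "\<exists>r\<ge>0. \<forall>d\<in>D. \<forall>b\<in>B. d \<otimes> b \<in> A \<longrightarrow> \<bar>deg b\<bar> \<le> r"
proof -
  obtain r where "r \<ge> 0" "\<forall>d\<in>D. \<forall>c\<in>A. \<forall>b\<in>B. \<forall>b'\<in>B. d \<otimes> b = c \<otimes> b' \<longrightarrow> \<bar>deg b - deg b'\<bar> \<le> r"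
    using degree_bound[OF D_finite A(1) D_carrier A(2)] by blast
  moreover have "d \<otimes> b = (d \<otimes> b) \<otimes> \<one>" if "d \<in> D" "b \<in> B" for d b using that by simp
  ultimately show ?thesis using deg_one B_one by (metis diff_zero)
qed

text \<open>
  The thickness a wall must have: layers whose degrees differ by more than \<open>w\<close> cannot interact
  through two windows.
\<close>

definition thick :: "'g set \<Rightarrow> int \<Rightarrow> bool" where
  "thick F w \<longleftrightarrow> w \<ge> 0 \<and> (\<forall>a\<in>F. \<forall>h\<in>E. \<forall>h'\<in>E. \<forall>a'\<in>F. \<forall>b\<in>B. \<forall>b'\<in>B.
    a \<otimes> b = h \<otimes> (h' \<otimes> (a' \<otimes> b')) \<longrightarrow> \<bar>deg b - deg b'\<bar> \<le> w)"

text \<open>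
  The layers around the degrees 0 and \<open>M\<close> are quiet at all times, so they separate what is between them
  from the rest.
\<close>

definition walled :: "'g set \<Rightarrow> int \<Rightarrow> int \<Rightarrow> 'x \<Rightarrow> bool" where
  "walled F w M u \<longleftrightarrow> u \<in> X \<and> periodic L u \<and>
    (\<forall>m. \<forall>g\<in>supp ((f ^^ m) u). \<exists>a\<in>F. \<exists>b\<in>B. g = a \<otimes> b) \<and>
    (\<forall>m. \<forall>a\<in>F. \<forall>b\<in>B. a \<otimes> b \<in> supp ((f ^^ m) u) \<longrightarrow> w < \<bar>deg b\<bar> \<and> w < \<bar>deg b - M\<bar>)"

lemma thick_exists:
  assumes F: "finite F" "F \<subseteq> carrier G"
  shows "\<exists>w. thick F w"
proof -
  have E2: "E <#> E \<subseteq> carrier G" "finite (E <#> E)"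
    using E_closed[OF window(2)] E_finite[OF window(1)] by simp_all
  have EEF: "(E <#> E) <#> F \<subseteq> carrier G" "finite ((E <#> E) <#> F)"
    using set_mult_closed[OF E2(1) F(2)] finite_set_mult[OF E2(2) F(1)] by simp_all
  obtain w where w: "w \<ge> 0" "\<forall>a\<in>F. \<forall>c\<in>(E <#> E) <#> F. \<forall>b\<in>B. \<forall>b'\<in>B. a \<otimes> b = c \<otimes> b' \<longrightarrow> \<bar>deg b - deg b'\<bar> \<le> w"
    using degree_bound[OF F(1) EEF(2) F(2) EEF(1)] by blast
  have "\<bar>deg b - deg b'\<bar> \<le> w"
    if "a \<in> F" "h \<in> E" "h' \<in> E" "a' \<in> F" "b \<in> B" "b' \<in> B" "a \<otimes> b = h \<otimes> (h' \<otimes> (a' \<otimes> b'))" for a h h' a' b b'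
  proof -
    have "a \<otimes> b = (h \<otimes> h' \<otimes> a') \<otimes> b'" using that F by (simp add: m_assoc subset_iff)
    moreover have "h \<otimes> h' \<otimes> a' \<in> (E <#> E) <#> F" using that by (intro set_multI)
    ultimately show ?thesis using w(2) that by blast
  qed
  with w(1) show ?thesis unfolding thick_def by blast
qed

lemma thick_step:
  assumes "thick F w" "F \<subseteq> carrier G" "a \<in> F" "h \<in> E" "a' \<in> F" "b \<in> B" "b' \<in> B" "a \<otimes> b = h \<otimes> (a' \<otimes> b')"
  shows "\<bar>deg b - deg b'\<bar> \<le> w"
proof -
  have "a' \<otimes> b' \<in> carrier G" using assms by auto
  then have "a \<otimes> b = \<one> \<otimes> (h \<otimes> (a' \<otimes> b'))" using assms by simp
  then show ?thesis using assms window(3) unfolding thick_def by blast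
qed

text \<open>
  This is \<open>finally_quiet\<close> in the class of the rows, and it provides a wall: whatever is placed in layers
  of large degree, in the presence of \<open>Q0\<close> the layers of degree \<open>-w\<close> to \<open>w\<close> become and remain quiet,
  so that the two sides do not interact any more.
\<close>

lemma quiet_walls:
  assumes F: "finite F" "F \<subseteq> carrier G"
  shows "\<exists>Q0 J N0. gapped Q0 \<and> 0 \<in> Q0 \<and> 0 \<le> J \<and> Q0 \<subseteq> {-J..J} \<and>
    (\<forall>Q n. gapped Q \<longrightarrow> Q \<inter> {-J..J} = Q0 \<longrightarrow> N0 \<le> n \<longrightarrow>
       supp ((f ^^ n) (row Q)) \<inter> layer F {-w..w} = {})"
proof -
  obtain W where W: "finite W" "W \<subseteq> carrier G" "layer F {-w..w} \<subseteq> W <#> L"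
    using layer_finite[OF F, of "{-w..w}"] by auto
  have "\<exists>x\<in>{row Q |Q. gapped Q \<and> 0 \<in> Q}. \<exists>K N. finite K \<and> K \<subseteq> carrier G \<and>
           (\<forall>y\<in>{row Q |Q. gapped Q \<and> 0 \<in> Q}. near K x y \<longrightarrow> (\<forall>n\<ge>N. supp ((f ^^ n) y) \<inter> W = {}))"
  proof (rule finally_quiet[OF _ _ W(1,2)])
    have "gapped {0}" by (simp add: gapped_def)
    then show "{row Q |Q. gapped Q \<and> 0 \<in> Q} \<noteq> {}" by blast
  qed auto
  then obtain Q0 K N0 where Q0: "gapped Q0" "0 \<in> Q0" and K: "finite K" "K \<subseteq> carrier G"
    and quiet0: "\<And>Q n. gapped Q \<Longrightarrow> 0 \<in> Q \<Longrightarrow> near K (row Q0) (row Q) \<Longrightarrow> N0 \<le> n \<Longrightarrow>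
        supp ((f ^^ n) (row Q)) \<inter> W = {}"
    by blast
  obtain J0 where J0: "\<forall>d\<in>D. \<forall>b\<in>B. d \<otimes> b \<in> K \<longrightarrow> \<bar>deg b\<bar> \<le> J0"
    using finite_window[OF K] by blast
  obtain J where J: "J \<ge> J0" "J \<ge> 0" "\<And>q. q \<in> Q0 \<Longrightarrow> \<bar>q\<bar> \<le> J"
  proof -
    define S where "S = insert 0 (insert J0 ((\<lambda>q. \<bar>q\<bar>) ` Q0))"
    have "finite S" using Q0 by (simp add: gapped_def S_def)
    then have "s \<le> Max S" if "s \<in> S" for s using that by simp
    then show thesis by (intro that[of "Max S"]) (simp_all add: S_def)
  qed
  have Q0J: "Q0 \<subseteq> {-J..J}" using J(3) by (fastforce simp: abs_le_iff)
  have quiet: "supp ((f ^^ n) (row Q)) \<inter> layer F {-w..w} = {}"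
    if Q: "gapped Q" "Q \<inter> {-J..J} = Q0" and n: "N0 \<le> n" for Q n
  proof (rule ccontr)
    assume "supp ((f ^^ n) (row Q)) \<inter> layer F {-w..w} \<noteq> {}"
    then obtain g where g: "g \<in> supp ((f ^^ n) (row Q))" "g \<in> W <#> L" using W(3) by blast
    then obtain y l where yl: "y \<in> W" "l \<in> L" "g = y \<otimes> l" by (auto elim!: set_multE)
    have "periodic L ((f ^^ n) (row Q))"
      using Q by (intro periodic_fn row_periodic L_carrier) auto
    then have "y \<in> supp ((f ^^ n) (row Q))"
      using periodic_supp[OF _ L(1), of "(f ^^ n) (row Q)" y l] g yl W Q by auto
    moreover have "near K (row Q0) (row Q)"
    proof (rule row_near[OF Q0(1) Q(1) K(2), where r = J])
      show "\<bar>deg b\<bar> \<le> J" if "d \<in> D" "b \<in> B" "d \<otimes> b \<in> K" for d b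
        using J0 that J(1) by fastforce
      have "Q0 \<inter> {-J..J} = Q0" using Q0J by blast
      then show "Q0 \<inter> {-J..J} = Q \<inter> {-J..J}" using Q(2) by simp
    qed
    ultimately show False using quiet0[OF Q(1) _ _ n] Q Q0(2) yl(1) by blast
  qed
  show ?thesis using Q0 J(2) Q0J quiet by blast
qed

text \<open>
  Let \<open>u\<close> have quiet walls at the degrees 0 and \<open>M\<close>. The part \<open>y\<close> of \<open>u\<close> between the walls evolves on
  its own. It meets finitely many cosets of \<open>L\<close> only, so it dies. Therefore \<open>dying_spread_bounded\<close>
  applies to \<open>y\<close>, for the subgroup \<open>L\<close>, and to its translates: if \<open>y\<close> visits a layer, then its
  support was close to this layer at the beginning. The bound for the distance is independent of \<open>M\<close>.
\<close>

lemma trapped_between_walls: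
  assumes F: "finite F" "F \<subseteq> carrier G" and H: "finite H" "H \<subseteq> carrier G" and thick: "thick F w"
  shows "\<exists>R\<ge>0. \<forall>M u Q m. 2 * w < M \<longrightarrow> walled F w M u \<longrightarrow> supp u \<subseteq> H <#> pos Q \<longrightarrow>
    (\<forall>a\<in>F. \<forall>b\<in>B. a \<otimes> b \<in> supp ((f ^^ m) u) \<longrightarrow> 0 < deg b \<longrightarrow> deg b < M \<longrightarrow>
       (\<exists>q\<in>Q. \<bar>deg b - q\<bar> \<le> R))"
proof -
  have EF: "E <#> F \<subseteq> carrier G" "finite (E <#> F)"
    using E_closed[OF F(2)] E_finite[OF F(1)] by simp_all
  have EH: "finite (E <#> H)" "E <#> H \<subseteq> carrier G"
    using E_finite[OF H(1)] E_closed[OF H(2)] by simp_all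
  have w: "w \<ge> 0" using thick by (simp add: thick_def)
  have w2: "\<bar>deg b - deg b'\<bar> \<le> w"
    if "a \<in> F" "h \<in> E" "h' \<in> E" "a' \<in> F" "b \<in> B" "b' \<in> B" "a \<otimes> b = h \<otimes> (h' \<otimes> (a' \<otimes> b'))" for a h h' a' b b'
    using thick that unfolding thick_def by blast
  obtain W1 where W1: "finite W1" "W1 \<subseteq> carrier G" "layer (E <#> F) {0} \<subseteq> W1 <#> L"
    using layer_finite[OF EF(2,1), of "{0}"] by auto
  obtain F' where F'': "finite F' \<and> F' \<subseteq> carrier G \<and> (\<forall>y. dying y \<longrightarrow> thin L y \<longrightarrow>
      supp y \<inter> (F' <#> L) = {} \<longrightarrow> (\<forall>n. supp ((f ^^ n) y) \<inter> W1 = {}))"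
    using dying_spread_bounded[OF L_carrier L_one W1(1,2)] by (rule exE)
  then have F': "finite F'" "F' \<subseteq> carrier G"
    and avoid: "\<And>y n. dying y \<Longrightarrow> thin L y \<Longrightarrow> supp y \<inter> (F' <#> L) = {} \<Longrightarrow> supp ((f ^^ n) y) \<inter> W1 = {}"
    by simp_all
  obtain R0 where R0: "R0 \<ge> 0" "\<forall>c\<in>E <#> H. \<forall>d\<in>F'. \<forall>b\<in>B. \<forall>b'\<in>B. c \<otimes> b = d \<otimes> b' \<longrightarrow> \<bar>deg b - deg b'\<bar> \<le> R0"
    using degree_bound[OF EH(1) F'(1) EH(2) F'(2)] by blast
  have "\<exists>q\<in>Q. \<bar>deg b - q\<bar> \<le> R0"
    if M: "2 * w < M" and walled: "walled F w M u" and u_supp: "supp u \<subseteq> H <#> pos Q"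
      and s: "a \<otimes> b \<in> supp ((f ^^ m) u)" and a: "a \<in> F" and b: "b \<in> B"
      and j: "0 < deg b" "deg b < M"
    for M u Q m a b
  proof -
    have uX: "u \<in> X" and u_per: "periodic L u"
      and u_rep: "\<And>m g. g \<in> supp ((f ^^ m) u) \<Longrightarrow> \<exists>a\<in>F. \<exists>b\<in>B. g = a \<otimes> b"
      and u_band: "\<And>a b m. a \<otimes> b \<in> supp ((f ^^ m) u) \<Longrightarrow> a \<in> F \<Longrightarrow> b \<in> B \<Longrightarrow>
        w < \<bar>deg b\<bar> \<and> w < \<bar>deg b - M\<bar>"
      using walled unfolding walled_def by simp_all
    define A where "A = layer (E <#> F) {0<..<M}"
    have A_c: "A \<subseteq> carrier G" unfolding A_def by (rule layer_carrier[OF EF(1)])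
    have A_mem: "g \<in> A \<longleftrightarrow> (\<exists>h\<in>E. \<exists>a\<in>F. \<exists>b\<in>B. 0 < deg b \<and> deg b < M \<and> g = h \<otimes> (a \<otimes> b))" for g
    proof
      assume "g \<in> A"
      then obtain c b where c: "c \<in> E <#> F" and b: "b \<in> B" "deg b \<in> {0<..<M}" "g = c \<otimes> b"
        unfolding A_def layer_mem by (elim bexE conjE)
      from c obtain h a where ha: "h \<in> E" "a \<in> F" "c = h \<otimes> a" by (rule set_multE)
      then have "a \<in> carrier G" using F by auto
      then have "g = h \<otimes> (a \<otimes> b)" using ha b by (simp add: m_assoc)
      then show "\<exists>h\<in>E. \<exists>a\<in>F. \<exists>b\<in>B. 0 < deg b \<and> deg b < M \<and> g = h \<otimes> (a \<otimes> b)"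
        using ha b by (intro bexI[of _ h] bexI[of _ a] bexI[of _ b]) simp_all
    next
      assume "\<exists>h\<in>E. \<exists>a\<in>F. \<exists>b\<in>B. 0 < deg b \<and> deg b < M \<and> g = h \<otimes> (a \<otimes> b)"
      then obtain h a b where r: "h \<in> E" "a \<in> F" "b \<in> B" "0 < deg b" "deg b < M" "g = h \<otimes> (a \<otimes> b)"
        by (elim bexE conjE)
      then have "a \<in> carrier G" using F by auto
      then have "g = (h \<otimes> a) \<otimes> b" using r by (simp add: m_assoc)
      moreover have "(h \<otimes> a) \<otimes> b \<in> A" unfolding A_def using r by (intro layerI set_multI) simp_all
      ultimately show "g \<in> A" by simp
    qed
    have A_I: "h \<otimes> (a \<otimes> b) \<in> A" if "h \<in> E" "a \<in> F" "b \<in> B" "0 < deg b" "deg b < M" for h a b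
      using that unfolding A_mem by blast
    \<comment> \<open>The point between the walls. The set \<open>A\<close> includes a window around the layers, so that nothing visible crosses its boundary on the sides either.\<close>
    define v where "v g = (if g \<in> A then u else z)" for g
    have vX: "v \<in> carrier G \<rightarrow> X" using uX by (auto simp: v_def)
    have inA: "0 < deg b' \<and> deg b' < M"
      if k: "k \<in> supp ((f ^^ i) (u))" "k = a' \<otimes> b'" "a' \<in> F" "b' \<in> B"
        and near: "\<bar>deg b' - deg b''\<bar> \<le> w" "0 < deg b''" "deg b'' < M" for k i a' b' b''
    proof -
      have "w < \<bar>deg b'\<bar>" "w < \<bar>deg b' - M\<bar>" using u_band[of a' b' i] k by auto
      then show ?thesis using near M w by linarith
    qed
    have sep: "separated ((f ^^ i) \<circ> v)" for i
      unfolding separated_def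
    proof (intro ballI impI)
      fix g h assume g: "g \<in> carrier G" and h: "h \<in> E" and ne: "((f ^^ i) \<circ> v) (h \<otimes> g) \<noteq> ((f ^^ i) \<circ> v) g"
      then have iff: "h \<otimes> g \<in> A \<longleftrightarrow> g \<notin> A" by (auto simp: v_def split: if_splits)
      have "g \<notin> supp ((f ^^ i) (u))"
      proof
        assume s: "g \<in> supp ((f ^^ i) (u))"
        then obtain a' b' where ab: "a' \<in> F" "b' \<in> B" "g = a' \<otimes> b'" using u_rep by blast
        have abc: "a' \<in> carrier G" "b' \<in> carrier G" using ab F by auto
        have "0 < deg b' \<and> deg b' < M"
        proof (cases "g \<in> A")
          case True
          then obtain h' a'' b'' where r: "h' \<in> E" "a'' \<in> F" "b'' \<in> B" "0 < deg b''" "deg b'' < M" "g = h' \<otimes> (a'' \<otimes> b'')"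
            unfolding A_mem by blast
          then have "\<bar>deg b' - deg b''\<bar> \<le> w" using thick_step[OF thick F(2), of a' h' a'' b' b''] ab by simp
          then show ?thesis using inA[OF s ab(3,1,2)] r by blast
        next
          case False
          then obtain h' a'' b'' where r: "h' \<in> E" "a'' \<in> F" "b'' \<in> B" "0 < deg b''" "deg b'' < M" "h \<otimes> g = h' \<otimes> (a'' \<otimes> b'')"
            using iff unfolding A_mem by blast
          have "g = inv h \<otimes> (h' \<otimes> (a'' \<otimes> b''))"
            using r g h F by (intro E_sym[of g _ h]) (auto simp: subset_iff)
          then have "\<bar>deg b' - deg b''\<bar> \<le> w" using w2[of a' "inv h" h' a'' b' b''] ab r window(4)[OF h] by simp
          then show ?thesis using inA[OF s ab(3,1,2)] r by blast
        qed
        then have "\<one> \<otimes> (a' \<otimes> b') \<in> A" "h \<otimes> (a' \<otimes> b') \<in> A"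
          using A_I[OF window(3) ab(1,2)] A_I[OF h ab(1,2)] by blast+
        then have "g \<in> A" "h \<otimes> g \<in> A" using ab abc by simp_all
        then show False using iff by simp
      qed
      then show "g \<notin> supp (((f ^^ i) \<circ> v) g) \<and> g \<notin> supp (((f ^^ i) \<circ> v) (h \<otimes> g))"
        by (auto simp: v_def)
    qed
    have "separated v" using sep[of 0] by (simp add: comp_def)
    from realization_exists[OF vX this] obtain y where y: "y \<in> X" "realizes y v" by blast
    have real: "realizes ((f ^^ i) y) ((f ^^ i) \<circ> v)" for i
      using sep by (intro realizes_fn y vX)
    have A_L: "g \<otimes> l \<in> A \<longleftrightarrow> g \<in> A" if "g \<in> carrier G" "l \<in> L" for g l
    proof
      show "g \<otimes> l \<in> A" if "g \<in> A" using that \<open>l \<in> L\<close> EF unfolding A_def by (intro layer_L)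
      assume "g \<otimes> l \<in> A"
      then have "g \<otimes> l \<otimes> inv l \<in> A"
        unfolding A_def by (rule layer_L) (use that EF in simp_all)
      then show "g \<in> A" using that by (simp add: m_assoc)
    qed
    have y_per: "periodic L y"
      unfolding periodic_def
    proof
      fix l assume l: "l \<in> L"
      show "\<phi> l y = y"
      proof (rule realizes_unique[OF _ y(1) _ y(2)])
        show "realizes (\<phi> l y) v"
          unfolding realizes_def
        proof
          fix g assume g: "g \<in> carrier G"
          have "dist (\<phi> (g \<otimes> l) y) (\<phi> (g \<otimes> l) (v (g \<otimes> l))) < \<eta>"
            using y(2) g l unfolding realizes_def by simp
          moreover have "\<phi> (g \<otimes> l) (v (g \<otimes> l)) = \<phi> g (v g)"
            using A_L[OF g l] g l u_per uX by (simp add: v_def periodic_def)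
          ultimately show "dist (\<phi> g (\<phi> l y)) (\<phi> g (v g)) < \<eta>"
            using g l y by simp
        qed
      qed (use l y in simp)
    qed
    have "finite {0<..<M}" by simp
    from layer_finite[OF EF(2,1) this] obtain Y where Y: "finite Y" "Y \<subseteq> carrier G" "A \<subseteq> Y <#> L"
      unfolding A_def by blast
    have EY: "finite (E <#> Y)" "E <#> Y \<subseteq> carrier G"
      using E_finite[OF Y(1)] E_closed[OF Y(2)] by auto
    have supp_y: "supp ((f ^^ i) y) \<subseteq> (E <#> Y) <#> L" for i
    proof -
      have "supp ((f ^^ i) y) \<subseteq> E <#> {g \<in> carrier G. g \<in> supp (((f ^^ i) \<circ> v) g)}"
        by (rule realizes_supp_subset[OF fn_in[OF y(1)] real])
      also have "\<dots> \<subseteq> E <#> (Y <#> L)"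
        using Y(3) by (intro mono_set_mult) (auto simp: v_def split: if_splits)
      finally show ?thesis using Y L_carrier window by (simp add: set_mult_assoc)
    qed
    have y_dying: "dying y" by (rule periodic_dying[OF y(1) y_per L(1) EY supp_y])
    have supp_y0: "supp y \<subseteq> (E <#> H) <#> pos Q"
    proof -
      have pc: "pos Q \<subseteq> carrier G" using pos_B[of Q] by (auto dest!: subsetD)
      have "supp y \<subseteq> E <#> {g \<in> carrier G. g \<in> supp (v g)}" by (rule realizes_supp_subset[OF y])
      also have "\<dots> \<subseteq> E <#> (H <#> pos Q)"
        using u_supp by (intro mono_set_mult) (auto simp: v_def split: if_splits)
      also have "\<dots> = (E <#> H) <#> pos Q" using window pc H by (simp add: set_mult_assoc)
      finally show ?thesis .
    qed
    have ac: "a \<in> carrier G" "b \<in> carrier G" using a b F by auto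
    have abc: "a \<otimes> b \<in> carrier G" using ac by simp
    have "\<exists>h\<in>E. h \<otimes> (a \<otimes> b) \<in> supp ((f ^^ m) y)"
    proof (rule ccontr)
      assume no: "\<not> ?thesis"
      have "supp ((f ^^ m) (u)) \<inter> {a \<otimes> b} = {}"
      proof (rule near_small_supp)
        fix k assume "k \<in> E <#> {a \<otimes> b}"
        then obtain h where h: "h \<in> E" "k = h \<otimes> (a \<otimes> b)" by (auto elim!: set_multE)
        have kc: "k \<in> carrier G" using h abc by simp
        have "k \<in> A" using A_I[OF h(1) a b j] h by simp
        then have "dist (\<phi> k ((f ^^ m) y)) (\<phi> k ((f ^^ m) (u))) < \<eta>"
          using real[of m] kc unfolding realizes_def by (auto simp: v_def dest!: bspec[of _ _ k])
        moreover have "dist (\<phi> k ((f ^^ m) y)) z < \<delta>" using not_supp[OF kc] no h by blast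
        ultimately show "dist (\<phi> k ((f ^^ m) (u))) z \<le> 4 * \<eta>"
          using dist_triangle3[of "\<phi> k ((f ^^ m) (u))" z "\<phi> k ((f ^^ m) y)"] threshold by linarith
      qed (use uX abc in auto)
      then show False using s by blast
    qed
    then obtain h where h: "h \<in> E" "h \<otimes> (a \<otimes> b) \<in> supp ((f ^^ m) y)" by blast
    define j where "j = deg b"
    \<comment> \<open>The visit is moved to degree 0, where the finite set to be avoided has been fixed in advance.\<close>
    define y' where "y' = \<phi> (tpow j) y"
    have y'X: "y' \<in> X" using y by (simp add: y'_def)
    have y'_per: "periodic L y'"
      unfolding periodic_def
    proof
      fix l assume l: "l \<in> L"
      have l2: "tpow (- j) \<otimes> l \<otimes> inv (tpow (- j)) \<in> L" using L(3)[of "tpow (- j)" l] l by simp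
      have "l \<otimes> tpow j = tpow j \<otimes> (tpow (- j) \<otimes> l \<otimes> inv (tpow (- j)))"
        using l by (simp add: tpow_neg m_assoc[symmetric] tpow_add[symmetric])
      then have "\<phi> l y' = \<phi> (tpow j) (\<phi> (tpow (- j) \<otimes> l \<otimes> inv (tpow (- j))) y)"
        unfolding y'_def using l y l2 by (metis act_mult tpow_carrier L_in_carrier)
      then show "\<phi> l y' = y'" using y_per l2 unfolding periodic_def y'_def by simp
    qed
    have y'_dying: "dying y'"
      unfolding y'_def using y_dying by (rule dying_act) simp
    have shift_y': "k \<in> supp ((f ^^ i) y') \<longleftrightarrow> k \<otimes> tpow j \<in> supp ((f ^^ i) y)" if "k \<in> carrier G" for k i
      unfolding y'_def using that y by (simp add: fn_act supp_act)
    have y'_thin: "thin L y'"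
      unfolding thin_def
    proof (intro exI conjI)
      let ?Z = "(E <#> Y) <#> {tpow (- j)}"
      show "finite ?Z" "?Z \<subseteq> carrier G"
        using finite_set_mult[OF EY(1), of "{tpow (- j)}"] set_mult_closed[OF EY(2), of "{tpow (- j)}"] by simp_all
      show "supp y' \<subseteq> ?Z <#> L"
      proof
        fix k assume k: "k \<in> supp y'"
        then have kc: "k \<in> carrier G" using supp_carrier by auto
        then have "k \<otimes> tpow j \<in> supp y" using shift_y'[of k 0] k by simp
        then have "k \<otimes> tpow j \<in> (E <#> Y) <#> L" using supp_y[of 0] by auto
        then obtain c l where cl: "c \<in> E <#> Y" "l \<in> L" "k \<otimes> tpow j = c \<otimes> l"
          by (rule set_multE)
        have cc: "c \<in> carrier G" using cl EY by auto
        have "k = c \<otimes> l \<otimes> tpow (- j)" using cl kc cc by (metis tpow_neg inv_solve_right m_closed tpow_carrier L_in_carrier)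
        also have "\<dots> = c \<otimes> tpow (- j) \<otimes> (tpow j \<otimes> l \<otimes> inv (tpow j))"
        proof -
          have "tpow (- j) \<otimes> (tpow j \<otimes> l \<otimes> inv (tpow j)) = l \<otimes> tpow (- j)"
            using cl by (simp add: tpow_neg m_assoc[symmetric] tpow_add[symmetric])
          then show ?thesis using cl cc by (simp add: m_assoc)
        qed
        finally show "k \<in> ?Z <#> L"
          using cl L(3)[of "tpow j" l] by (auto intro!: set_multI)
      qed
    qed
    have "W1 \<inter> supp ((f ^^ m) y') \<noteq> {}"
    proof -
      let ?k = "(h \<otimes> a) \<otimes> (b \<otimes> tpow (- j))"
      have kc: "?k \<in> carrier G" using h ac by simp
      have "?k \<otimes> tpow j = h \<otimes> (a \<otimes> b)"
        using h ac by (simp add: m_assoc tpow_add[symmetric])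
      then have k: "?k \<in> supp ((f ^^ m) y')" using shift_y'[OF kc] h by simp
      have "?k \<in> layer (E <#> F) {0}"
        using h a b by (intro layerI set_multI) (auto simp: deg_mult j_def)
      then have "?k \<in> W1 <#> L" using W1(3) by blast
      then obtain x l where xl: "x \<in> W1" "l \<in> L" "?k = x \<otimes> l" by (rule set_multE)
      have "periodic L ((f ^^ m) y')" by (rule periodic_fn[OF y'_per L_carrier y'X])
      then have "x \<in> supp ((f ^^ m) y')"
        using periodic_supp[OF _ L(1), of "(f ^^ m) y'" x l] k xl W1 y'X by auto
      then show ?thesis using xl by blast
    qed
    then have "supp y' \<inter> (F' <#> L) \<noteq> {}" using avoid[OF y'_dying y'_thin, of m] by blast
    then obtain c l where cl: "c \<in> F'" "l \<in> L" "c \<otimes> l \<in> supp y'" by (auto elim!: set_multE)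
    have cc: "c \<in> carrier G" using cl F' by auto
    have "c \<otimes> l \<otimes> tpow j \<in> (E <#> H) <#> pos Q"
      using shift_y'[of "c \<otimes> l" 0] cl cc supp_y0 by auto
    then obtain d p where dp: "d \<in> E <#> H" "p \<in> pos Q" "c \<otimes> l \<otimes> tpow j = d \<otimes> p" by (rule set_multE)
    have pB: "p \<in> B" using dp pos_B by auto
    have "d \<otimes> p = c \<otimes> (l \<otimes> tpow j)" using dp cl cc by (simp add: m_assoc)
    then have "\<bar>deg p - deg (l \<otimes> tpow j)\<bar> \<le> R0" using R0(2) dp(1) cl pB by (meson B_closed L_in_B tpow_B)
    moreover have "deg (l \<otimes> tpow j) = j" using cl by (simp add: deg_mult)
    moreover have "deg p \<in> Q" using dp pos_deg by blast
    ultimately show ?thesis unfolding j_def by (intro bexI[of _ "deg p"]) (auto simp: abs_minus_commute)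
  qed
  then show ?thesis using R0(1) by (intro exI[of _ R0]) auto
qed

text \<open>
  The pattern \<open>Q0\<close> from \<open>quiet_walls\<close> is placed twice, at the degrees 0 and \<open>M\<close>. What the two copies
  emit towards each other is trapped close to them by \<open>trapped_between_walls\<close>. For \<open>M\<close> tending to
  infinity, one copy alone emits nothing that leaves a bounded set of degrees, upwards in the limit of the
  lower copy and downwards in the limit of the upper copy. Being confined to finitely many cosets of
  \<open>L\<close>, the row \<open>Q0\<close> dies.
\<close>

lemma dying_row: "\<exists>Q. gapped Q \<and> 0 \<in> Q \<and> dying (row Q)"
proof -
  obtain F where F: "finite F" "F \<subseteq> carrier G"
    and spread: "\<And>P n. P \<subseteq> B \<Longrightarrow> sparse P \<Longrightarrow> supp ((f ^^ n) (overlay P)) \<subseteq> F <#> B"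
    using confined_B unfolding confined_def by blast
  have rep: "\<exists>a\<in>F. \<exists>b\<in>B. g = a \<otimes> b" if "gapped Q" "g \<in> supp ((f ^^ n) (row Q))" for Q n g
    using subsetD[OF spread[OF pos_B sparse_pos[OF that(1)]]] that(2)
    unfolding row_def by (meson set_multE)
  obtain w where thick: "thick F w" using thick_exists[OF F] by blast
  then have w: "w \<ge> 0" by (simp add: thick_def)
  obtain Q0 J N0 where Q0: "gapped Q0" "0 \<in> Q0" and J0: "0 \<le> J" and Q0J: "Q0 \<subseteq> {-J..J}"
    and quiet: "\<And>Q n. gapped Q \<Longrightarrow> Q \<inter> {-J..J} = Q0 \<Longrightarrow> N0 \<le> n \<Longrightarrow>
      supp ((f ^^ n) (row Q)) \<inter> layer F {-w..w} = {}"
    using quiet_walls[OF F, of w] by blast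
  have J: "\<bar>q\<bar> \<le> J" if "q \<in> Q0" for q using that Q0J by (auto simp: abs_le_iff)
  \<comment> \<open>The configuration with two walls, and its translate in which the upper wall has degree 0.\<close>
  define Qp where "Qp M = Q0 \<union> (+) M ` Q0" for M :: int
  define Qm where "Qm M = (\<lambda>q. q - M) ` Qp M" for M :: int
  have Qm_eq: "Qm M = (\<lambda>q. q - M) ` Q0 \<union> Q0" for M
    by (simp add: Qm_def Qp_def image_Un image_image)
  define M0 where "M0 = 2 * J + gap + 2 * w + 1"
  have gapQ0: "\<And>i j. i \<in> Q0 \<Longrightarrow> j \<in> Q0 \<Longrightarrow> i \<noteq> j \<Longrightarrow> gap < \<bar>i - j\<bar>" and finQ0: "finite Q0"
    using Q0(1) by (auto simp: gapped_def)
  have gp: "gapped (Qp M)" "gapped (Qm M)" if M: "M > M0" for M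
  proof -
    have far: "gap < \<bar>i - (M + j)\<bar>" if "i \<in> Q0" "j \<in> Q0" for i j
      using J[OF that(1)] J[OF that(2)] M w J0 unfolding M0_def by linarith
    show 1: "gapped (Qp M)"
      unfolding gapped_def
    proof (intro conjI ballI impI)
      fix i j assume ij: "i \<in> Qp M" "j \<in> Qp M" "i \<noteq> j"
      then consider "i \<in> Q0" "j \<in> Q0" | i' where "i = M + i'" "i' \<in> Q0" "j \<in> Q0"
        | j' where "j = M + j'" "i \<in> Q0" "j' \<in> Q0" | i' j' where "i = M + i'" "j = M + j'" "i' \<in> Q0" "j' \<in> Q0"
        unfolding Qp_def by blast
      then show "gap < \<bar>i - j\<bar>"
      proof cases
        case 1 then show ?thesis using gapQ0 ij by blast
      next
        case 2 then show ?thesis using far[of j i'] by linarith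
      next
        case 3 then show ?thesis using far[of i j'] by linarith
      next
        case 4 then show ?thesis using gapQ0[of i' j'] ij by auto
      qed
    qed (use finQ0 in \<open>simp add: Qp_def\<close>)
    show "gapped (Qm M)"
      using 1 unfolding gapped_def Qm_def by auto
  qed
  have wp: "Qp M \<inter> {-J..J} = Q0" "Qm M \<inter> {-J..J} = Q0" if M: "M > M0" for M
  proof -
    have "M + q \<notin> {-J..J}" "q - M \<notin> {-J..J}" if "q \<in> Q0" for q
      using J[OF that] M w gap J0 unfolding M0_def by auto
    then show "Qp M \<inter> {-J..J} = Q0" "Qm M \<inter> {-J..J} = Q0"
      unfolding Qm_eq Qp_def using Q0J by blast+
  qed
  have shift: "g \<in> supp ((f ^^ n) (row (Qm M))) \<longleftrightarrow> g \<otimes> tpow M \<in> supp ((f ^^ n) (row (Qp M)))"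
    if M: "M > M0" and g: "g \<in> carrier G" for g n M
  proof -
    have "row (Qm M) = \<phi> (tpow M) (row (Qp M))"
      using row_shift[OF gp(1)[OF M], of M] by (simp add: Qm_def)
    then show ?thesis using g gp(1)[OF M] by (simp add: fn_act supp_act)
  qed
  define u where "u M = (f ^^ N0) (row (Qp M))" for M
  have uX: "u M \<in> X" if "M > M0" for M using gp(1)[OF that] by (simp add: u_def)
  have fu: "(f ^^ m) (u M) = (f ^^ (m + N0)) (row (Qp M))" for m M
    by (simp add: u_def funpow_add)
  have u_rep: "\<exists>a\<in>F. \<exists>b\<in>B. g = a \<otimes> b" if "M > M0" "g \<in> supp ((f ^^ m) (u M))" for M m g
    using rep[OF gp(1)[OF that(1)]] that(2) unfolding fu by blast
  have u_band: "w < \<bar>deg b\<bar> \<and> w < \<bar>deg b - M\<bar>"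
    if M: "M > M0" and s: "a \<otimes> b \<in> supp ((f ^^ m) (u M))" and a: "a \<in> F" and b: "b \<in> B" for M m a b
  proof -
    have ac: "a \<in> carrier G" using a F by auto
    have "a \<otimes> b \<notin> layer F {-w..w}"
      using quiet[OF gp(1)[OF M] wp(1)[OF M], of "m + N0"] s unfolding fu by auto
    then have "\<not> (- w \<le> deg b \<and> deg b \<le> w)" using layerI[OF a b, of "{-w..w}"] by auto
    then have 1: "w < \<bar>deg b\<bar>" by arith
    have "a \<otimes> b \<otimes> tpow (- M) \<otimes> tpow M = a \<otimes> b"
      using ac b by (simp add: m_assoc tpow_add[symmetric])
    then have "a \<otimes> b \<otimes> tpow (- M) \<in> supp ((f ^^ (m + N0)) (row (Qm M)))"
      using shift[OF M, of "a \<otimes> b \<otimes> tpow (- M)"] ac b s unfolding fu by simp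
    then have "a \<otimes> (b \<otimes> tpow (- M)) \<notin> layer F {-w..w}"
      using quiet[OF gp(2)[OF M] wp(2)[OF M], of "m + N0"] ac b by (auto simp: m_assoc)
    then have "deg (b \<otimes> tpow (- M)) \<notin> {-w..w}" using layerI[OF a, of "b \<otimes> tpow (- M)"] b by auto
    then have "\<not> (- w \<le> deg b - M \<and> deg b - M \<le> w)" using b by (simp add: deg_mult)
    then have "w < \<bar>deg b - M\<bar>" by arith
    with 1 show ?thesis by blast
  qed
  have ED: "E <#> D \<subseteq> carrier G" "finite (E <#> D)"
    using E_closed[OF D_carrier] E_finite[OF D_finite] by auto
  obtain R0 where R0: "R0 \<ge> 0" and far: "\<And>M u Q m a b. 2 * w < M \<Longrightarrow> walled F w M u \<Longrightarrow>
      supp u \<subseteq> halo N0 (E <#> D) <#> pos Q \<Longrightarrow> a \<in> F \<Longrightarrow> b \<in> B \<Longrightarrow> a \<otimes> b \<in> supp ((f ^^ m) u) \<Longrightarrow>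
      0 < deg b \<Longrightarrow> deg b < M \<Longrightarrow> \<exists>q\<in>Q. \<bar>deg b - q\<bar> \<le> R0"
    using trapped_between_walls[OF F halo_finite[OF ED(2), of N0] halo_carrier[OF ED(1), of N0] thick]
    by metis
  have trapped: "\<exists>q\<in>Qp M. \<bar>deg b - q\<bar> \<le> R0"
    if M: "M > M0" and s: "a \<otimes> b \<in> supp ((f ^^ m) (u M))" and a: "a \<in> F" and b: "b \<in> B"
      and j: "0 < deg b" "deg b < M" for M m a b
  proof -
    have pc: "pos (Qp M) \<subseteq> carrier G" using pos_B[of "Qp M"] by (auto dest!: subsetD)
    have "supp (u M) \<subseteq> halo N0 (supp (row (Qp M)))"
      unfolding u_def using gp(1)[OF M] by (intro supp_fn) simp
    also have "\<dots> \<subseteq> halo N0 ((E <#> D) <#> pos (Qp M))"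
      unfolding row_def by (intro halo_mono overlay_supp sparse_pos gp M)
    finally have su: "supp (u M) \<subseteq> halo N0 (E <#> D) <#> pos (Qp M)"
      using halo_mult[OF ED(1) pc] by simp
    have per: "periodic L (u M)"
      unfolding u_def using gp(1)[OF M] by (intro periodic_fn row_periodic L_carrier) auto
    have M': "2 * w < M" using M J0 gap w unfolding M0_def by linarith
    have "walled F w M (u M)"
      unfolding walled_def using uX[OF M] per u_rep[OF M] u_band[OF M] by blast
    from far[OF M' this su a b s j] show ?thesis .
  qed
  define R1 where "R1 = R0 + J + w"
  have bounded: "\<bar>deg b\<bar> \<le> R1"
    if n: "n \<ge> N0" and s: "a \<otimes> b \<in> supp ((f ^^ n) (row Q0))" and a: "a \<in> F" and b: "b \<in> B" for n a b
  proof (rule ccontr)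
    assume big: "\<not> \<bar>deg b\<bar> \<le> R1"
    have ac: "a \<in> carrier G" "b \<in> carrier G" using a b F by auto
    have sc: "{a \<otimes> b} \<subseteq> carrier G" using ac by simp
    define A where "A = halo (Suc n) (E <#> {a \<otimes> b})"
    have A: "finite A" "A \<subseteq> carrier G"
      unfolding A_def
      using halo_finite[OF E_finite, of "{a \<otimes> b}"] halo_carrier[OF E_closed[OF sc]]
      by simp_all
    obtain r where r: "r \<ge> 0" "\<forall>d\<in>D. \<forall>b\<in>B. d \<otimes> b \<in> A \<longrightarrow> \<bar>deg b\<bar> \<le> r"
      using finite_window[OF A] by blast
    define M where "M = M0 + r + \<bar>deg b\<bar> + R1 + J + 1"
    have R1: "R1 \<ge> 0" "M0 \<ge> 0" using R0 J0 w gap by (auto simp: R1_def M0_def)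
    have M: "M > M0" using r R1 J0 unfolding M_def by linarith
    have hit: "\<exists>a'\<in>F. \<exists>b'\<in>B. a' \<otimes> b' \<in> supp ((f ^^ n) (row Q)) \<and> \<bar>deg b' - deg b\<bar> \<le> w"
      if Q: "gapped Q" "Q \<inter> {-r..r} = Q0 \<inter> {-r..r}" for Q
    proof -
      have "near A (row Q0) (row Q)"
        using r Q A by (intro row_near[OF Q0(1), where r = r]) auto
      then have "supp ((f ^^ n) (row Q)) \<inter> (E <#> {a \<otimes> b}) \<noteq> {}"
        using supp_transfer[OF _ _ sc, of "row Q0" "row Q" n] Q0 Q s unfolding A_def by auto
      then obtain h where h: "h \<in> E" "h \<otimes> (a \<otimes> b) \<in> supp ((f ^^ n) (row Q))" by (auto elim!: set_multE)
      then obtain a' b' where ab': "a' \<in> F" "b' \<in> B" "h \<otimes> (a \<otimes> b) = a' \<otimes> b'" using rep[OF Q(1)] by blast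
      then have "\<bar>deg b' - deg b\<bar> \<le> w" using thick_step[OF thick F(2), of a' h a b' b] h a b by simp
      then show ?thesis using ab' h by auto
    qed
    show False
    proof (cases "deg b > 0")
      case True
      have "M + q \<notin> {-r..r}" if "q \<in> Q0" for q
        using J[OF that] J0 R1 unfolding M_def by (auto simp: abs_le_iff)
      then have "Qp M \<inter> {-r..r} = Q0 \<inter> {-r..r}" unfolding Qp_def by auto
      from hit[OF gp(1)[OF M] this] obtain a' b' where ab': "a' \<in> F" "b' \<in> B"
        "a' \<otimes> b' \<in> supp ((f ^^ n) (row (Qp M)))" "\<bar>deg b' - deg b\<bar> \<le> w" by blast
      have e: "(f ^^ (n - N0)) (u M) = (f ^^ n) (row (Qp M))" unfolding fu using n by simp
      have "0 < deg b'" "deg b' < M"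
        using ab'(4) True big R0 J0 w R1 r unfolding R1_def M_def by linarith+
      then obtain q where q: "q \<in> Qp M" "\<bar>deg b' - q\<bar> \<le> R0"
        using trapped[OF M, of a' b' "n - N0"] ab' unfolding e by blast
      show False
      proof (cases "q \<in> Q0")
        case True
        then show False using J[OF True] q(2) ab'(4) big \<open>deg b > 0\<close> unfolding R1_def by linarith
      next
        case False
        then obtain q' where q': "q' \<in> Q0" "q = M + q'" using q(1) unfolding Qp_def by blast
        then show False using J[OF q'(1)] q(2) ab'(4) R1 r unfolding M_def R1_def by linarith
      qed
    next
      case False
      have "q - M \<notin> {-r..r}" if "q \<in> Q0" for q
        using J[OF that] J0 R1 unfolding M_def by (auto simp: abs_le_iff)
      then have "Qm M \<inter> {-r..r} = Q0 \<inter> {-r..r}" unfolding Qm_eq by auto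
      from hit[OF gp(2)[OF M] this] obtain a' b' where ab': "a' \<in> F" "b' \<in> B"
        "a' \<otimes> b' \<in> supp ((f ^^ n) (row (Qm M)))" "\<bar>deg b' - deg b\<bar> \<le> w" by blast
      have e: "(f ^^ (n - N0)) (u M) = (f ^^ n) (row (Qp M))" unfolding fu using n by simp
      have a'c: "a' \<in> carrier G" using ab' F by auto
      have "a' \<otimes> (b' \<otimes> tpow M) \<in> supp ((f ^^ n) (row (Qp M)))"
        using shift[OF M, of "a' \<otimes> b'" n] ab' a'c by (simp add: m_assoc)
      moreover have d: "deg (b' \<otimes> tpow M) = deg b' + M" using ab' by (simp add: deg_mult)
      moreover have "0 < deg b' + M" "deg b' + M < M"
        using ab'(4) False big R0 J0 w R1 r unfolding R1_def M_def by linarith+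
      ultimately obtain q where q: "q \<in> Qp M" "\<bar>deg b' + M - q\<bar> \<le> R0"
        using trapped[OF M, of a' "b' \<otimes> tpow M" "n - N0"] ab' unfolding e by auto
      show False
      proof (cases "q \<in> Q0")
        case True
        then show False using J[OF True] q(2) ab'(4) R1 r unfolding M_def R1_def by linarith
      next
        case False
        then obtain q' where q': "q' \<in> Q0" "q = M + q'" using q(1) unfolding Qp_def by blast
        then show False using J[OF q'(1)] q(2) ab'(4) big \<open>\<not> deg b > 0\<close> unfolding R1_def by linarith
      qed
    qed
  qed
  obtain Y where Y: "finite Y" "Y \<subseteq> carrier G" "layer F {-R1..R1} \<subseteq> Y <#> L"
    using layer_finite[OF F, of "{-R1..R1}"] by auto
  have "supp ((f ^^ n) (row Q0)) \<subseteq> Y <#> L" if n: "n \<ge> N0" for n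
  proof
    fix g assume g: "g \<in> supp ((f ^^ n) (row Q0))"
    then obtain a b where ab: "a \<in> F" "b \<in> B" "g = a \<otimes> b" using rep[OF Q0(1)] by blast
    then have "\<bar>deg b\<bar> \<le> R1" using bounded[OF n, of a b] g by blast
    then have "g \<in> layer F {-R1..R1}" using ab by (auto intro!: layerI simp: abs_le_iff)
    then show "g \<in> Y <#> L" using Y by blast
  qed
  then have "dying (row Q0)"
    using Q0 by (intro periodic_dying[OF _ _ L(1) Y(1,2)] row_periodic) auto
  then show ?thesis using Q0 by blast
qed

end

context cyclic_extension
begin

lemma N_mult [simp]: "a \<in> N \<Longrightarrow> b \<in> N \<Longrightarrow> a \<otimes> b \<in> N" and N_inv [simp]: "a \<in> N \<Longrightarrow> inv a \<in> N"
  and N_one [simp]: "\<one> \<in> N"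
  using N_sub by (auto intro: subgroup.m_closed subgroup.m_inv_closed subgroup.one_closed)

lemma N_carrier: "N \<subseteq> carrier G" using N_sub by (rule subgroup.subset)

text \<open>
  The extension is a dying row with pattern \<open>P0\<close>. The subgroup \<open>L\<close> is chosen so sparse that the copies
  of \<open>P0\<close> along \<open>L\<close> meet neither each other nor \<open>A\<close>, and the gaps of degrees exceed \<open>r\<close>.
\<close>

lemma dying_extension:
  assumes P0: "P0 \<subseteq> N" "finite P0" "sparse P0" and A: "finite A" "A \<subseteq> carrier G"
  shows "\<exists>P. P0 \<subseteq> P \<and> P \<subseteq> B \<and> sparse P \<and> dying (overlay P) \<and> thin N (overlay P) \<and>
     (\<forall>p\<in>P. p \<in> P0 \<or> p \<in> N \<and> p \<notin> A \<or> r < \<bar>deg p\<bar>)"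
proof -
  have P0c: "P0 \<subseteq> carrier G" using P0(1) N_carrier by auto
  define T1 where "T1 = (\<lambda>(q, d, c, p). inv q \<otimes> (inv d \<otimes> (c \<otimes> p))) ` (P0 \<times> D \<times> D \<times> P0)"
  define T2 where "T2 = (\<lambda>(p, a). inv p \<otimes> a) ` (P0 \<times> A)"
  have "finite ((T1 \<union> T2) - {\<one>})" unfolding T1_def T2_def using P0(2) A(1) D_finite by simp
  then obtain L C where L: "subgroup L G" "L \<subseteq> N" "L \<inter> ((T1 \<union> T2) - {\<one>}) = {}"
    "\<forall>b\<in>B. \<forall>l\<in>L. b \<otimes> l \<otimes> inv b \<in> L" and C: "finite C" "C \<subseteq> N" "N \<subseteq> C <#> L"
    using small_subgroups[of "(T1 \<union> T2) - {\<one>}"] by auto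
  have Lc: "L \<subseteq> carrier G" using L(1) by (rule subgroup.subset)
  obtain r0 where r0: "r0 \<ge> 0" "\<forall>c\<in>D. \<forall>d\<in>D. \<forall>b\<in>B. \<forall>b'\<in>B. c \<otimes> b = d \<otimes> b' \<longrightarrow> \<bar>deg b - deg b'\<bar> \<le> r0"
    using degree_bound[OF D_finite D_finite D_carrier D_carrier] by blast
  have sp: "sparse (P0 <#> L)"
    unfolding sparse_def
  proof (intro conjI ballI impI)
    show "P0 <#> L \<subseteq> carrier G" by (rule set_mult_closed[OF P0c Lc])
    fix x y c d assume a: "x \<in> P0 <#> L" "y \<in> P0 <#> L" "c \<in> D" "d \<in> D" "c \<otimes> x = d \<otimes> y"
    obtain p l where x: "p \<in> P0" "l \<in> L" "x = p \<otimes> l" using a(1) by (rule set_multE)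
    obtain q k where y: "q \<in> P0" "k \<in> L" "y = q \<otimes> k" using a(2) by (rule set_multE)
    have cc: "p \<in> carrier G" "q \<in> carrier G" "l \<in> carrier G" "k \<in> carrier G" using x y P0c Lc by auto
    define m where "m = inv q \<otimes> (inv d \<otimes> (c \<otimes> p))"
    have "m \<otimes> l = inv q \<otimes> (inv d \<otimes> (c \<otimes> x))" using cc a(3,4) x by (simp add: m_def m_assoc)
    also have "\<dots> = k" using cc a(3,4) y by (simp add: a(5) m_assoc[symmetric])
    finally have ml: "m \<otimes> l = k" .
    have mc: "m \<in> carrier G" using cc a by (simp add: m_def)
    have "m = k \<otimes> inv l" using ml mc cc by (metis inv_solve_right)
    then have "m \<in> L" using x y L(1) by (simp add: subgroup.m_closed subgroup.m_inv_closed)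
    moreover have "m \<in> T1" unfolding T1_def m_def using x y a by force
    ultimately have m1: "m = \<one>" using L(3) by blast
    then have lk: "l = k" using ml cc by simp
    have "c \<otimes> p = d \<otimes> q" using m1 cc a(3,4) unfolding m_def
      by (metis D_in inv_closed inv_inv inv_equality inv_solve_left m_closed r_one)
    then have "p = q" using P0(3) x y a unfolding sparse_def by blast
    then show "x = y" using x y lk by simp
  qed
  interpret W: wall_setting G X \<phi> z f \<eta> \<delta> E x0 N B t deg P0 L C "max r0 r"
  proof
    show "\<bar>deg b - deg b'\<bar> \<le> max r0 r"
      if "c \<in> D" "d \<in> D" "b \<in> B" "b' \<in> B" "c \<otimes> b = d \<otimes> b'" for c d b b'
      using r0(2) that by fastforce
    show "0 \<le> max r0 r" using r0(1) by simp
  qed (use P0 L C sp subgroup.m_closed[OF L(1)] subgroup.one_closed[OF L(1)]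
        subgroup.m_inv_closed[OF L(1)] in auto)
  obtain Q where Q: "W.gapped Q" "0 \<in> Q" "dying (W.row Q)" using W.dying_row by blast
  show ?thesis
  proof (intro exI conjI)
    show "P0 \<subseteq> W.pos Q"
    proof
      fix p assume p: "p \<in> P0"
      then have "p = p \<otimes> \<one> \<otimes> tpow 0" using P0c by auto
      then show "p \<in> W.pos Q" unfolding W.pos_mem using p Q(2) W.L_one by blast
    qed
    show "W.pos Q \<subseteq> B" by (rule W.pos_B)
    show sparse: "sparse (W.pos Q)" by (rule W.sparse_pos[OF Q(1)])
    show "dying (overlay (W.pos Q))" using Q(3) by (simp add: W.row_def)
    show "thin N (overlay (W.pos Q))"
      unfolding thin_def
    proof (intro exI conjI)
      let ?F = "(E <#> D) <#> (tpow ` Q)"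
      have ED: "E <#> D \<subseteq> carrier G" by (rule E_closed[OF D_carrier])
      have tQ: "tpow ` Q \<subseteq> carrier G" by auto
      show "finite ?F" using Q(1) window(1) D_finite by (auto intro!: finite_set_mult simp: W.gapped_def)
      show "?F \<subseteq> carrier G" by (rule set_mult_closed[OF ED tQ])
      have "W.pos Q \<subseteq> (tpow ` Q) <#> N"
      proof
        fix b assume b: "b \<in> W.pos Q"
        then have bB: "b \<in> B" and q: "deg b \<in> Q" using W.pos_B W.pos_deg by auto
        have "deg (inv (tpow (deg b)) \<otimes> b) = 0" using bB by (simp add: deg_mult deg_inv)
        then have "inv (tpow (deg b)) \<otimes> b \<in> N" using deg_0 bB by simp
        moreover have "b = tpow (deg b) \<otimes> (inv (tpow (deg b)) \<otimes> b)" using bB by (simp add: m_assoc[symmetric])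
        ultimately show "b \<in> (tpow ` Q) <#> N" using q by (metis image_eqI set_multI)
      qed
      then have "(E <#> D) <#> W.pos Q \<subseteq> (E <#> D) <#> ((tpow ` Q) <#> N)" by (intro mono_set_mult) auto
      also have "\<dots> = ?F <#> N" using ED tQ N_carrier by (simp add: set_mult_assoc)
      finally show "supp (overlay (W.pos Q)) \<subseteq> ?F <#> N" using overlay_supp[OF sparse] by blast
    qed
    show "\<forall>p\<in>W.pos Q. p \<in> P0 \<or> p \<in> N \<and> p \<notin> A \<or> r < \<bar>deg p\<bar>"
    proof
      fix b assume b: "b \<in> W.pos Q"
      then obtain p l q where plq: "p \<in> P0" "l \<in> L" "q \<in> Q" "b = p \<otimes> l \<otimes> tpow q" unfolding W.pos_mem by blast
      have pc: "p \<in> carrier G" "l \<in> carrier G" using plq P0c Lc by auto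
      show "b \<in> P0 \<or> b \<in> N \<and> b \<notin> A \<or> r < \<bar>deg b\<bar>"
      proof (cases "q = 0")
        case True
        then have bpl: "b = p \<otimes> l" using plq pc by simp
        have pN: "p \<in> N" "l \<in> N" using plq P0 L by auto
        then have bN: "b \<in> N" using bpl by simp
        show ?thesis
        proof (cases "b \<in> A")
          case True
          then have "inv p \<otimes> b \<in> T2" unfolding T2_def using plq by force
          moreover have e: "inv p \<otimes> b = l" using bpl pc by (simp add: m_assoc[symmetric])
          ultimately have "l = \<one>" using L(3) plq by auto
          then show ?thesis using bpl plq pc by simp
        qed (use bN in simp)
      next
        case False
        have "deg b = q" using plq by (simp add: deg_mult)
        moreover have "max r0 r < \<bar>q - 0\<bar>"
          using Q(1,2) plq False unfolding W.gapped_def by blast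
        ultimately show ?thesis by simp
      qed
    qed
  qed
qed

text \<open>
  Suppose that the superposition with positions \<open>P \<subseteq> N\<close> visits \<open>a \<otimes> b\<close>. The past of this visit sees
  finitely many positions, so \<open>P\<close> may be replaced by one of its dying extensions. After a translation
  by \<open>b\<close> the visit is at \<open>a\<close>, in a fixed finite set. So \<open>dying_spread_bounded\<close> for the subgroup \<open>N\<close>
  shows that the translated positions in \<open>N \<otimes> inv b\<close> are close to \<open>N\<close>, that is, \<open>b\<close> lies in one of
  finitely many cosets of \<open>N\<close>.
\<close>

lemma confined_N: "confined N"
proof -
  obtain F where F: "finite F" "F \<subseteq> carrier G"
    and spread: "\<And>P n. P \<subseteq> B \<Longrightarrow> sparse P \<Longrightarrow> supp ((f ^^ n) (overlay P)) \<subseteq> F <#> B"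
    using confined_B unfolding confined_def by blast
  have EF: "E <#> F \<subseteq> carrier G" "finite (E <#> F)"
    using E_closed[OF F(2)] E_finite[OF F(1)] by simp_all
  have ED: "E <#> D \<subseteq> carrier G" "finite (E <#> D)"
    using E_closed[OF D_carrier] E_finite[OF D_finite] by simp_all
  obtain F' where F'': "finite F' \<and> F' \<subseteq> carrier G \<and> (\<forall>y. dying y \<longrightarrow> thin N y \<longrightarrow>
      supp y \<inter> (F' <#> N) = {} \<longrightarrow> (\<forall>n. supp ((f ^^ n) y) \<inter> (E <#> F) = {}))"
    using dying_spread_bounded[OF N_carrier N_one EF(2,1)] by (rule exE)
  then have F': "finite F'" "F' \<subseteq> carrier G"
    and avoid: "\<And>y n. dying y \<Longrightarrow> thin N y \<Longrightarrow> supp y \<inter> (F' <#> N) = {} \<Longrightarrow> supp ((f ^^ n) y) \<inter> (E <#> F) = {}"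
    by simp_all
  obtain r1 where r1: "r1 \<ge> 0" "\<forall>c\<in>E <#> D. \<forall>d\<in>F'. \<forall>b\<in>B. \<forall>b'\<in>B. c \<otimes> b = d \<otimes> b' \<longrightarrow> \<bar>deg b - deg b'\<bar> \<le> r1"
    using degree_bound[OF ED(2) F'(1) ED(1) F'(2)] by blast
  define S where "S = (\<lambda>(a, c, d). a \<otimes> inv (inv c \<otimes> d)) ` (F \<times> (E <#> D) \<times> F')"
  have S: "finite S" unfolding S_def using F ED F' by simp
  have "a \<otimes> inv (inv c \<otimes> d) \<in> carrier G" if "a \<in> F" "c \<in> E <#> D" "d \<in> F'" for a c d
    using subsetD[OF F(2) that(1)] subsetD[OF ED(1) that(2)] subsetD[OF F'(2) that(3)] by simp
  then have Sc: "S \<subseteq> carrier G" unfolding S_def by auto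
  have "supp ((f ^^ n) (overlay P)) \<subseteq> S <#> N" if P: "P \<subseteq> N" "sparse P" for P n
  proof
    fix g assume g: "g \<in> supp ((f ^^ n) (overlay P))"
    then have gc: "g \<in> carrier G" using supp_carrier by auto
    have "g \<in> F <#> B" using spread[of P n] P N_B g by blast
    then obtain a b where ab: "a \<in> F" "b \<in> B" "g = a \<otimes> b" by (rule set_multE)
    have ac: "a \<in> carrier G" "b \<in> carrier G" using ab F by auto
    define A0 where "A0 = halo (Suc n) (E <#> {g})"
    have sg: "{g} \<subseteq> carrier G" using gc by simp
    have A0: "finite A0" "A0 \<subseteq> carrier G"
      unfolding A0_def
      using halo_finite[OF E_finite, of "{g}"] halo_carrier[OF E_closed[OF sg]]
      by simp_all
    define A where "A = {p \<in> carrier G. \<exists>d\<in>D. d \<otimes> p \<in> A0}"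
    have "A \<subseteq> (\<lambda>(d, k). inv d \<otimes> k) ` (D \<times> A0)"
    proof
      fix p assume "p \<in> A"
      then obtain d where d: "d \<in> D" "d \<otimes> p \<in> A0" "p \<in> carrier G" unfolding A_def by blast
      then have "p = inv d \<otimes> (d \<otimes> p)" by (simp add: m_assoc[symmetric])
      then show "p \<in> (\<lambda>(d, k). inv d \<otimes> k) ` (D \<times> A0)" using d by force
    qed
    then have "finite A" by (rule finite_subset) (simp add: D_finite A0(1))
    moreover have "A \<subseteq> carrier G" by (auto simp: A_def)
    ultimately have A: "finite A" "A \<subseteq> carrier G" by simp_all
    obtain r0 where r0: "\<forall>d\<in>D. \<forall>k\<in>A0. \<forall>b\<in>B. \<forall>b'\<in>B. d \<otimes> b = k \<otimes> b' \<longrightarrow> \<bar>deg b - deg b'\<bar> \<le> r0"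
      using degree_bound[OF D_finite A0(1) D_carrier A0(2)] by blast
    define P0 where "P0 = P \<inter> A"
    have P0: "P0 \<subseteq> N" "finite P0" "sparse P0"
      unfolding P0_def using P A sparse_subset[OF P(2), of "P \<inter> A"] by auto
    obtain P' where P': "P0 \<subseteq> P'" "P' \<subseteq> B" "sparse P'" "dying (overlay P')" "thin N (overlay P')"
      and far: "\<forall>p\<in>P'. p \<in> P0 \<or> p \<in> N \<and> p \<notin> A \<or> max r0 (\<bar>deg b\<bar> + r1) < \<bar>deg p\<bar>"
      using dying_extension[OF P0 A] by blast
    have "near A0 (overlay P) (overlay P')"
    proof (rule overlay_near[OF P(2) P'(3) A0(2)])
      fix p d assume p: "p \<in> P - P' \<or> p \<in> P' - P" and d: "d \<in> D"
      show "d \<otimes> p \<notin> A0"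
      proof
        assume dp: "d \<otimes> p \<in> A0"
        have pB: "p \<in> B" using p P P' N_B by auto
        have pA: "p \<in> A" unfolding A_def using dp d pB by auto
        have "d \<otimes> p = (d \<otimes> p) \<otimes> \<one>" using d pB by simp
        with r0[THEN bspec, OF d, THEN bspec, OF dp, THEN bspec, OF pB, THEN bspec, OF B_one]
        have "\<bar>deg p\<bar> \<le> r0" by simp
        then show False using p far P' pA unfolding P0_def by fastforce
      qed
    qed
    then have "supp ((f ^^ n) (overlay P')) \<inter> (E <#> {g}) \<noteq> {}"
      using supp_transfer[OF _ _ sg, of "overlay P" "overlay P'" n] P P' g unfolding A0_def by auto
    then obtain h where h: "h \<in> E" "h \<otimes> g \<in> supp ((f ^^ n) (overlay P'))" by (auto elim!: set_multE)
    define y where "y = \<phi> b (overlay P')"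
    have supp_y: "k \<in> supp ((f ^^ i) y) \<longleftrightarrow> k \<otimes> b \<in> supp ((f ^^ i) (overlay P'))" if "k \<in> carrier G" for k i
      unfolding y_def using that ac P' by (simp add: fn_act supp_act)
    have "dying y" unfolding y_def using P'(4) ac(2) by (rule dying_act)
    moreover have "thin N y"
    proof -
      obtain F3 where F3: "finite F3" "F3 \<subseteq> carrier G" "supp (overlay P') \<subseteq> F3 <#> N"
        using P'(5) unfolding thin_def by blast
      have "supp y \<subseteq> (F3 <#> {inv b}) <#> N"
      proof
        fix k assume k: "k \<in> supp y"
        then have kc: "k \<in> carrier G" using supp_carrier by auto
        then have "k \<otimes> b \<in> F3 <#> N" using supp_y[of k 0] k F3(3) by auto
        then obtain c m where cm: "c \<in> F3" "m \<in> N" "k \<otimes> b = c \<otimes> m" by (rule set_multE)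
        have cc: "c \<in> carrier G" "m \<in> carrier G" using cm F3 N_carrier by auto
        have "k = c \<otimes> m \<otimes> inv b" using cm kc cc ac by (metis inv_solve_right m_closed)
        moreover have "inv b \<otimes> (b \<otimes> m \<otimes> inv b) = m \<otimes> inv b" using cc ac by (simp add: m_assoc[symmetric])
        ultimately have "k = (c \<otimes> inv b) \<otimes> (b \<otimes> m \<otimes> inv b)" using cc ac by (simp add: m_assoc)
        moreover have "b \<otimes> m \<otimes> inv b \<in> N"
          using deg_0[of "b \<otimes> m \<otimes> inv b"] deg_0[of m] cm ab by (simp add: deg_mult deg_inv)
        ultimately show "k \<in> (F3 <#> {inv b}) <#> N" using cm by (auto intro!: set_multI)
      qed
      moreover have "finite (F3 <#> {inv b})" "F3 <#> {inv b} \<subseteq> carrier G"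
        using finite_set_mult[OF F3(1)] set_mult_closed[OF F3(2)] ac by simp_all
      ultimately show ?thesis unfolding thin_def by blast
    qed
    moreover have "h \<otimes> a \<in> supp ((f ^^ n) y) \<inter> (E <#> F)"
      using supp_y[of "h \<otimes> a" n] h ab ac by (auto intro: set_multI simp: m_assoc)
    ultimately have "supp y \<inter> (F' <#> N) \<noteq> {}" using avoid[of y n] by blast
    then obtain d m where dm: "d \<in> F'" "m \<in> N" "d \<otimes> m \<in> supp y" by (auto elim!: set_multE)
    have dc: "d \<in> carrier G" "m \<in> carrier G" using dm F' N_carrier by auto
    have "d \<otimes> m \<otimes> b \<in> (E <#> D) <#> P'"
      using supp_y[of "d \<otimes> m" 0] dm dc overlay_supp[OF P'(3)] by auto
    then obtain c p where cp: "c \<in> E <#> D" "p \<in> P'" "d \<otimes> m \<otimes> b = c \<otimes> p" by (rule set_multE)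
    have cc: "c \<in> carrier G" using cp ED by auto
    have pB: "p \<in> B" using cp P' by auto
    have mB: "m \<otimes> b \<in> B" using dm ab by simp
    have e: "d \<otimes> (m \<otimes> b) = c \<otimes> p" using cp dc ac by (simp add: m_assoc)
    have dmb: "deg (m \<otimes> b) = deg b" using dm ab deg_0[of m] by (simp add: deg_mult)
    have "\<bar>deg p - deg (m \<otimes> b)\<bar> \<le> r1" using r1(2) cp(1) dm(1) pB mB e[symmetric] by blast
    then have "\<not> max r0 (\<bar>deg b\<bar> + r1) < \<bar>deg p\<bar>" unfolding dmb by linarith
    then have "p \<in> N" using far cp(2) P0(1) by blast
    then have p0: "deg p = 0" using deg_0 pB by blast
    define s where "s = inv c \<otimes> d"
    have s: "s \<in> B" "deg s = deg p - deg (m \<otimes> b)"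
      unfolding s_def using degree_shift[OF dc(1) cc mB pB e] by auto
    have "deg (s \<otimes> b) = 0" using s dmb p0 ab by (simp add: deg_mult)
    then have "s \<otimes> b \<in> N" using deg_0 s ab by simp
    moreover have "a \<otimes> inv s \<in> S" unfolding S_def s_def using ab cp dm by force
    moreover have "g = (a \<otimes> inv s) \<otimes> (s \<otimes> b)"
    proof -
      have "inv s \<otimes> (s \<otimes> b) = b" using s ac by (simp add: m_assoc[symmetric])
      then show ?thesis using s ac ab by (simp add: m_assoc)
    qed
    ultimately show "g \<in> S <#> N" by (auto intro: set_multI)
  qed
  then show ?thesis unfolding confined_def using S Sc by blast
qed

end

section \<open>Descent along a subnormal series\<close>

context group
begin

text \<open>
  Finite index, normality and residual finiteness for subsets of one ambient group. This spares the
  passage to groups with another carrier.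
\<close>

definition finite_index_in :: "'a set \<Rightarrow> 'a set \<Rightarrow> bool" where
  "finite_index_in H K \<longleftrightarrow> (\<exists>C. finite C \<and> C \<subseteq> H \<and> H \<subseteq> C <#> K)"

lemma finite_index_in_restrict:
  assumes K: "subgroup K G" and M: "subgroup M G" and C: "finite C" "C \<subseteq> carrier G" "M \<subseteq> C <#> K"
  shows "finite_index_in M (K \<inter> M)"
proof -
  define R where "R = {c \<in> C. \<exists>k\<in>K. c \<otimes> k \<in> M}"
  have "\<forall>c\<in>R. \<exists>k\<in>K. c \<otimes> k \<in> M" by (auto simp: R_def)
  then obtain s where s: "\<And>c. c \<in> R \<Longrightarrow> s c \<in> K \<and> c \<otimes> s c \<in> M" by metis
  let ?C = "(\<lambda>c. c \<otimes> s c) ` R"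
  have "M \<subseteq> ?C <#> (K \<inter> M)"
  proof
    fix m assume m: "m \<in> M"
    then obtain c k where ck: "c \<in> C" "k \<in> K" "m = c \<otimes> k" using C(3) by (auto elim!: set_multE dest!: subsetD)
    then have cR: "c \<in> R" using m by (auto simp: R_def)
    have cc: "c \<in> carrier G" "k \<in> carrier G" "s c \<in> carrier G"
      using ck C s[OF cR] subgroup.mem_carrier[OF K] by auto
    have e: "inv (c \<otimes> s c) \<otimes> m = inv (s c) \<otimes> k"
      using cc ck(3) by (simp add: inv_mult_group m_assoc) (simp add: m_assoc[symmetric])
    have "inv (s c) \<otimes> k \<in> K" using s[OF cR] ck K by (simp add: subgroup.m_closed subgroup.m_inv_closed)
    moreover have "inv (c \<otimes> s c) \<otimes> m \<in> M"
      using s[OF cR] m M by (simp add: subgroup.m_closed subgroup.m_inv_closed)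
    ultimately have "inv (c \<otimes> s c) \<otimes> m \<in> K \<inter> M" using e by simp
    moreover have "m = (c \<otimes> s c) \<otimes> (inv (c \<otimes> s c) \<otimes> m)"
      using cc subgroup.mem_carrier[OF M m] by (simp add: m_assoc[symmetric] del: inv_mult_group)
    ultimately show "m \<in> ?C <#> (K \<inter> M)" using cR set_multI by (metis image_eqI)
  qed
  moreover have "finite ?C" using C(1) by (simp add: R_def)
  moreover have "?C \<subseteq> M" using s by auto
  ultimately show ?thesis unfolding finite_index_in_def by blast
qed

lemma finite_index_in_Int:
  assumes "subgroup H G" "subgroup K1 G" "subgroup K2 G" "K1 \<subseteq> H" "finite_index_in H K1" "finite_index_in H K2"
  shows "finite_index_in H (K1 \<inter> K2)"
proof -
  have Hc: "H \<subseteq> carrier G" using assms(1) by (rule subgroup.subset)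
  obtain C1 where C1: "finite C1" "C1 \<subseteq> H" "H \<subseteq> C1 <#> K1" using assms(5) by (auto simp: finite_index_in_def)
  obtain C2 where C2: "finite C2" "C2 \<subseteq> H" "H \<subseteq> C2 <#> K2" using assms(6) by (auto simp: finite_index_in_def)
  have "finite_index_in K1 (K2 \<inter> K1)"
    using C2 Hc assms(2-4) by (intro finite_index_in_restrict[of _ _ C2]) auto
  then obtain C where C: "finite C" "C \<subseteq> K1" "K1 \<subseteq> C <#> (K2 \<inter> K1)" by (auto simp: finite_index_in_def)
  have "H \<subseteq> C1 <#> (C <#> (K2 \<inter> K1))" using C1(3) C(3) mono_set_mult[of C1 C1 K1] by blast
  also have "\<dots> = (C1 <#> C) <#> (K1 \<inter> K2)"
    using C1 C Hc assms(4) by (subst set_mult_assoc) (auto simp: Int_commute)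
  finally have "H \<subseteq> (C1 <#> C) <#> (K1 \<inter> K2)" .
  moreover have "C1 <#> C \<subseteq> H"
    using C1(2) C(2) assms(1,4) by (auto elim!: set_multE intro!: subgroup.m_closed)
  ultimately show ?thesis unfolding finite_index_in_def using finite_set_mult[OF C1(1) C(1)] by blast
qed

definition normal_within :: "'a set \<Rightarrow> 'a set \<Rightarrow> bool" where
  "normal_within H K \<longleftrightarrow> subgroup K G \<and> K \<subseteq> H \<and> (\<forall>h\<in>H. \<forall>k\<in>K. h \<otimes> k \<otimes> inv h \<in> K)"

definition residual_within :: "'a set \<Rightarrow> bool" where
  "residual_within H \<longleftrightarrow> (\<forall>g\<in>H. g \<noteq> \<one> \<longrightarrow> (\<exists>K. normal_within H K \<and> finite_index_in H K \<and> g \<notin> K))"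

lemma residual_within_finite_set:
  assumes H: "subgroup H G" "residual_within H" and T: "finite T" "\<one> \<notin> T"
  shows "\<exists>K. normal_within H K \<and> finite_index_in H K \<and> K \<inter> T = {}"
  using T
proof (induction T)
  case empty
  have Hc: "H \<subseteq> carrier G" using H(1) by (rule subgroup.subset)
  have "normal_within H H"
    using H(1) by (auto simp: normal_within_def intro!: subgroup.m_closed subgroup.m_inv_closed)
  moreover have "finite_index_in H H"
    unfolding finite_index_in_def
  proof (intro exI[of _ "{\<one>}"] conjI)
    show "H \<subseteq> {\<one>} <#> H" using Hc by (force simp: mem_set_mult)
  qed (use H(1) subgroup.one_closed in auto)
  ultimately show ?case by auto
next
  case (insert t T)
  then obtain K where K: "normal_within H K" "finite_index_in H K" "K \<inter> T = {}" by auto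
  show ?case
  proof (cases "t \<in> H")
    case False
    then show ?thesis using K by (auto simp: normal_within_def)
  next
    case True
    then obtain K' where K': "normal_within H K'" "finite_index_in H K'" "t \<notin> K'"
      using H(2) insert by (auto simp: residual_within_def)
    have "finite_index_in H (K \<inter> K')"
      using K K' by (intro finite_index_in_Int H) (auto simp: normal_within_def)
    moreover have "normal_within H (K \<inter> K')"
      using K K' subgroups_Inter_pair by (auto simp: normal_within_def)
    ultimately show ?thesis using K K' by auto
  qed
qed

definition commutators_in :: "'a set \<Rightarrow> 'a set \<Rightarrow> bool" where
  "commutators_in A V \<longleftrightarrow> (\<forall>a\<in>A. \<forall>b\<in>A. a \<otimes> b \<otimes> inv a \<otimes> inv b \<in> V)"

lemma commutators_conj:
  assumes "commutators_in A M" "subgroup M G" "M \<subseteq> A" "A \<subseteq> carrier G" "a \<in> A" "m \<in> M"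
  shows "a \<otimes> m \<otimes> inv a \<in> M"
proof -
  have "a \<otimes> m \<otimes> inv a \<otimes> inv m \<in> M" using assms unfolding commutators_in_def by blast
  then have "(a \<otimes> m \<otimes> inv a \<otimes> inv m) \<otimes> m \<in> M" using assms by (simp add: subgroup.m_closed)
  moreover have "a \<in> carrier G" "m \<in> carrier G" using assms by auto
  ultimately show ?thesis by (simp add: m_assoc)
qed

definition adjoin :: "'a set \<Rightarrow> 'a \<Rightarrow> 'a set" where
  "adjoin M c = {m \<otimes> c [^] (j::int) | m j. m \<in> M}"

lemma adjoin_subgroup:
  assumes A: "subgroup A G" and comm: "commutators_in A M" and M: "subgroup M G" "M \<subseteq> A" and c: "c \<in> A"
  shows "subgroup (adjoin M c) G" "M \<subseteq> adjoin M c" "c \<in> adjoin M c" "adjoin M c \<subseteq> A"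
proof -
  have Ac: "A \<subseteq> carrier G" using A by (rule subgroup.subset)
  have cc: "c \<in> carrier G" using c Ac by auto
  have mc: "m \<in> carrier G" if "m \<in> M" for m using that M Ac by auto
  have cj: "c [^] (j::int) \<in> A" for j using A c by (rule subgroup_int_pow_closed)
  have conj: "c [^] (j::int) \<otimes> m \<otimes> c [^] (- j) \<in> M" if "m \<in> M" for m j
    using commutators_conj[OF comm M Ac cj that, of j] cc by (simp add: int_pow_neg)
  have I: "m \<otimes> c [^] (j::int) \<in> adjoin M c" if "m \<in> M" for m j using that by (auto simp: adjoin_def)
  have one: "\<one> \<in> M" using M by (simp add: subgroup.one_closed)
  show MA: "M \<subseteq> adjoin M c"
  proof
    fix m assume m: "m \<in> M"
    then show "m \<in> adjoin M c" using I[OF m, of 0] mc[OF m] by simp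
  qed
  show "c \<in> adjoin M c" using I[OF one, of 1] cc by simp
  show sub: "adjoin M c \<subseteq> A" using cj M A by (auto simp: adjoin_def intro!: subgroup.m_closed)
  show "subgroup (adjoin M c) G"
  proof
    show "adjoin M c \<subseteq> carrier G" using sub Ac by auto
    show "\<one> \<in> adjoin M c" using one MA by auto
    fix x y assume "x \<in> adjoin M c" "y \<in> adjoin M c"
    then obtain m i n j where xy: "m \<in> M" "x = m \<otimes> c [^] (i::int)" "n \<in> M" "y = n \<otimes> c [^] (j::int)"
      by (auto simp: adjoin_def)
    have "x \<otimes> y = m \<otimes> (c [^] i \<otimes> n \<otimes> c [^] (- i)) \<otimes> c [^] (i + j)"
    proof -
      have "c [^] (- i) \<otimes> c [^] (i + j) = c [^] j" using cc by (simp add: int_pow_mult[symmetric])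
      then show ?thesis using xy mc cc by (simp add: m_assoc)
    qed
    moreover have "m \<otimes> (c [^] i \<otimes> n \<otimes> c [^] (- i)) \<in> M" using xy conj M(1) by (simp add: subgroup.m_closed)
    ultimately show "x \<otimes> y \<in> adjoin M c" using I by metis
  next
    fix x assume "x \<in> adjoin M c"
    then obtain m i where x: "m \<in> M" "x = m \<otimes> c [^] (i::int)" by (auto simp: adjoin_def)
    have "inv x = c [^] (- i) \<otimes> inv m" using x mc cc by (simp add: inv_mult_group int_pow_neg)
    also have "\<dots> = (c [^] (- i) \<otimes> inv m \<otimes> c [^] (- (- i))) \<otimes> c [^] (- i)"
    proof -
      have "c [^] (- (- i)) \<otimes> c [^] (- i) = \<one>" using cc by (simp add: int_pow_mult[symmetric])
      then show ?thesis using x mc cc by (simp add: m_assoc del: minus_minus)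
    qed
    finally show "inv x \<in> adjoin M c" using I conj[of "inv m" "- i"] x M(1) by (metis subgroup.m_inv_closed)
  qed
qed

end

context seeded_endomorphism
begin

text \<open>
  Either some power of \<open>c\<close> lies in \<open>M\<close>, and \<open>M\<close> has finite index, or the quotient is infinite cyclic
  and \<open>confined_N\<close> applies.
\<close>

lemma confined_adjoin:
  assumes H: "subgroup H G" "residual_within H" and A: "subgroup A G" "A \<subseteq> H"
    and comm: "commutators_in A M" and M: "subgroup M G" "M \<subseteq> A" and c: "c \<in> A"
    and conf: "confined (adjoin M c)"
  shows "confined M"
proof -
  note adj = adjoin_subgroup[OF A(1) comm M c]
  have Ac: "A \<subseteq> carrier G" using A(1) by (rule subgroup.subset)
  have cc: "c \<in> carrier G" using c Ac by auto
  have Mc: "M \<subseteq> carrier G" using M(1) by (rule subgroup.subset)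
  have conj: "a \<otimes> m \<otimes> inv a \<in> M" if "a \<in> A" "m \<in> M" for a m
    by (rule commutators_conj[OF comm M Ac that])
  have cj: "c [^] (j::int) \<in> A" for j using A(1) c by (rule subgroup_int_pow_closed)
  have move: "m \<otimes> c [^] (j::int) = c [^] j \<otimes> (c [^] (- j) \<otimes> m \<otimes> inv (c [^] (- j)))" if "m \<in> M" for m j
  proof -
    have "m \<in> carrier G" using that Mc by auto
    moreover have "inv (c [^] (- j)) = c [^] j" using cc by (simp add: int_pow_neg)
    moreover have "c [^] j \<otimes> c [^] (- j) = \<one>" using cc by (simp add: int_pow_mult[symmetric])
    ultimately show ?thesis using cc by (simp add: m_assoc[symmetric])
  qed
  show ?thesis
  proof (cases "\<exists>k>0. c [^] (k::int) \<in> M")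
    case True
    then obtain k where k: "k > 0" "c [^] (k::int) \<in> M" by blast
    have kq: "c [^] (k * q) \<in> M" for q
      using subgroup_int_pow_closed[OF M(1) k(2), of q] cc by (simp add: int_pow_pow)
    let ?C = "(\<lambda>i. c [^] i) ` {0..<k}"
    have "adjoin M c \<subseteq> ?C <#> M"
    proof
      fix x assume "x \<in> adjoin M c"
      then obtain m j where x: "m \<in> M" "x = m \<otimes> c [^] (j::int)" by (auto simp: adjoin_def)
      have mc: "m \<in> carrier G" using x Mc by auto
      have "c [^] j = c [^] (k * (j div k)) \<otimes> c [^] (j mod k)" using cc by (simp add: int_pow_mult[symmetric])
      then have x2: "x = (m \<otimes> c [^] (k * (j div k))) \<otimes> c [^] (j mod k)" using x mc cc by (simp add: m_assoc)
      have m': "m \<otimes> c [^] (k * (j div k)) \<in> M" using x(1) kq M(1) by (simp add: subgroup.m_closed)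
      have "x = c [^] (j mod k) \<otimes> (c [^] (- (j mod k)) \<otimes> (m \<otimes> c [^] (k * (j div k))) \<otimes> inv (c [^] (- (j mod k))))"
        unfolding x2 by (rule move[OF m'])
      moreover have "c [^] (j mod k) \<in> ?C" using k(1) by auto
      ultimately show "x \<in> ?C <#> M" using conj[OF cj m'] by (metis set_multI)
    qed
    then show ?thesis
      by (rule confined_finite_index[OF conf adj(2)]) (use adj(4) Ac cc in auto)
  next
    case False
    have zero: "j = 0" if "c [^] (j::int) \<in> M" for j
    proof (rule ccontr)
      assume "j \<noteq> 0"
      moreover have "c [^] (- j) \<in> M" using subgroup.m_inv_closed[OF M(1) that] cc by (simp add: int_pow_neg)
      ultimately show False using False that by (cases "j > 0") auto
    qed
    have uniq: "i = j" if "m \<in> M" "n \<in> M" "m \<otimes> c [^] (i::int) = n \<otimes> c [^] (j::int)" for m n i j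
    proof -
      have mn: "m \<in> carrier G" "n \<in> carrier G" using that Mc by auto
      have "c [^] (i - j) = inv m \<otimes> (m \<otimes> c [^] i) \<otimes> c [^] (- j)"
        using mn cc by (simp add: m_assoc[symmetric] int_pow_mult[symmetric])
      also have "\<dots> = inv m \<otimes> n"
        unfolding that(3) using mn cc by (simp add: m_assoc int_pow_mult[symmetric])
      finally have "c [^] (i - j) \<in> M" using that M(1) by (simp add: subgroup.m_closed subgroup.m_inv_closed)
      then show ?thesis using zero[of "i - j"] by simp
    qed
    define deg where "deg b = (THE j::int. \<exists>m\<in>M. b = m \<otimes> c [^] j)" for b
    have deg: "deg (m \<otimes> c [^] j) = j" if "m \<in> M" for m and j :: int
      unfolding deg_def using that uniq by (intro the_equality) blast+
    have cyc: "cyclic_extension G X \<phi> z f \<eta> \<delta> E x0 M (adjoin M c) c deg"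
    proof
      show "x \<otimes> y \<in> M" if "x \<in> M" "y \<in> M" for x y using that M(1) by (rule subgroup.m_closed[rotated])
      show "\<one> \<in> M" by (rule subgroup.one_closed[OF M(1)])
      show "inv x \<in> M" if "x \<in> M" for x using that M(1) by (rule subgroup.m_inv_closed[rotated])
      show "x \<otimes> y \<in> adjoin M c" if "x \<in> adjoin M c" "y \<in> adjoin M c" for x y
        using that adj(1) by (metis subgroup.m_closed)
      show "\<one> \<in> adjoin M c" by (rule subgroup.one_closed[OF adj(1)])
      show "inv x \<in> adjoin M c" if "x \<in> adjoin M c" for x using that adj(1) by (metis subgroup.m_inv_closed)
      show "deg c = 1" using deg[OF subgroup.one_closed[OF M(1)], of 1] cc by simp
      show "deg (x \<otimes> y) = deg x + deg y" if in_adj: "x \<in> adjoin M c" "y \<in> adjoin M c" for x y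
      proof -
        obtain m i n j where xy: "m \<in> M" "x = m \<otimes> c [^] (i::int)" "n \<in> M" "y = n \<otimes> c [^] (j::int)"
          using in_adj unfolding adjoin_def by blast
        have mn: "m \<in> carrier G" "n \<in> carrier G" using xy Mc by auto
        have "m \<otimes> (c [^] i \<otimes> n \<otimes> inv (c [^] i)) \<in> M"
          using xy conj[OF cj] M(1) by (simp add: subgroup.m_closed)
        moreover have "x \<otimes> y = (m \<otimes> (c [^] i \<otimes> n \<otimes> inv (c [^] i))) \<otimes> c [^] (i + j)"
        proof -
          have "inv (c [^] i) \<otimes> c [^] (i + j) = c [^] j"
            using cc by (simp add: int_pow_neg[symmetric] int_pow_mult[symmetric])
          then show ?thesis using xy mn cc by (simp add: m_assoc)
        qed
        ultimately show ?thesis using deg xy by simp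
      qed
      show "deg x = 0 \<longleftrightarrow> x \<in> M" if in_adj: "x \<in> adjoin M c" for x
      proof -
        obtain m i where x: "m \<in> M" "x = m \<otimes> c [^] (i::int)" using in_adj unfolding adjoin_def by blast
        have mc: "m \<in> carrier G" using x Mc by auto
        show ?thesis
        proof
          assume "deg x = 0" then show "x \<in> M" using deg[OF x(1), of i] x mc by simp
        next
          assume xM: "x \<in> M"
          then have "deg (x \<otimes> c [^] (0::int)) = 0" by (rule deg)
          then show "deg x = 0" using xM Mc by auto
        qed
      qed
      fix T :: "'g set" assume T: "finite T" "\<one> \<notin> T"
      obtain K where K: "normal_within H K" "finite_index_in H K" "K \<inter> T = {}"
        using residual_within_finite_set[OF H T] by blast
      then obtain C where C: "finite C" "C \<subseteq> H" "H \<subseteq> C <#> K" by (auto simp: finite_index_in_def)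
      have Hc: "H \<subseteq> carrier G" using H(1) by (rule subgroup.subset)
      have Kc: "subgroup K G" using K by (simp add: normal_within_def)
      have "finite_index_in M (K \<inter> M)"
        using C A M Hc by (intro finite_index_in_restrict[OF Kc M(1), of C]) auto
      then obtain C' where C': "finite C'" "C' \<subseteq> M" "M \<subseteq> C' <#> (K \<inter> M)" by (auto simp: finite_index_in_def)
      show "\<exists>L C. subgroup L G \<and> L \<subseteq> M \<and> L \<inter> T = {} \<and>
          (\<forall>b\<in>adjoin M c. \<forall>l\<in>L. b \<otimes> l \<otimes> inv b \<in> L) \<and> finite C \<and> C \<subseteq> M \<and> M \<subseteq> C <#> L"
      proof (rule exI[of _ "K \<inter> M"], rule exI[of _ C'], intro conjI ballI)
        show "subgroup (K \<inter> M) G" using Kc M(1) by (rule subgroups_Inter_pair)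
        fix b l assume b: "b \<in> adjoin M c" and l: "l \<in> K \<inter> M"
        have "b \<in> A" "b \<in> H" using b adj(4) A by auto
        then show "b \<otimes> l \<otimes> inv b \<in> K \<inter> M" using l K(1) conj unfolding normal_within_def by blast
      qed (use C' K in auto)
    qed (use Mc adj conf Ac in auto)
    then interpret C: cyclic_extension G X \<phi> z f \<eta> \<delta> E x0 M "adjoin M c" c deg .
    show ?thesis by (rule C.confined_N)
  qed
qed

lemma confined_generators:
  assumes H: "subgroup H G" "residual_within H" and A: "subgroup A G" "A \<subseteq> H"
    and comm: "commutators_in A M0" and M0: "subgroup M0 G" "M0 \<subseteq> A" and S: "finite S" "S \<subseteq> A"
  shows "\<exists>M. subgroup M G \<and> M0 \<subseteq> M \<and> M \<subseteq> A \<and> S \<subseteq> M \<and> (confined M \<longrightarrow> confined M0)"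
  using S
proof (induction S)
  case empty
  then show ?case using M0 by auto
next
  case (insert c S)
  then obtain M where M: "subgroup M G" "M0 \<subseteq> M" "M \<subseteq> A" "S \<subseteq> M" "confined M \<longrightarrow> confined M0" by auto
  have comm': "commutators_in A M" using comm M(2) by (auto simp: commutators_in_def)
  have c: "c \<in> A" using insert by auto
  note adj = adjoin_subgroup[OF A(1) comm' M(1,3) c]
  have "confined (adjoin M c) \<longrightarrow> confined M0"
    using confined_adjoin[OF H A comm' M(1,3) c] M(5) by blast
  then show ?case using adj M by (intro exI[of _ "adjoin M c"]) auto
qed

text \<open>
  Confinement passes from \<open>B\<close> to a finitely generated subgroup of \<open>B\<close>, from there to a subgroup \<open>A\<close>
  of finite index that is abelian modulo \<open>V\<close>, and to a finitely generated subgroup of \<open>A\<close>. Modulo \<open>V\<close>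
  the latter is generated by finitely many commuting elements, and \<open>confined_adjoin\<close> removes them one at
  a time.
\<close>

lemma confined_descend:
  assumes H: "subgroup H G" "residual_within H" and V: "subgroup V G" and B: "subgroup B G" "B \<subseteq> H"
    and step: "\<And>C. finite C \<Longrightarrow> C \<subseteq> B \<Longrightarrow>
      \<exists>A. subgroup A G \<and> A \<subseteq> generate G C \<and> finite_index_in (generate G C) A \<and> commutators_in A V"
    and conf: "confined B"
  shows "\<exists>B'. subgroup B' G \<and> B' \<subseteq> B \<inter> V \<and> confined B'"
proof -
  have Bc: "B \<subseteq> carrier G" using B(1) by (rule subgroup.subset)
  obtain C where C: "finite C" "C \<subseteq> B"
    "\<And>N'. subgroup N' G \<Longrightarrow> N' \<subseteq> B \<Longrightarrow> C \<subseteq> N' \<Longrightarrow> confined N'"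
    using confined_finitely_generated[OF conf B(1)] by blast
  have Cc: "C \<subseteq> carrier G" using C Bc by auto
  let ?B1 = "generate G C"
  have B1: "subgroup ?B1 G" "?B1 \<subseteq> B" "C \<subseteq> ?B1"
    using generate_is_subgroup[OF Cc] generate_subgroup_incl[OF C(2) B(1)] generate.incl by auto
  then have conf1: "confined ?B1" using C(3) by blast
  obtain A where A: "subgroup A G" "A \<subseteq> ?B1" "finite_index_in ?B1 A" "commutators_in A V"
    using step[OF C(1,2)] by blast
  obtain R where R: "finite R" "R \<subseteq> ?B1" "?B1 \<subseteq> R <#> A" using A(3) by (auto simp: finite_index_in_def)
  have "confined A"
    using conf1 A(2) R(3,1) by (rule confined_finite_index) (use R B1 Bc in auto)
  then obtain S where S: "finite S" "S \<subseteq> A"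
    "\<And>N'. subgroup N' G \<Longrightarrow> N' \<subseteq> A \<Longrightarrow> S \<subseteq> N' \<Longrightarrow> confined N'"
    using confined_finitely_generated[OF _ A(1)] by blast
  have Ac: "A \<subseteq> carrier G" using A(1) by (rule subgroup.subset)
  have Sc: "S \<subseteq> carrier G" using S Ac by auto
  let ?A' = "generate G S"
  have A': "subgroup ?A' G" "?A' \<subseteq> A" "S \<subseteq> ?A'"
    using generate_is_subgroup[OF Sc] generate_subgroup_incl[OF S(2) A(1)] generate.incl by auto
  have comm: "commutators_in ?A' (?A' \<inter> V)"
    using A(4) A'(1,2) unfolding commutators_in_def
    by (auto intro!: subgroup.m_closed[OF A'(1)] subgroup.m_inv_closed[OF A'(1)])
  have M0: "subgroup (?A' \<inter> V) G" using A'(1) V by (rule subgroups_Inter_pair)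
  have A'H: "?A' \<subseteq> H" using A' A B1 B by blast
  obtain M where M: "subgroup M G" "M \<subseteq> ?A'" "S \<subseteq> M" "confined M \<longrightarrow> confined (?A' \<inter> V)"
    using confined_generators[OF H A'(1) A'H comm M0 _ S(1) A'(3)] by blast
  have "confined M" using S(3)[OF M(1)] M A' by blast
  then show ?thesis using M M0 A' A B1 by (intro exI[of _ "?A' \<inter> V"]) auto
qed

lemma confined_series:
  fixes Hs :: "nat \<Rightarrow> 'g set"
  assumes H: "subgroup (Hs n) G" "residual_within (Hs n)" "\<And>i. i \<le> n \<Longrightarrow> subgroup (Hs i) G" "Hs 0 = {\<one>}"
    and sub: "\<And>i. i \<le> n \<Longrightarrow> Hs i \<subseteq> Hs n"
    and step: "\<And>i C. i < n \<Longrightarrow> finite C \<Longrightarrow> C \<subseteq> Hs (Suc i) \<Longrightarrow>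
      \<exists>A. subgroup A G \<and> A \<subseteq> generate G C \<and> finite_index_in (generate G C) A \<and> commutators_in A (Hs i)"
    and conf: "confined (Hs n)"
  shows "dying x0"
proof -
  have "\<exists>B. subgroup B G \<and> B \<subseteq> Hs (n - k) \<and> confined B" if "k \<le> n" for k
    using that
  proof (induction k)
    case 0
    then show ?case using H(1) conf by auto
  next
    case (Suc k)
    then obtain B where B: "subgroup B G" "B \<subseteq> Hs (n - k)" "confined B" by auto
    have i: "Suc (n - Suc k) = n - k" "n - Suc k < n" using Suc.prems by auto
    have BH: "B \<subseteq> Hs n" using B(2) sub[of "n - k"] by auto
    have "\<exists>B'. subgroup B' G \<and> B' \<subseteq> B \<inter> Hs (n - Suc k) \<and> confined B'"
    proof (rule confined_descend[OF H(1,2) _ B(1) BH _ B(3)])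
      show "subgroup (Hs (n - Suc k)) G" by (rule H(3)) simp
      fix C assume "finite C" "C \<subseteq> B"
      then show "\<exists>A. subgroup A G \<and> A \<subseteq> generate G C \<and> finite_index_in (generate G C) A \<and> commutators_in A (Hs (n - Suc k))"
        using step[OF i(2), of C] B(2) unfolding i(1) by auto
    qed
    then show ?case by auto
  qed
  from this[of n] obtain B where B: "subgroup B G" "B \<subseteq> {\<one>}" "confined B" using H(4) by auto
  then have "B = {\<one>}" using subgroup.one_closed by blast
  then show ?thesis using B(3) confined_one_dying by simp
qed

end

section \<open>Groups given by the hypotheses\<close>

context group
begin

lemma finite_rcosets_reps:
  assumes K: "subgroup K G" and fin: "finite (rcosets K)"
  shows "\<exists>C. finite C \<and> C \<subseteq> carrier G \<and> carrier G \<subseteq> C <#> K"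
proof -
  have Kc: "K \<subseteq> carrier G" using K by (rule subgroup.subset)
  have "\<forall>R\<in>rcosets K. \<exists>r. r \<in> R"
    using subgroup.rcosets_non_empty[OF K] by blast
  then obtain r where r: "\<And>R. R \<in> rcosets K \<Longrightarrow> r R \<in> R" by metis
  have rc: "r R \<in> carrier G" if "R \<in> rcosets K" for R
    using r[OF that] rcosets_part_G[OF K] that by blast
  let ?C = "(\<lambda>R. inv (r R)) ` (rcosets K)"
  have "carrier G \<subseteq> ?C <#> K"
  proof
    fix g assume g: "g \<in> carrier G"
    have R: "K #> inv g \<in> rcosets K" using g Kc by (intro rcosetsI) auto
    then obtain k where k: "k \<in> K" "r (K #> inv g) = k \<otimes> inv g" using r[OF R] by (auto simp: r_coset_def)
    have kc: "k \<in> carrier G" using k Kc by auto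
    have "g = inv (r (K #> inv g)) \<otimes> k" unfolding k(2) using kc g by (simp add: inv_mult_group m_assoc)
    then show "g \<in> ?C <#> K" using R k(1) by (metis image_eqI set_multI)
  qed
  moreover have "?C \<subseteq> carrier G" using rc by auto
  ultimately show ?thesis using fin by blast
qed

lemma residual_within_if_residually_finite:
  assumes H: "subgroup H G" and rf: "residually_finite (G\<lparr>carrier := H\<rparr>)"
  shows "residual_within H"
  unfolding residual_within_def
proof (intro ballI impI)
  fix g assume g: "g \<in> H" "g \<noteq> \<one>"
  interpret GH: group "G\<lparr>carrier := H\<rparr>" using H by (rule subgroup_imp_group)
  obtain K where K: "K \<lhd> G\<lparr>carrier := H\<rparr>" "finite (rcosets\<^bsub>G\<lparr>carrier := H\<rparr>\<^esub> K)" "g \<notin> K"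
    using rf g unfolding residually_finite_def by auto
  have KH: "subgroup K (G\<lparr>carrier := H\<rparr>)" using K(1) by (rule normal_imp_subgroup)
  have "\<exists>C. finite C \<and> C \<subseteq> H \<and> H \<subseteq> C <#> K"
    using GH.finite_rcosets_reps[OF KH K(2)] by simp
  then have "finite_index_in H K" by (simp add: finite_index_in_def)
  moreover have "normal_within H K"
    unfolding normal_within_def
  proof (intro conjI ballI)
    show "subgroup K G" using H KH by (rule incl_subgroup)
    show "K \<subseteq> H" using subgroup.subset[OF KH] by simp
    fix h k assume hk: "h \<in> H" "k \<in> K"
    then have "h \<otimes>\<^bsub>G\<lparr>carrier := H\<rparr>\<^esub> k \<otimes>\<^bsub>G\<lparr>carrier := H\<rparr>\<^esub> inv\<^bsub>G\<lparr>carrier := H\<rparr>\<^esub> h \<in> K"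
      using K(1) GH.normal_inv_iff[of K] by simp
    then show "h \<otimes> k \<otimes> inv h \<in> K" using m_inv_consistent[OF H hk(1)] by simp
  qed
  ultimately show "\<exists>K. normal_within H K \<and> finite_index_in H K \<and> g \<notin> K" using K(3) by blast
qed

text \<open>
  In this form the hypothesis on a quotient \<open>U / V\<close> speaks of elements of \<open>U\<close> only and is inherited by
  all subgroups of \<open>U\<close>. The subgroup \<open>A\<close> is the preimage of an abelian subgroup of finite index in the
  image of the group generated by \<open>C\<close>.
\<close>

lemma locally_virtually_abelian_quotient:
  assumes U: "subgroup U G" and V: "V \<lhd> G\<lparr>carrier := U\<rparr>"
    and lva: "group_locally (group_virtually comm_group) ((G\<lparr>carrier := U\<rparr>) Mod V)"
    and C: "finite C" "C \<subseteq> U"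
  shows "\<exists>A. subgroup A G \<and> A \<subseteq> generate G C \<and> finite_index_in (generate G C) A \<and> commutators_in A V"
proof -
  define Q where "Q = (G\<lparr>carrier := U\<rparr>) Mod V"
  define \<pi> where "\<pi> a = V #> a" for a
  interpret GU: group "G\<lparr>carrier := U\<rparr>" using U by (rule subgroup_imp_group)
  interpret N: normal V "G\<lparr>carrier := U\<rparr>" by (rule V)
  interpret Q: group Q unfolding Q_def by (rule N.factorgroup_is_group)
  have "(\<lambda>a. V #>\<^bsub>G\<lparr>carrier := U\<rparr>\<^esub> a) \<in> hom (G\<lparr>carrier := U\<rparr>) Q"
    unfolding Q_def by (rule N.r_coset_hom_Mod)
  moreover have "(\<lambda>a. V #>\<^bsub>G\<lparr>carrier := U\<rparr>\<^esub> a) = \<pi>"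
    by (rule ext) (simp add: \<pi>_def r_coset_def)
  ultimately have hom: "\<pi> \<in> hom (G\<lparr>carrier := U\<rparr>) Q" by simp
  interpret pi: group_hom "G\<lparr>carrier := U\<rparr>" Q \<pi>
    using hom by unfold_locales
  have Uc: "U \<subseteq> carrier G" using U by (rule subgroup.subset)
  have Cc: "C \<subseteq> carrier G" using C Uc by auto
  define g where "g = generate G C"
  have g: "subgroup g G" "g \<subseteq> U" unfolding g_def
    using generate_is_subgroup[OF Cc] generate_subgroup_incl[OF C(2) U] by auto
  define S where "S = generate Q (\<pi> ` C)"
  have piC: "\<pi> ` C \<subseteq> carrier Q" using C pi.hom_closed by auto
  have S: "subgroup S Q" unfolding S_def using piC by (rule Q.generate_is_subgroup)
  have S_img: "S = \<pi> ` g"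
    unfolding S_def g_def using pi.generate_img[of C] C generate_consistent[OF C(2) U] by simp
  have CS: "\<pi> ` C \<subseteq> S" unfolding S_def using generate.incl[of _ "\<pi> ` C" Q] by blast
  have "finitely_generated (Q\<lparr>carrier := S\<rparr>)"
    unfolding finitely_generated_def
  proof (intro exI[of _ "\<pi> ` C"] conjI)
    show "carrier (Q\<lparr>carrier := S\<rparr>) = generate (Q\<lparr>carrier := S\<rparr>) (\<pi> ` C)"
      using Q.generate_consistent[OF CS S] by (simp add: S_def)
  qed (use C CS in auto)
  then have "group_virtually comm_group (Q\<lparr>carrier := S\<rparr>)"
    using lva S unfolding group_locally_def Q_def by blast
  then obtain A' where A': "subgroup A' (Q\<lparr>carrier := S\<rparr>)"
    "finite (rcosets\<^bsub>Q\<lparr>carrier := S\<rparr>\<^esub> A')" "comm_group (Q\<lparr>carrier := S, carrier := A'\<rparr>)"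
    unfolding group_virtually_def by blast
  interpret QS: group "Q\<lparr>carrier := S\<rparr>" using S by (rule Q.subgroup_imp_group)
  have "\<exists>R. finite R \<and> R \<subseteq> S \<and> S \<subseteq> R <#>\<^bsub>Q\<^esub> A'"
    using QS.finite_rcosets_reps[OF A'(1,2)] by simp
  then obtain R where R: "finite R" "R \<subseteq> S" "S \<subseteq> R <#>\<^bsub>Q\<^esub> A'" by blast
  have A'Q: "subgroup A' Q" using S A'(1) by (rule Q.incl_subgroup)
  have A'comm: "x \<otimes>\<^bsub>Q\<^esub> y = y \<otimes>\<^bsub>Q\<^esub> x" if "x \<in> A'" "y \<in> A'" for x y
    using comm_groupE(4)[OF A'(3), of x y] that by simp
  have pc: "\<pi> a \<in> carrier Q" if "a \<in> U" for a using pi.hom_closed[of a] that by simp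
  have pm: "\<pi> (a \<otimes> b) = \<pi> a \<otimes>\<^bsub>Q\<^esub> \<pi> b" if "a \<in> U" "b \<in> U" for a b
    using pi.hom_mult[of a b] that by simp
  have pinv: "\<pi> (inv a) = inv\<^bsub>Q\<^esub> \<pi> a" if "a \<in> U" for a
    using pi.hom_inv[of a] m_inv_consistent[OF U that] that by simp
  have Uin: "inv a \<in> U" "a \<otimes> b \<in> U" if "a \<in> U" "b \<in> U" for a b
    using that U by (auto intro: subgroup.m_inv_closed subgroup.m_closed)
  define A where "A = {a \<in> g. \<pi> a \<in> A'}"
  have gU: "a \<in> U" if "a \<in> g" for a using that g by auto
  have "subgroup A G"
  proof
    show "A \<subseteq> carrier G" using g Uc by (auto simp: A_def)
    show "\<one> \<in> A"
      using pi.hom_one subgroup.one_closed[OF A'Q] subgroup.one_closed[OF g(1)] by (simp add: A_def)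
    show "x \<otimes> y \<in> A" if "x \<in> A" "y \<in> A" for x y
      using that pm[of x y] gU g(1) A'Q by (auto simp: A_def intro: subgroup.m_closed)
    show "inv x \<in> A" if "x \<in> A" for x
      using that pinv[of x] gU g(1) A'Q by (auto simp: A_def intro: subgroup.m_inv_closed)
  qed
  moreover have "A \<subseteq> g" by (auto simp: A_def)
  moreover have "commutators_in A V"
    unfolding commutators_in_def
  proof (intro ballI)
    fix a b assume ab: "a \<in> A" "b \<in> A"
    then have abU: "a \<in> U" "b \<in> U" and abA': "\<pi> a \<in> A'" "\<pi> b \<in> A'" by (auto simp: A_def gU)
    let ?k = "a \<otimes> b \<otimes> inv a \<otimes> inv b"
    have kU: "?k \<in> U" using abU Uin by simp
    have "\<pi> ?k = \<pi> a \<otimes>\<^bsub>Q\<^esub> \<pi> b \<otimes>\<^bsub>Q\<^esub> inv\<^bsub>Q\<^esub> \<pi> a \<otimes>\<^bsub>Q\<^esub> inv\<^bsub>Q\<^esub> \<pi> b"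
      using abU Uin by (simp add: pm pinv)
    also have "\<dots> = \<pi> b \<otimes>\<^bsub>Q\<^esub> \<pi> a \<otimes>\<^bsub>Q\<^esub> inv\<^bsub>Q\<^esub> \<pi> a \<otimes>\<^bsub>Q\<^esub> inv\<^bsub>Q\<^esub> \<pi> b"
      using A'comm[OF abA'] by simp
    also have "\<dots> = \<one>\<^bsub>Q\<^esub>" using pc[OF abU(1)] pc[OF abU(2)] by (simp add: Q.m_assoc)
    finally have join: "V #> ?k = V" by (simp add: \<pi>_def Q_def)
    have VG: "subgroup V G" using U N.subgroup_axioms by (rule incl_subgroup)
    show "?k \<in> V" by (rule coset_join1[OF join subsetD[OF Uc kU] VG])
  qed
  moreover have "finite_index_in g A"
  proof -
    define R' where "R' = {\<rho> \<in> R. \<exists>x\<in>g. \<exists>a\<in>A'. \<pi> x = \<rho> \<otimes>\<^bsub>Q\<^esub> a}"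
    have "\<forall>\<rho>\<in>R'. \<exists>x. x \<in> g \<and> (\<exists>a\<in>A'. \<pi> x = \<rho> \<otimes>\<^bsub>Q\<^esub> a)" by (auto simp: R'_def)
    then obtain s where s: "\<And>\<rho>. \<rho> \<in> R' \<Longrightarrow> s \<rho> \<in> g \<and> (\<exists>a\<in>A'. \<pi> (s \<rho>) = \<rho> \<otimes>\<^bsub>Q\<^esub> a)" by metis
    have "g \<subseteq> s ` R' <#> A"
    proof
      fix x assume x: "x \<in> g"
      then have "\<pi> x \<in> R <#>\<^bsub>Q\<^esub> A'" using R(3) S_img by auto
      then obtain \<rho> a where ra: "\<rho> \<in> R" "a \<in> A'" "\<pi> x = \<rho> \<otimes>\<^bsub>Q\<^esub> a" by (auto simp: Q.mem_set_mult)
      then have r: "\<rho> \<in> R'" using x by (auto simp: R'_def)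
      then obtain a' where a': "s \<rho> \<in> g" "a' \<in> A'" "\<pi> (s \<rho>) = \<rho> \<otimes>\<^bsub>Q\<^esub> a'" using s by blast
      have c: "\<rho> \<in> carrier Q" "a \<in> carrier Q" "a' \<in> carrier Q"
        using ra a' R(2) subgroup.subset[OF S] subgroup.subset[OF A'Q] by auto
      have "\<pi> (inv (s \<rho>) \<otimes> x) = inv\<^bsub>Q\<^esub> (\<rho> \<otimes>\<^bsub>Q\<^esub> a') \<otimes>\<^bsub>Q\<^esub> (\<rho> \<otimes>\<^bsub>Q\<^esub> a)"
        using gU[OF x] gU[OF a'(1)] Uin a'(3) ra(3) by (simp add: pm pinv)
      also have "\<dots> = inv\<^bsub>Q\<^esub> a' \<otimes>\<^bsub>Q\<^esub> a"
        using c by (simp add: Q.inv_mult_group Q.m_assoc) (simp add: Q.m_assoc[symmetric])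
      also have "\<dots> \<in> A'" using A'Q ra a' by (simp add: subgroup.m_closed subgroup.m_inv_closed)
      finally have "inv (s \<rho>) \<otimes> x \<in> A"
        using g(1) a'(1) x by (simp add: A_def subgroup.m_closed subgroup.m_inv_closed)
      moreover have "x = s \<rho> \<otimes> (inv (s \<rho>) \<otimes> x)"
        using subgroup.mem_carrier[OF g(1)] a'(1) x by (simp add: m_assoc[symmetric])
      ultimately show "x \<in> s ` R' <#> A" using r by (metis image_eqI set_multI)
    qed
    moreover have "finite (s ` R')" using R(1) by (simp add: R'_def)
    moreover have "s ` R' \<subseteq> g" using s by auto
    ultimately show ?thesis unfolding finite_index_in_def by blast
  qed
  ultimately show ?thesis unfolding g_def by blast
qed

end

section \<open>The constants of an expansive system\<close>

text \<open>
  The pairs of points at distance at least \<open>\<epsilon>\<close> form a compact set. By expansiveness it is covered by the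
  relatively open sets of pairs that a given group element separates by more than \<open>\<Delta>\<close>.
\<close>

lemma expansive_window:
  assumes sys: "pointed_dynamical_system G X \<phi> z" and \<epsilon>: "0 < \<epsilon>"
    and expand: "\<And>x y. x \<in> X \<Longrightarrow> y \<in> X \<Longrightarrow> (\<And>g. g \<in> carrier G \<Longrightarrow> dist (\<phi> g x) (\<phi> g y) \<le> \<Delta>) \<Longrightarrow> x = y"
  shows "\<exists>K. finite K \<and> K \<subseteq> carrier G \<and>
    (\<forall>x\<in>X. \<forall>y\<in>X. (\<forall>g\<in>K. dist (\<phi> g x) (\<phi> g y) \<le> \<Delta>) \<longrightarrow> dist x y < \<epsilon>)"
proof -
  interpret pointed_dynamical_system G X \<phi> z by (rule sys)
  define far where "far g = (\<lambda>p. dist (\<phi> g (fst p)) (\<phi> g (snd p)))" for g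
  have "\<exists>T. open T \<and> T \<inter> (X \<times> X) = far g -` {\<Delta><..} \<inter> (X \<times> X)" if g: "g \<in> carrier G" for g
  proof -
    have "continuous_on (X \<times> X) (\<lambda>p. \<phi> g (fst p))" "continuous_on (X \<times> X) (\<lambda>p. \<phi> g (snd p))"
      by (rule continuous_on_compose2[OF continuous_action[OF g]]; auto intro!: continuous_intros)+
    then have "continuous_on (X \<times> X) (far g)" unfolding far_def by (intro continuous_intros)
    then show ?thesis unfolding continuous_on_open_invariant using open_greaterThan by blast
  qed
  then obtain T where T: "\<And>g. g \<in> carrier G \<Longrightarrow> open (T g)"
    "\<And>g. g \<in> carrier G \<Longrightarrow> T g \<inter> (X \<times> X) = far g -` {\<Delta><..} \<inter> (X \<times> X)"
    by metis
  define Y where "Y = (X \<times> X) \<inter> {p. \<epsilon> \<le> dist (fst p) (snd p)}"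
  have "compact Y" unfolding Y_def
    by (intro compact_Int_closed compact_Times compact_space closed_Collect_le continuous_intros)
  moreover have "Y \<subseteq> (\<Union>g\<in>carrier G. T g)"
  proof
    fix p assume p: "p \<in> Y"
    then have pX: "fst p \<in> X" "snd p \<in> X" "fst p \<noteq> snd p" using \<epsilon> by (auto simp: Y_def)
    then obtain g where g: "g \<in> carrier G" "\<not> dist (\<phi> g (fst p)) (\<phi> g (snd p)) \<le> \<Delta>"
      using expand[of "fst p" "snd p"] by blast
    then have "p \<in> far g -` {\<Delta><..} \<inter> (X \<times> X)" using pX by (auto simp: far_def mem_Times_iff)
    then show "p \<in> (\<Union>g\<in>carrier G. T g)" using T(2)[OF g(1)] g(1) by blast
  qed
  ultimately obtain K where K: "K \<subseteq> carrier G" "finite K" "Y \<subseteq> (\<Union>g\<in>K. T g)"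
    using compactE_image[of Y "carrier G" T] T(1) by metis
  have "dist x y < \<epsilon>" if xy: "x \<in> X" "y \<in> X" "\<forall>g\<in>K. dist (\<phi> g x) (\<phi> g y) \<le> \<Delta>" for x y
  proof (rule ccontr)
    assume "\<not> dist x y < \<epsilon>"
    then have "(x, y) \<in> Y" using xy by (auto simp: Y_def)
    then obtain g where g: "g \<in> K" "(x, y) \<in> T g" using K(3) by blast
    then have "(x, y) \<in> far g -` {\<Delta><..} \<inter> (X \<times> X)" using T(2)[of g] K(1) xy by blast
    then show False using xy(3) g(1) by (auto simp: far_def)
  qed
  then show ?thesis using K by blast
qed

lemma windowed_endomorphism_exists:
  fixes G :: "('g, 'b) monoid_scheme" (structure) and X :: "'x::metric_space set"
  assumes sys: "pointed_dynamical_system G X \<phi> z"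
    and exp: "expansive G X \<phi>" and gluing: "zero_gluing G X \<phi> z"
    and endo: "system_endomorphism G X \<phi> z f" and asym: "asymptotically_nilpotent X z f"
  shows "\<exists>\<eta> \<delta> E. windowed_endomorphism G X \<phi> z f \<eta> \<delta> E"
proof -
  interpret pointed_dynamical_system G X \<phi> z by (rule sys)
  obtain \<Delta> :: real where "0 < \<Delta>"
    and "\<forall>x\<in>X. \<forall>y\<in>X. (\<forall>g\<in>carrier G. dist (\<phi> g x) (\<phi> g y) \<le> \<Delta>) \<longrightarrow> x = y"
    using exp unfolding expansive_def by (elim exE conjE) (rule that)
  then have \<Delta>: "0 < \<Delta>"
    "\<And>x y. x \<in> X \<Longrightarrow> y \<in> X \<Longrightarrow> (\<And>g. g \<in> carrier G \<Longrightarrow> dist (\<phi> g x) (\<phi> g y) \<le> \<Delta>) \<Longrightarrow> x = y"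
    by simp_all
  define \<eta> where "\<eta> = \<Delta> / 4"
  have \<eta>: "0 < \<eta>" "4 * \<eta> = \<Delta>" using \<Delta> by (simp_all add: \<eta>_def)
  obtain \<delta>0 E0 where E0: "0 < \<delta>0" "finite E0" "E0 \<subseteq> carrier G"
    and real: "\<forall>(I :: 'x set) A x. de_designation G X \<phi> z \<delta>0 E0 I A x \<longrightarrow> (\<exists>y. realization X \<phi> \<eta> I A x y)"
    using zero_gluing_any_index_type[OF gluing \<eta>(1), where 'i = 'x] by (elim exE conjE) (rule that)
  define \<delta> where "\<delta> = min \<delta>0 \<eta>"
  have \<delta>: "0 < \<delta>" "\<delta> \<le> \<eta>" "\<delta> \<le> \<delta>0" using E0 \<eta> by (auto simp: \<delta>_def)
  have det: "\<exists>K. finite K \<and> K \<subseteq> carrier G \<and>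
      (\<forall>x\<in>X. \<forall>y\<in>X. (\<forall>g\<in>K. dist (\<phi> g x) (\<phi> g y) \<le> 4 * \<eta>) \<longrightarrow> dist x y < \<epsilon>)" if "0 < \<epsilon>" for \<epsilon>
    using expansive_window[OF sys that \<Delta>(2)] unfolding \<eta>(2) by blast
  have f: "continuous_on X f" using endo by (simp add: system_endomorphism_def)
  have "uniformly_continuous_on X f" by (rule compact_uniformly_continuous[OF f compact_space])
  then obtain \<epsilon> where \<epsilon>: "\<epsilon> > 0" "\<And>x y. x \<in> X \<Longrightarrow> y \<in> X \<Longrightarrow> dist x y < \<epsilon> \<Longrightarrow> dist (f x) (f y) < \<delta>"
    using \<delta>(1) unfolding uniformly_continuous_on_def by metis
  have "0 < min \<epsilon> \<delta>" using \<epsilon> \<delta> by simp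
  from det[OF this] obtain K where K: "finite K" "K \<subseteq> carrier G"
    "\<And>x y. x \<in> X \<Longrightarrow> y \<in> X \<Longrightarrow> (\<forall>g\<in>K. dist (\<phi> g x) (\<phi> g y) \<le> 4 * \<eta>) \<Longrightarrow> dist x y < min \<epsilon> \<delta>"
    by blast
  define S where "S = insert \<one> (E0 \<union> K)"
  define E where "E = S \<union> (\<lambda>h. inv h) ` S"
  have S: "finite S" "S \<subseteq> carrier G" using E0 K by (auto simp: S_def)
  have "windowed_endomorphism G X \<phi> z f \<eta> \<delta> E"
  proof
    show "finite E" "E \<subseteq> carrier G" "\<one> \<in> E" using S by (auto simp: E_def S_def)
    show "inv h \<in> E" if "h \<in> E" for h using that S by (auto simp: E_def)
    show "dist x y < \<delta> \<and> dist (f x) (f y) < \<delta>"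
      if xy: "x \<in> X" "y \<in> X" "\<And>h. h \<in> E \<Longrightarrow> dist (\<phi> h x) (\<phi> h y) \<le> 4 * \<eta>" for x y
    proof -
      have "dist x y < min \<epsilon> \<delta>" using K(3)[OF xy(1,2)] xy(3) by (auto simp: E_def S_def)
      then show ?thesis using \<epsilon>(2)[OF xy(1,2)] by auto
    qed
    show "\<exists>y\<in>X. \<forall>g\<in>carrier G. dist (\<phi> g y) (\<phi> g (v g)) < \<eta>"
      if v: "v \<in> carrier G \<rightarrow> X"
        and bd: "\<And>g h. g \<in> carrier G \<Longrightarrow> h \<in> E \<Longrightarrow> v (h \<otimes> g) \<noteq> v g \<Longrightarrow> dist (\<phi> g (v g)) z < \<delta>" for v
    proof -
      define A where "A x = {g \<in> carrier G. v g = x}" for x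
      have "de_designation G X \<phi> z \<delta>0 E0 (v ` carrier G) A (\<lambda>x. x)"
        unfolding de_designation_def designation_def
      proof (intro conjI ballI)
        show "disjoint_family_on A (v ` carrier G)" by (auto simp: disjoint_family_on_def A_def)
        show "(\<Union>i\<in>v ` carrier G. A i) = carrier G" by (auto simp: A_def)
        show "i \<in> X" if "i \<in> v ` carrier G" for i using that v by auto
        fix i g assume i: "i \<in> v ` carrier G" and g: "g \<in> boundary G E0 (A i)"
        then have gc: "g \<in> carrier G" "v g = i" by (auto simp: boundary_def A_def)
        obtain h where h: "h \<in> E0" "h \<otimes> g \<notin> A i" using g by (auto simp: boundary_def r_coset_def)
        then have "v (h \<otimes> g) \<noteq> v g" using gc E0 by (auto simp: A_def)
        then have "dist (\<phi> g (v g)) z < \<delta>" using bd[OF gc(1), of h] h(1) by (auto simp: E_def S_def)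
        then show "dist (\<phi> g i) z < \<delta>0" using gc \<delta> by simp
      qed
      from real[rule_format, OF this] obtain y where "realization X \<phi> \<eta> (v ` carrier G) A (\<lambda>x. x) y" by blast
      then have "y \<in> X" "\<And>g. g \<in> carrier G \<Longrightarrow> dist (\<phi> g y) (\<phi> g (v g)) < \<eta>"
        by (auto simp: realization_def A_def)
      then show ?thesis by blast
    qed
  qed (use endo asym \<delta> det in auto)
  then show ?thesis by blast
qed

section \<open>Nilpotency\<close>

theorem mainTheorem1:
  fixes G :: "('g, 'b) monoid_scheme"
    and X :: "'x::metric_space set"
    and \<phi> :: "'g \<Rightarrow> 'x \<Rightarrow> 'x"
    and z :: 'x
    and f :: "'x \<Rightarrow> 'x"
  assumes "group G"
    and "group_locally
           (\<lambda>H. residually_finite H \<and>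
                has_subnormal_series (group_locally (group_virtually comm_group)) H) G"
    and "pointed_dynamical_system G X \<phi> z"
    and "expansive G X \<phi>"
    and "zero_gluing G X \<phi> z"
    and "dense_homoclinic_points G X \<phi> z"
    and "system_endomorphism G X \<phi> z f"
    and "asymptotically_nilpotent X z f"
  shows "nilpotent_map X z f"
proof -
  obtain \<eta> \<delta> E where "windowed_endomorphism G X \<phi> z f \<eta> \<delta> E"
    using windowed_endomorphism_exists assms(3-5,7,8) by blast
  then interpret windowed_endomorphism G X \<phi> z f \<eta> \<delta> E .
  have "dying x" if x: "x \<in> X" "finite (supp x)" for x
  proof -
    interpret seeded_endomorphism G X \<phi> z f \<eta> \<delta> E x
      using x by unfold_locales
    have self: "subgroup (carrier G) G" by (rule subgroup_self)
    obtain C where C: "finite C" "C \<subseteq> carrier G"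
      "\<And>N'. subgroup N' G \<Longrightarrow> N' \<subseteq> carrier G \<Longrightarrow> C \<subseteq> N' \<Longrightarrow> confined N'"
      using confined_finitely_generated[OF confined_carrier self] by blast
    define H where "H = generate G C"
    have H: "subgroup H G" "C \<subseteq> H"
      unfolding H_def using generate_is_subgroup[OF C(2)] generate.incl by auto
    have conf: "confined H" using C(3) H subgroup.subset[OF H(1)] by blast
    have "finitely_generated (G\<lparr>carrier := H\<rparr>)"
      unfolding finitely_generated_def
      using C(1) H generate_consistent[OF H(2,1)] by (intro exI[of _ C]) (simp add: H_def)
    then have rf: "residually_finite (G\<lparr>carrier := H\<rparr>)"
      and ser: "has_subnormal_series (group_locally (group_virtually comm_group)) (G\<lparr>carrier := H\<rparr>)"
      using assms(2) H(1) unfolding group_locally_def by blast+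
    obtain n Hs where Hs: "Hs 0 = {\<one>\<^bsub>G\<^esub>}" "Hs n = H"
      "\<And>i. i \<le> n \<Longrightarrow> subgroup (Hs i) (G\<lparr>carrier := H\<rparr>)"
      "\<And>i. i < n \<Longrightarrow> Hs i \<lhd> G\<lparr>carrier := Hs (Suc i)\<rparr>"
      "\<And>i. i < n \<Longrightarrow> group_locally (group_virtually comm_group) (G\<lparr>carrier := Hs (Suc i)\<rparr> Mod Hs i)"
      using ser unfolding has_subnormal_series_def by auto
    have sub: "subgroup (Hs i) G" "Hs i \<subseteq> H" if "i \<le> n" for i
      using incl_subgroup[OF H(1) Hs(3)[OF that]] subgroup.subset[OF Hs(3)[OF that]] by auto
    show "dying x"
    proof (rule confined_series[of Hs n])
      show "subgroup (Hs n) G" "residual_within (Hs n)" "confined (Hs n)"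
        unfolding Hs(2) using H(1) residual_within_if_residually_finite[OF H(1) rf] conf by auto
      show "\<exists>A. subgroup A G \<and> A \<subseteq> generate G C' \<and> finite_index_in (generate G C') A \<and> commutators_in A (Hs i)"
        if "i < n" "finite C'" "C' \<subseteq> Hs (Suc i)" for i C'
        using that sub(1)[of "Suc i"] Hs(4,5)[OF that(1)]
        by (intro locally_virtually_abelian_quotient) auto
    qed (use Hs sub in auto)
  qed
  moreover have "X \<subseteq> closure {x \<in> X. finite (supp x)}"
  proof -
    have "finite (supp x)" if hom: "homoclinic G \<phi> z x" for x
    proof -
      obtain F where F: "finite F" "\<forall>g\<in>carrier G - F. dist (\<phi> g x) z < \<delta>"
        using hom[unfolded homoclinic_def, rule_format, OF threshold(1)] by (elim exE conjE) (rule that)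
      have "supp x \<subseteq> F"
      proof
        fix g assume "g \<in> supp x"
        then have "g \<in> carrier G" "\<not> dist (\<phi> g x) z < \<delta>" by (simp_all add: supp_def)
        then show "g \<in> F" using F(2) by blast
      qed
      then show ?thesis using F(1) finite_subset by blast
    qed
    then have "{x \<in> X. homoclinic G \<phi> z x} \<subseteq> {x \<in> X. finite (supp x)}" by blast
    then show ?thesis
      using assms(6) closure_mono unfolding dense_homoclinic_points_def by blast
  qed
  ultimately obtain n where "\<forall>x\<in>X. (f ^^ n) x = z"
    using nilpotent_if_homoclinic_dying by blast
  then have "(f ^^ n) ` X = {z}" using z_in by (auto intro!: image_eqI[of z _ z])
  then show ?thesis unfolding nilpotent_map_def by blast
qed

end
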